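(* Let $p$ be a prime, let $L$ be a field of characteristic $p$ with a fixed algebraic closure $\overline{L}$, and let $\overline{\mathbb{F}}_p$ denote the algebraic closure of $\mathbb{F}_p$ inside $\overline{L}$. Let $f(x)=c_1x^{d_1}+c_2x^{d_2}\in\overline{\mathbb{F}}_p[x]$ with $c_1,c_2\in\overline{\mathbb{F}}_p^*$, $1\le d_1<d_2$, and write $d_i=p^{\ell_i}s_i$ with integers $\ell_i\ge 0$ and $p\nmid s_i$. Assume $s_1,s_2>1$ and $$p^{\ell_2}(s_2-1)=p^{\ell_1}(s_1-1).$$ Let $\alpha,\beta\in L$. If $\mathrm{Prep}(f;\alpha,\beta)$ is infinite and $\alpha,\beta$ are not both contained in $\overline{\mathbb{F}}_p$, then either $f(\alpha)=f(\beta)$ or $$(f(\beta)-f(\alpha))^{p^{\ell_2}-p^{\ell_1}}=-\frac{c_1s_1}{c_2s_2}\in\overline{\mathbb{F}}_p^*.$$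
   Context: For $\lambda\in\overline{L}$ let $f_\lambda(x):=f(x)+\lambda\in\overline{L}[x]$. An element $\gamma$ is preperiodic under $f_\lambda$ if its forward orbit $\{f_\lambda^n(\gamma):n\ge0\}$ is finite. $\mathrm{Prep}(f;\alpha,\beta)$ denotes the set of all $\lambda\in\overline{L}$ such that both $\alpha$ and $\beta$ are preperiodic under $f_\lambda$. *)

theory Defs
  imports "HOL-Computational_Algebra.Computational_Algebra"
begin

definition is_subfield :: "'k::field set \<Rightarrow> bool" where
  "is_subfield F \<longleftrightarrow> 0 \<in> F \<and> 1 \<in> F \<and>
     (\<forall>x\<in>F. \<forall>y\<in>F. x + y \<in> F \<and> x * y \<in> F) \<and>
     (\<forall>x\<in>F. - x \<in> F \<and> inverse x \<in> F)"

definition algebraic_over :: "'k::field set \<Rightarrow> 'k \<Rightarrow> bool" where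
  "algebraic_over F x \<longleftrightarrow> (\<exists>q. q \<noteq> 0 \<and> (\<forall>i. coeff q i \<in> F) \<and> poly q x = 0)"

text \<open>The whole type \<^typ>\<open>'k\<close> is an algebraic closure of its subfield \<open>L\<close>;
  that \<^typ>\<open>'k\<close> is algebraically closed is part of its sort.\<close>

definition alg_closure_of :: "'k::alg_closed_field set \<Rightarrow> bool" where
  "alg_closure_of L \<longleftrightarrow> is_subfield L \<and> (\<forall>x. algebraic_over L x)"

text \<open>In a field of prime characteristic \<open>p\<close> the set \<open>\<int>\<close>, which is the range of
  \<^const>\<open>of_int\<close>, is the prime field with \<open>p\<close> elements.\<close>

definition Fp_bar :: "'k::field set" where
  "Fp_bar = {x. algebraic_over \<int> x}"

definition shift_poly :: "'k::field poly \<Rightarrow> 'k \<Rightarrow> 'k poly" where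
  "shift_poly f l = f + [:l:]"

definition preperiodic :: "'k::field poly \<Rightarrow> 'k \<Rightarrow> bool" where
  "preperiodic g \<gamma> \<longleftrightarrow> finite (range (\<lambda>n. (poly g ^^ n) \<gamma>))"

definition Prep :: "'k::field poly \<Rightarrow> 'k \<Rightarrow> 'k \<Rightarrow> 'k set" where
  "Prep f \<alpha> \<beta> = {l. preperiodic (shift_poly f l) \<alpha> \<and> preperiodic (shift_poly f l) \<beta>}"

end

theory Submission
  imports Defs
begin

text \<open>
  Put \<open>u = f \<beta> - f \<alpha>\<close> and \<open>P\<^sub>i = p^l\<^sub>i\<close>; the claim is that
  \<open>h u = c\<^sub>2 s\<^sub>2 u^P\<^sub>2 + c\<^sub>1 s\<^sub>1 u^P\<^sub>1\<close> vanishes. Fix a place with \<open>|\<alpha>| > 1\<close>. If \<open>\<lambda>\<close> is a parameter for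
  which \<open>\<alpha>\<close> is preperiodic, then every preperiodic point of \<open>f\<^sub>\<lambda>\<close> has absolute value \<open>|\<alpha>|\<close>, and two of
  them at distance less than \<open>|\<alpha>|\<close> have a difference \<open>w\<close> with \<open>|w| \<le> 1\<close> and \<open>|h w| < 1\<close>; this is where the
  relation between the exponents enters. Applied to \<open>f\<^sub>\<lambda> \<alpha>\<close> and \<open>f\<^sub>\<lambda> \<beta>\<close>, whose difference is \<open>u\<close>, it gives
  \<open>|h u| < 1\<close> as soon as \<open>|u| < |\<alpha>|\<close>. When this holds at all conjugates of \<open>\<beta>\<close> over \<open>Fp_bar(\<alpha>)\<close>, the norm
  of \<open>h u\<close> is integral over \<open>Fp_bar[\<alpha>]\<close> and vanishes at infinity, hence is \<open>0\<close>.

  It remains to exclude \<open>|u| = |\<alpha>|\<close>. The points \<open>f\<^sub>\<lambda> \<alpha>\<close> lie near the points \<open>\<zeta> \<alpha>\<close> with \<open>\<zeta>^s\<^sub>2 = 1\<close>, and so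
  do the points \<open>f\<^sub>\<lambda> \<alpha> + u\<close>. If every \<open>\<zeta>\<close> occurs, then translation by \<open>u/\<alpha>\<close> permutes the \<open>\<zeta>\<close> modulo the
  maximal ideal and summation gives \<open>|u| < |\<alpha>|\<close>. If some \<open>\<zeta>\<close> never occurs, dividing two roots near
  \<open>\<zeta> \<alpha>\<close> out of \<open>f X - f \<alpha>\<close> leaves a polynomial that is at most \<open>1/|\<alpha>|\<close> on all points \<open>f\<^sub>\<lambda> \<alpha>\<close>, so the
  discriminant of \<open>M\<close> parameters is at most \<open>|\<alpha>|^(- c M\<^sup>2)\<close> with a fixed \<open>c > 0\<close>. At the other
  conjugates the iterates of \<open>\<alpha>\<close>, as polynomials in \<open>\<lambda>\<close>, bound the discriminant by \<open>|\<alpha>|^(\<epsilon> M\<^sup>2)\<close> with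
  \<open>\<epsilon>\<close> as small as desired. Since there are infinitely many parameters, the norm of the discriminant
  would be nonzero, integral over \<open>Fp_bar[\<alpha>]\<close> and small at infinity, which is impossible.
\<close>

section \<open>Subrings and valuation rings\<close>

definition is_subring :: "'k::field set \<Rightarrow> bool" where
  "is_subring R \<longleftrightarrow> 1 \<in> R \<and> (\<forall>x\<in>R. \<forall>y\<in>R. x - y \<in> R \<and> x * y \<in> R)"

definition coeffs_in :: "'k::zero set \<Rightarrow> 'k poly \<Rightarrow> bool" where
  "coeffs_in R q \<longleftrightarrow> (\<forall>i. coeff q i \<in> R)"

definition adjoin :: "'k::field set \<Rightarrow> 'k \<Rightarrow> 'k set" where
  "adjoin R x = {poly q x |q. coeffs_in R q}"

text \<open>Places are represented by valuation rings of the whole field \<open>'k\<close>, so that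
  parameters and conjugates have a size at every place as well. The trivial case
  \<open>V = UNIV\<close> is included.\<close>

definition val_ring :: "'k::field set \<Rightarrow> bool" where
  "val_ring V \<longleftrightarrow> is_subring V \<and> (\<forall>x. x \<in> V \<or> inverse x \<in> V)"

lemma is_subring_1: "is_subring R \<Longrightarrow> 1 \<in> R"
  and is_subring_diff: "is_subring R \<Longrightarrow> x \<in> R \<Longrightarrow> y \<in> R \<Longrightarrow> x - y \<in> R"
  and is_subring_mult: "is_subring R \<Longrightarrow> x \<in> R \<Longrightarrow> y \<in> R \<Longrightarrow> x * y \<in> R"
  unfolding is_subring_def by blast+

lemma is_subring_0: "is_subring R \<Longrightarrow> 0 \<in> R"
  using is_subring_diff[of R 1 1] is_subring_1[of R] by simp

lemma is_subring_minus: "is_subring R \<Longrightarrow> x \<in> R \<Longrightarrow> - x \<in> R"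
  using is_subring_diff[of R 0 x] is_subring_0[of R] by simp

lemma is_subring_add: "is_subring R \<Longrightarrow> x \<in> R \<Longrightarrow> y \<in> R \<Longrightarrow> x + y \<in> R"
  using is_subring_diff[of R x "- y"] is_subring_minus[of R y] by simp

lemma is_subring_power: "is_subring R \<Longrightarrow> x \<in> R \<Longrightarrow> x ^ n \<in> R"
  by (induction n) (auto intro: is_subring_1 is_subring_mult)

lemma is_subring_sum:
  assumes "is_subring R" "\<And>i. i \<in> I \<Longrightarrow> g i \<in> R"
  shows "sum g I \<in> R"
  using assms(2)
  by (induction I rule: infinite_finite_induct) (auto intro: is_subring_0 is_subring_add assms(1))

lemma is_subring_prod:
  assumes "is_subring R" "\<And>i. i \<in> I \<Longrightarrow> g i \<in> R"
  shows "prod g I \<in> R"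
  using assms(2)
  by (induction I rule: infinite_finite_induct) (auto intro: is_subring_1 is_subring_mult assms(1))

lemma is_subring_of_nat: "is_subring R \<Longrightarrow> of_nat n \<in> R"
  by (induction n) (auto intro: is_subring_0 is_subring_1 is_subring_add)

lemma is_subring_Ints_self: "is_subring \<int>"
  by (auto simp: is_subring_def)

lemma coeffs_in_mono: "coeffs_in R q \<Longrightarrow> R \<subseteq> R' \<Longrightarrow> coeffs_in R' q"
  by (auto simp: coeffs_in_def)

lemma coeffs_in_pCons: "coeffs_in R (pCons a q) \<longleftrightarrow> a \<in> R \<and> coeffs_in R q"
  unfolding coeffs_in_def coeff_pCons by (metis nat.case nat.exhaust)

lemma coeffs_in_0: "is_subring R \<Longrightarrow> coeffs_in R 0"
  by (auto simp: coeffs_in_def is_subring_0)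

lemma coeffs_in_1: "is_subring R \<Longrightarrow> coeffs_in R 1"
  by (auto simp: coeffs_in_def is_subring_0 is_subring_1)

lemma coeffs_in_monom: "is_subring R \<Longrightarrow> a \<in> R \<Longrightarrow> coeffs_in R (monom a n)"
  by (auto simp: coeffs_in_def is_subring_0)

lemma coeffs_in_add: "is_subring R \<Longrightarrow> coeffs_in R q \<Longrightarrow> coeffs_in R r \<Longrightarrow> coeffs_in R (q + r)"
  by (auto simp: coeffs_in_def is_subring_add)

lemma coeffs_in_diff: "is_subring R \<Longrightarrow> coeffs_in R q \<Longrightarrow> coeffs_in R r \<Longrightarrow> coeffs_in R (q - r)"
  by (auto simp: coeffs_in_def is_subring_diff)

lemma coeffs_in_mult: "is_subring R \<Longrightarrow> coeffs_in R q \<Longrightarrow> coeffs_in R r \<Longrightarrow> coeffs_in R (q * r)"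
  by (auto simp: coeffs_in_def coeff_mult intro!: is_subring_sum is_subring_mult)

lemma coeffs_in_smult: "is_subring R \<Longrightarrow> a \<in> R \<Longrightarrow> coeffs_in R r \<Longrightarrow> coeffs_in R (smult a r)"
  by (auto simp: coeffs_in_def intro!: is_subring_mult)

lemma coeffs_in_power: "is_subring R \<Longrightarrow> coeffs_in R q \<Longrightarrow> coeffs_in R (q ^ n)"
  by (induction n) (auto intro: coeffs_in_1 coeffs_in_mult)

lemma is_subring_adjoin:
  assumes "is_subring R" shows "is_subring (adjoin R x)"
  unfolding is_subring_def
proof (intro conjI ballI)
  show "1 \<in> adjoin R x"
    unfolding adjoin_def using coeffs_in_1[OF assms] by (force intro: exI[of _ 1])
  fix a b assume "a \<in> adjoin R x" "b \<in> adjoin R x"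
  then obtain q r where "coeffs_in R q" "coeffs_in R r" "a = poly q x" "b = poly r x"
    unfolding adjoin_def by blast
  then show "a - b \<in> adjoin R x" "a * b \<in> adjoin R x"
    unfolding adjoin_def using coeffs_in_diff[OF assms, of q r] coeffs_in_mult[OF assms, of q r]
    by (force intro: exI[of _ "q - r"], force intro: exI[of _ "q * r"])
qed

lemma adjoin_superset:
  assumes "is_subring R" shows "R \<subseteq> adjoin R x"
proof
  fix a assume "a \<in> R"
  then have "coeffs_in R [:a:]" using assms by (simp add: coeffs_in_pCons coeffs_in_0)
  then show "a \<in> adjoin R x" unfolding adjoin_def by (force intro: exI[of _ "[:a:]"])
qed

lemma in_adjoin:
  assumes "is_subring R" shows "x \<in> adjoin R x"
proof -
  have "coeffs_in R [:0, 1:]"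
    using assms by (simp add: coeffs_in_pCons coeffs_in_0 is_subring_0 is_subring_1)
  then show ?thesis unfolding adjoin_def by (force intro: exI[of _ "[:0,1:]"])
qed

lemma power_mult_poly_inverse:
  assumes "is_subring R" "coeffs_in R q" "x \<in> R" "x \<noteq> 0" "degree q \<le> n"
  shows "x ^ n * poly q (inverse x) \<in> R"
proof -
  have "x ^ n * poly q (inverse x) = (\<Sum>i\<le>degree q. coeff q i * x ^ (n - i))"
    using assms(4,5)
    by (auto simp: poly_altdef sum_distrib_left power_diff power_inverse field_simps
        intro!: sum.cong)
  also have "\<dots> \<in> R"
    using assms by (intro is_subring_sum is_subring_mult is_subring_power) (auto simp: coeffs_in_def)
  finally show ?thesis .
qed

text \<open>A relation of minimal degree \<open>n\<close> for \<open>z\<close> with coefficients in the ideal \<open>tV\<close> can be shortened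
  by means of one of degree \<open>m \<le> n\<close> for \<open>1/z\<close>.\<close>

lemma shorten_relation:
  fixes z t :: "'k::field"
  assumes V: "is_subring V" and t: "t \<in> V" "t \<noteq> 0"
    and unit: "\<And>j. j \<in> V \<Longrightarrow> inverse (1 - t * j) \<in> V \<and> 1 - t * j \<noteq> 0"
    and z: "z \<noteq> 0"
    and P: "coeffs_in V P" "t * poly P z = 1" "degree P = n"
    and Q: "coeffs_in V Q" "t * poly Q (inverse z) = 1" "degree Q \<le> n"
    and n: "0 < n"
  shows "\<exists>P'. coeffs_in V P' \<and> t * poly P' z = 1 \<and> degree P' < n"
proof -
  define w where "w = inverse (1 - t * coeff Q 0)"
  have Qi: "coeff Q i \<in> V" for i using Q(1) by (auto simp: coeffs_in_def)
  have Pi: "coeff P i \<in> V" for i using P(1) by (auto simp: coeffs_in_def)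
  have w: "w \<in> V" "w * (1 - t * coeff Q 0) = 1"
    using unit[OF Qi[of 0]] by (auto simp: w_def)
  have "poly Q (inverse z) = (\<Sum>i\<le>n. coeff Q i * inverse z ^ i)"
    unfolding poly_altdef using Q(3)
    by (intro sum.mono_neutral_left) (auto simp: coeff_eq_0)
  also have "\<dots> = coeff Q 0 + (\<Sum>i=1..n. coeff Q i * inverse z ^ i)"
    by (simp add: atLeast0AtMost[symmetric] sum.atLeast_Suc_atMost)
  finally have "1 - t * coeff Q 0 = t * (\<Sum>i=1..n. coeff Q i * inverse z ^ i)"
    using Q(2) by (simp add: algebra_simps)
  then have "z ^ n * (1 - t * coeff Q 0) = t * (\<Sum>i=1..n. coeff Q i * (inverse z ^ i * z ^ n))"
    by (simp add: sum_distrib_left mult_ac)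
  also have "(\<Sum>i=1..n. coeff Q i * (inverse z ^ i * z ^ n)) = (\<Sum>i=1..n. coeff Q i * z ^ (n - i))"
    by (intro sum.cong refl) (use z in \<open>auto simp: power_diff power_inverse field_simps\<close>)
  \<comment> \<open>The relation for \<open>1/z\<close> is solved for \<open>z ^ n\<close>: only
    lower powers of \<open>z\<close> remain, and they can replace the leading term of
    \<open>P\<close>.\<close>
  finally have zn: "z ^ n = t * w * (\<Sum>i=1..n. coeff Q i * z ^ (n - i))"
    using w(2) by (metis (no_types, lifting) mult.assoc mult.commute mult.right_neutral)
  define R where "R = smult (t * w * coeff P n) (\<Sum>i=1..n. monom (coeff Q i) (n - i))"
  define P' where "P' = P - monom (coeff P n) n + R"
  have cin: "coeffs_in V P'"
    unfolding P'_def R_def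
    by (intro coeffs_in_add coeffs_in_diff coeffs_in_smult coeffs_in_monom V P Pi is_subring_mult w t)
       (auto simp: coeffs_in_def coeff_sum intro!: is_subring_sum V Qi is_subring_0)
  have "poly R z = coeff P n * z ^ n"
    unfolding zn R_def by (simp add: poly_sum poly_monom sum_distrib_left mult_ac)
  then have "poly P' z = poly P z"
    by (simp add: P'_def poly_monom)
  moreover have "degree P' < n"
  proof (rule degree_lessI)
    show "\<forall>k\<ge>n. coeff P' k = 0"
    proof (intro allI impI)
      fix k assume k: "n \<le> k"
      have "coeff R k = 0"
        using k n by (auto simp: R_def coeff_sum intro!: sum.neutral)
      moreover have "coeff (P - monom (coeff P n) n) k = 0"
        using k P(3) by (auto simp: coeff_eq_0)
      ultimately show "coeff P' k = 0" by (simp add: P'_def)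
    qed
  qed (use n in auto)
  ultimately show ?thesis using cin P(2) by auto
qed

text \<open>Chevalley's extension argument: Zorn's lemma gives a subring \<open>V\<close> that
  contains \<open>A\<close> and \<open>1/x\<close> and is maximal among those missing
  \<open>x\<close>; then \<open>shorten_relation\<close> shows that \<open>V\<close> is a valuation
  ring.\<close>

theorem exists_val_ring:
  fixes x :: "'k::field"
  assumes A: "is_subring A" and x: "x \<notin> adjoin A (inverse x)"
  shows "\<exists>V. val_ring V \<and> A \<subseteq> V \<and> x \<notin> V"
proof -
  define \<A> where "\<A> = {R. is_subring R \<and> adjoin A (inverse x) \<subseteq> R \<and> x \<notin> R}"
  have "\<exists>M\<in>\<A>. \<forall>X\<in>\<A>. M \<subseteq> X \<longrightarrow> X = M"
  proof (rule subset_Zorn_nonempty)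
    show "\<A> \<noteq> {}" using is_subring_adjoin[OF A] x by (auto simp: \<A>_def)
    fix \<C> assume C: "\<C> \<noteq> {}" "subset.chain \<A> \<C>"
    have "is_subring (\<Union>\<C>)"
      unfolding is_subring_def
    proof (intro conjI ballI)
      show "1 \<in> \<Union>\<C>" using C unfolding subset.chain_def \<A>_def by (blast dest: is_subring_1)
      fix a b assume "a \<in> \<Union>\<C>" "b \<in> \<Union>\<C>"
      then obtain R where "R \<in> \<C>" "a \<in> R" "b \<in> R"
        using C(2) unfolding subset.chain_def by blast
      moreover from this have "is_subring R" using C by (auto simp: subset.chain_def \<A>_def)
      ultimately show "a - b \<in> \<Union>\<C>" "a * b \<in> \<Union>\<C>"
        by (auto intro: is_subring_diff is_subring_mult)
    qed
    then show "\<Union>\<C> \<in> \<A>" using C by (auto simp: subset.chain_def \<A>_def)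
  qed
  then obtain V where VA: "V \<in> \<A>" and mx: "\<And>X. X \<in> \<A> \<Longrightarrow> V \<subseteq> X \<Longrightarrow> X = V" by metis
  then have V: "is_subring V" "adjoin A (inverse x) \<subseteq> V" "x \<notin> V" by (simp_all add: \<A>_def)
  have max: "X = V" if "is_subring X" "V \<subseteq> X" "x \<notin> X" for X
    using mx[of X] that V(2) by (simp add: \<A>_def)
  define t where "t = inverse x"
  have x0: "x \<noteq> 0" using V is_subring_0 by blast
  have t: "t \<in> V" "t \<noteq> 0" and xt: "x * t = 1"
    using in_adjoin[OF A] V(2) x0 by (auto simp: t_def)
  have ext: "x \<in> adjoin V z" if "z \<notin> V" for z
    using max[OF is_subring_adjoin[OF V(1)] adjoin_superset[OF V(1)]] in_adjoin[OF V(1)] that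
    by metis
  have ne: "1 - t * j \<noteq> 0" if "j \<in> V" for j
  proof
    assume "1 - t * j = 0"
    then have "x = j" using xt by (metis eq_iff_diff_eq_0 mult.commute mult_right_cancel t(2))
    with that V(3) show False by simp
  qed
  \<comment> \<open>Otherwise \<open>x\<close> lies in \<open>V[1/(1 - t j)]\<close>; clearing
    denominators puts a multiple \<open>(1 - t j) ^ d * x\<close> into \<open>V\<close>, and this
    differs from \<open>x\<close> by an element of \<open>V\<close> because
    \<open>x * t = 1\<close>.\<close>
  have unit: "inverse (1 - t * j) \<in> V" if j: "j \<in> V" for j
  proof (rule ccontr)
    assume "inverse (1 - t * j) \<notin> V"
    then obtain q where q: "coeffs_in V q" "x = poly q (inverse (1 - t * j))"
      using ext unfolding adjoin_def by blast
    have "1 - t * j \<in> V" by (intro is_subring_diff is_subring_1 is_subring_mult V t j)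
    then have 1: "(1 - t * j) ^ degree q * x \<in> V"
      unfolding q(2) by (intro power_mult_poly_inverse V q ne j) auto
    have "\<exists>i\<in>V. (1 - t * j) ^ n = 1 - t * i" for n
    proof (induction n)
      case 0 then show ?case using is_subring_0[OF V(1)] by auto
    next
      case (Suc n)
      then obtain i where i: "i \<in> V" "(1 - t * j) ^ n = 1 - t * i" by blast
      have "(1 - t * j) ^ Suc n = 1 - t * (i + j - t * j * i)"
        unfolding power_Suc i(2) by (simp add: algebra_simps)
      moreover have "i + j - t * j * i \<in> V"
        by (intro is_subring_diff is_subring_add is_subring_mult V t i j)
      ultimately show ?case by blast
    qed
    then obtain i where i: "i \<in> V" "(1 - t * j) ^ degree q = 1 - t * i" by blast
    have "x = (1 - t * j) ^ degree q * x + i"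
      unfolding i(2) using xt by (simp add: left_diff_distrib mult.assoc mult.left_commute[of i])
         (simp add: mult_ac)
    then have "x \<in> V" using 1 i(1) V(1) by (metis is_subring_add)
    with V(3) show False ..
  qed
  \<comment> \<open>\<open>t * poly P z = 1\<close> says \<open>x = poly P z\<close>; by maximality
    of \<open>V\<close> such a relation exists for every \<open>z\<close> outside
    \<open>V\<close>.\<close>
  define Rel where "Rel z n \<longleftrightarrow> (\<exists>P. coeffs_in V P \<and> t * poly P z = 1 \<and> degree P = n)" for z n
  have Rel_pos: "0 < n" if rel: "Rel z n" for z n
  proof (rule ccontr)
    assume "\<not> 0 < n"
    then obtain P where P: "coeffs_in V P" "t * poly P z = 1" "degree P = 0"
      using rel by (auto simp: Rel_def)
    then obtain a where "P = [:a:]" by (metis degree_eq_zeroE)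
    with P have "a \<in> V" "1 - t * a = 0" using V(1) by (auto simp: coeffs_in_pCons)
    with ne show False by blast
  qed
  have Rel_ex: "\<exists>n. Rel z n" if "z \<notin> V" for z
    using ext[OF that] xt unfolding Rel_def adjoin_def by (auto simp: mult.commute)
  have less: False
    if z: "z \<noteq> 0" and n: "Rel z n" "\<And>k. k < n \<Longrightarrow> \<not> Rel z k"
      and m: "Rel (inverse z) m" "m \<le> n" for z n m
  proof -
    obtain P where P: "coeffs_in V P" "t * poly P z = 1" "degree P = n"
      using n(1) by (auto simp: Rel_def)
    obtain Q where Q: "coeffs_in V Q" "t * poly Q (inverse z) = 1" "degree Q = m"
      using m(1) by (auto simp: Rel_def)
    have "\<exists>P'. coeffs_in V P' \<and> t * poly P' z = 1 \<and> degree P' < n"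
      using shorten_relation[OF V(1) t _ z P Q(1,2)] unit ne Q(3) m(2) Rel_pos[OF n(1)] by blast
    with n(2) show False by (auto simp: Rel_def)
  qed
  have "z \<in> V \<or> inverse z \<in> V" for z
  proof (rule ccontr)
    assume "\<not> (z \<in> V \<or> inverse z \<in> V)"
    then have z: "z \<notin> V" "inverse z \<notin> V" "z \<noteq> 0"
      using is_subring_0[OF V(1)] by auto
    \<comment> \<open>Of the two minimal relations, for \<open>z\<close> and for \<open>1/z\<close>,
      the longer one is shortened by the other.\<close>
    define n where "n = (LEAST n. Rel z n)"
    define m where "m = (LEAST n. Rel (inverse z) n)"
    have n: "Rel z n" "\<And>k. k < n \<Longrightarrow> \<not> Rel z k"
      using LeastI_ex[OF Rel_ex[OF z(1)]] not_less_Least unfolding n_def by auto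
    have m: "Rel (inverse z) m" "\<And>k. k < m \<Longrightarrow> \<not> Rel (inverse z) k"
      using LeastI_ex[OF Rel_ex[OF z(2)]] not_less_Least unfolding m_def by auto
    show False
    proof (cases "m \<le> n")
      case True then show ?thesis using less[OF z(3) n m(1)] by simp
    next
      case False
      then show ?thesis using less[of "inverse z" m n] z(3) m n(1) by simp
    qed
  qed
  then have "val_ring V" using V(1) by (auto simp: val_ring_def)
  with V(2,3) adjoin_superset[OF A] show ?thesis by blast
qed

text \<open>If \<open>x\<close> were not in \<open>A[1/x]\<close>, some valuation ring containing
  \<open>A\<close> would miss it; a relation \<open>x = q(1/x)\<close> becomes a polynomial equation
  after multiplication by a power of \<open>x\<close>.\<close>

lemma algebraic_if_in_all_val_rings:
  fixes x :: "'k::field"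
  assumes A: "is_subring A" and all: "\<And>V. val_ring V \<Longrightarrow> A \<subseteq> V \<Longrightarrow> x \<in> V"
  shows "\<exists>P. P \<noteq> 0 \<and> coeffs_in A P \<and> poly P x = 0"
proof (cases "x = 0")
  case True
  have "coeffs_in A [:0, 1:]"
    using A by (simp add: coeffs_in_pCons coeffs_in_0 is_subring_0 is_subring_1)
  with True show ?thesis by (intro exI[of _ "[:0,1:]"]) auto
next
  case False
  have "x \<in> adjoin A (inverse x)" using exists_val_ring[OF A] all by blast
  then obtain q where q: "coeffs_in A q" "x = poly q (inverse x)" unfolding adjoin_def by blast
  define P where "P = monom 1 (Suc (degree q)) - reflect_poly q"
  have "coeffs_in A (reflect_poly q)"
    using q A by (auto simp: coeffs_in_def coeff_reflect_poly intro: is_subring_0)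
  then have "coeffs_in A P"
    unfolding P_def by (intro coeffs_in_diff coeffs_in_monom A is_subring_1)
  moreover have "coeff P (Suc (degree q)) = 1"
    by (simp add: P_def coeff_reflect_poly)
  then have "P \<noteq> 0" by auto
  moreover have "poly P x = 0"
    using q(2) False by (simp add: P_def poly_monom poly_reflect_poly_nz mult.commute)
  ultimately show ?thesis by blast
qed

section \<open>The algebraic closure of the prime field\<close>

lemma power_char_diff:
  fixes x y :: "'k::field"
  assumes "prime CHAR('k)"
  shows "(x - y) ^ (CHAR('k) ^ n) = x ^ (CHAR('k) ^ n) - y ^ (CHAR('k) ^ n)"
  using freshmans_dream'[OF assms refl, of "x - y" y n] by (simp add: eq_diff_eq)

lemma power_char_inj:
  fixes x y :: "'k::field"
  assumes "prime CHAR('k)" "x ^ (CHAR('k) ^ n) = y ^ (CHAR('k) ^ n)"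
  shows "x = y"
  using power_char_diff[OF assms(1), of x y n] assms(2) by simp

lemma of_nat_power_char:
  assumes "prime CHAR('k::field)"
  shows "(of_nat s :: 'k) ^ (CHAR('k) ^ n) = of_nat s"
proof (induction s)
  case 0
  then show ?case using assms by (simp add: prime_gt_0_nat)
next
  case (Suc s)
  then show ?case using freshmans_dream'[OF assms refl, of 1 "of_nat s" n] by simp
qed

lemma Ints_eq_of_nat_image:
  assumes "prime CHAR('k::field)"
  shows "(\<int> :: 'k set) = of_nat ` {..<CHAR('k)}"
proof (intro equalityI subsetI)
  fix x :: 'k assume "x \<in> \<int>"
  then obtain a where "x = of_int a" by (rule Ints_cases)
  then obtain n where "x = of_nat n \<or> x = - of_nat n"
    by (metis int_cases2 of_int_minus of_int_of_nat_eq)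
  then have "\<exists>m. x = of_nat m"
  proof
    assume x: "x = - of_nat n"
    have "of_nat (n * (CHAR('k) - 1)) + of_nat n = (of_nat (n * CHAR('k)) :: 'k)"
      using prime_gt_0_nat[OF assms] unfolding of_nat_add[symmetric]
      by (metis Suc_pred' add.commute mult_Suc_right)
    then have "x = of_nat (n * (CHAR('k) - 1))"
      unfolding x by (metis add.commute add_eq_0_iff mult_zero_right of_nat_CHAR of_nat_mult)
    then show ?thesis by blast
  qed auto
  then obtain m where "x = of_nat m" by blast
  moreover have "(of_nat m :: 'k) = of_nat (m mod CHAR('k))"
    using arg_cong[OF div_mult_mod_eq[of m "CHAR('k)", symmetric], of "of_nat :: nat \<Rightarrow> 'k"]
    by (simp only: of_nat_add of_nat_mult of_nat_CHAR mult_zero_right add_0)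
  ultimately show "x \<in> of_nat ` {..<CHAR('k)}"
    using prime_gt_0_nat[OF assms] by auto
qed auto

lemma power_char_Ints:
  assumes "prime CHAR('k::field)" "(x :: 'k) \<in> \<int>"
  shows "x ^ (CHAR('k) ^ n) = x"
proof -
  obtain s where "x = of_nat s" using assms Ints_eq_of_nat_image[OF assms(1)] by (metis imageE)
  then show ?thesis by (simp add: of_nat_power_char assms(1))
qed

lemma inverse_Ints:
  assumes "prime CHAR('k::field)" "(x :: 'k) \<in> \<int>"
  shows "inverse x \<in> \<int>"
proof (cases "x = 0")
  case False
  have p: "CHAR('k) = Suc (Suc (CHAR('k) - 2))" using prime_ge_2_nat[OF assms(1)] by simp
  have "x * x ^ (CHAR('k) - 2) * x = x ^ CHAR('k)" by (subst (2) p) simp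
  also have "\<dots> = x" using power_char_Ints[OF assms, of 1] by simp
  finally have "x * x ^ (CHAR('k) - 2) = 1" using False by simp
  then have "inverse x = x ^ (CHAR('k) - 2)" by (rule inverse_unique)
  then show ?thesis using assms(2) by simp
qed (use assms in auto)

text \<open>An equation of degree \<open>d\<close> over the prime field rewrites
  \<open>x ^ d\<close>, so all powers of \<open>x\<close> stay in the finite set \<open>W\<close> of
  combinations of \<open>1, ..., x ^ (d - 1)\<close> with coefficients in the prime field.\<close>

lemma finite_powers_algebraic:
  fixes x :: "'k::field"
  assumes p: "prime CHAR('k)" and x: "x \<in> Fp_bar"
  shows "finite (range (\<lambda>m. x ^ m))"
proof -
  obtain q where q: "q \<noteq> 0" "\<And>i. coeff q i \<in> \<int>" "poly q x = 0"
    using x by (auto simp: Fp_bar_def algebraic_over_def)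
  define d where "d = degree q"
  have d: "0 < d" using q(1,3) unfolding d_def
    by (metis degree_eq_zeroE gr0I pCons_0_0 poly_const_conv)
  define W where "W = (\<lambda>g. \<Sum>i<d. g i * x ^ i) ` ({..<d} \<rightarrow>\<^sub>E (\<int> :: 'k set))"
  have finW: "finite W"
    unfolding W_def by (intro finite_imageI finite_PiE) (simp_all add: Ints_eq_of_nat_image[OF p])
  have WI: "(\<Sum>i<d. g i * x ^ i) \<in> W" if "\<And>i. i < d \<Longrightarrow> g i \<in> \<int>" for g
    unfolding W_def by (rule image_eqI[of _ _ "restrict g {..<d}"]) (use that in auto)
  define a where "a i = - coeff q i * inverse (coeff q d)" for i
  have a: "a i \<in> \<int>" for i unfolding a_def using q(2) inverse_Ints[OF p q(2)] by auto
  have "(\<Sum>i\<le>d. coeff q i * x ^ i) = 0" using q(3) by (simp add: poly_altdef d_def)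
  then have "coeff q d * x ^ d = - (\<Sum>i<d. coeff q i * x ^ i)"
    by (simp add: lessThan_Suc_atMost[symmetric] eq_neg_iff_add_eq_0 add.commute)
  moreover have "coeff q d \<noteq> 0" using q(1) by (simp add: d_def)
  ultimately have "x ^ d = inverse (coeff q d) * - (\<Sum>i<d. coeff q i * x ^ i)"
    by (metis left_inverse mult.assoc mult_1)
  then have xd: "x ^ d = (\<Sum>i<d. a i * x ^ i)"
    by (simp add: a_def sum_distrib_left sum_negf[symmetric] mult_ac)
  have step: "x * w \<in> W" if w: "w \<in> W" for w
  proof -
    obtain g where g: "w = (\<Sum>i<d. g i * x ^ i)" "\<And>i. i < d \<Longrightarrow> g i \<in> \<int>"
      using w unfolding W_def by auto
    obtain e where e: "d = Suc e" using d by (cases d) auto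
    define h where "h i = (if i = 0 then 0 else g (i - 1)) + g e * a i" for i
    have "x * w = (\<Sum>i<e. g i * x ^ Suc i) + g e * x ^ d"
      unfolding g(1) by (simp add: e sum_distrib_left algebra_simps)
    also have "(\<Sum>i<e. g i * x ^ Suc i) = (\<Sum>i<d. (if i = 0 then 0 else g (i - 1)) * x ^ i)"
      unfolding e by (simp add: sum.lessThan_Suc_shift del: sum.lessThan_Suc)
    also have "\<dots> + g e * x ^ d = (\<Sum>i<d. h i * x ^ i)"
      unfolding xd by (simp add: h_def sum_distrib_left sum.distrib algebra_simps)
    finally show ?thesis
      using WI[of h] g(2) a e by (auto simp: h_def)
  qed
  have "x ^ m \<in> W" for m
  proof (induction m)
    case 0
    have "(\<Sum>i<d. (if i = 0 then 1 else 0) * x ^ i) = x ^ 0"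
      using d by (subst sum.remove[of _ 0]) auto
    with WI[of "\<lambda>i. if i = 0 then 1 else 0"] show ?case by simp
  qed (use step in simp)
  then show ?thesis using finW by (blast intro: finite_subset)
qed

text \<open>Two Frobenius iterates of \<open>x\<close> coincide because its powers form a finite
  set, and Frobenius is injective. In this form the closure of \<open>Fp_bar\<close> under the field
  operations follows from Frobenius being a ring homomorphism.\<close>

lemma Fp_bar_iff:
  fixes x :: "'k::field"
  assumes p: "prime CHAR('k)"
  shows "x \<in> Fp_bar \<longleftrightarrow> (\<exists>n>0. x ^ (CHAR('k) ^ n) = x)"
proof
  assume "x \<in> Fp_bar"
  then have "finite (range (\<lambda>m. x ^ m))" by (rule finite_powers_algebraic[OF p])
  then have "finite (range (\<lambda>m. x ^ (CHAR('k) ^ m)))"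
    by (rule finite_subset[rotated]) auto
  then have "\<not> inj (\<lambda>m. x ^ (CHAR('k) ^ m))" using infinite_UNIV_nat finite_imageD by blast
  then obtain i j where ij: "i < j" "x ^ (CHAR('k) ^ i) = x ^ (CHAR('k) ^ j)"
    unfolding inj_def by (metis nat_neq_iff)
  have "CHAR('k) ^ j = CHAR('k) ^ (j - i) * CHAR('k) ^ i"
    using ij(1) by (simp add: power_add[symmetric])
  then have "(x ^ (CHAR('k) ^ (j - i))) ^ (CHAR('k) ^ i) = x ^ (CHAR('k) ^ i)"
    using ij(2) by (simp add: power_mult[symmetric])
  from power_char_inj[OF p this] ij(1) show "\<exists>n>0. x ^ (CHAR('k) ^ n) = x"
    by (intro exI[of _ "j - i"]) auto
next
  assume "\<exists>n>0. x ^ (CHAR('k) ^ n) = x"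
  then obtain n where n: "n > 0" "x ^ (CHAR('k) ^ n) = x" by blast
  define q where "q = monom (1::'k) (CHAR('k) ^ n) - monom 1 1"
  have "CHAR('k) ^ n \<noteq> 1"
    using one_less_power[OF prime_gt_1_nat[OF p] n(1)] by linarith
  from this[symmetric] have "coeff q (CHAR('k) ^ n) = 1" by (simp add: q_def)
  then have "q \<noteq> 0" by auto
  moreover have "coeff q i \<in> \<int>" for i by (auto simp: q_def)
  moreover have "poly q x = 0" using n(2) by (simp add: q_def poly_monom)
  ultimately show "x \<in> Fp_bar" by (auto simp: Fp_bar_def algebraic_over_def)
qed

lemma power_char_fixed_multiple:
  fixes x :: "'k::field"
  assumes "x ^ (CHAR('k) ^ n) = x"
  shows "x ^ (CHAR('k) ^ (n * k)) = x"
  by (induction k) (use assms in \<open>simp_all add: power_add power_mult mult.commute\<close>)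

lemma Fp_bar_common_exponent:
  fixes x y :: "'k::field"
  assumes p: "prime CHAR('k)" and "x \<in> Fp_bar" "y \<in> Fp_bar"
  obtains n where "n > 0" "x ^ (CHAR('k) ^ n) = x" "y ^ (CHAR('k) ^ n) = y"
proof -
  obtain i j where "i > 0" "x ^ (CHAR('k) ^ i) = x" "j > 0" "y ^ (CHAR('k) ^ j) = y"
    using assms Fp_bar_iff[OF p] by blast
  then show ?thesis
    using that[of "i * j"] power_char_fixed_multiple[of x i j] power_char_fixed_multiple[of y j i]
    by (simp add: mult.commute)
qed

lemma is_subring_Fp_bar:
  assumes p: "prime CHAR('k::field)"
  shows "is_subring (Fp_bar :: 'k set)"
  unfolding is_subring_def
proof (intro conjI ballI)
  show "(1::'k) \<in> Fp_bar" unfolding Fp_bar_iff[OF p] by (auto intro: exI[of _ 1])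
  fix x y :: 'k assume "x \<in> Fp_bar" "y \<in> Fp_bar"
  then obtain n where n: "n > 0" "x ^ (CHAR('k) ^ n) = x" "y ^ (CHAR('k) ^ n) = y"
    using Fp_bar_common_exponent[OF p] by blast
  then show "x - y \<in> Fp_bar" "x * y \<in> Fp_bar"
    unfolding Fp_bar_iff[OF p] using power_char_diff[OF p, of x y n]
    by (auto simp: power_mult_distrib intro!: exI[of _ n])
qed

lemma inverse_Fp_bar:
  assumes p: "prime CHAR('k::field)" and "(x::'k) \<in> Fp_bar"
  shows "inverse x \<in> Fp_bar"
  using assms(2) unfolding Fp_bar_iff[OF p] by (auto simp: power_inverse)

lemma Fp_bar_root_of_unity:
  assumes p: "prime CHAR('k::field)" and "(x::'k) \<in> Fp_bar" "x \<noteq> 0"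
  obtains m where "m > 0" "x ^ m = 1"
proof -
  obtain n where n: "n > 0" "x ^ (CHAR('k) ^ n) = x" using assms Fp_bar_iff[OF p] by blast
  define m where "m = CHAR('k) ^ n - 1"
  have "1 < CHAR('k) ^ n" using n(1) prime_gt_1_nat[OF p] by (metis one_less_power)
  then have m: "m > 0" "CHAR('k) ^ n = Suc m" unfolding m_def by auto
  have "x * x ^ m = x" using n(2) unfolding m(2) by simp
  then have "x ^ m = 1" using assms(3) by simp
  with m(1) show ?thesis using that by blast
qed

lemma root_of_unity_Fp_bar:
  fixes x :: "'k::field"
  assumes "m > 0" "x ^ m = 1"
  shows "x \<in> Fp_bar"
proof -
  define q where "q = monom (1::'k) m - monom 1 0"
  have "coeff q m = 1" using assms(1) by (simp add: q_def)
  then have "q \<noteq> 0" by auto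
  moreover have "coeff q i \<in> \<int>" for i by (auto simp: q_def)
  moreover have "poly q x = 0" using assms(2) by (simp add: q_def poly_monom)
  ultimately show ?thesis by (auto simp: Fp_bar_def algebraic_over_def)
qed

text \<open>Read contrapositively: an element outside \<open>Fp_bar\<close> has a place where it is
  not integral. This supplies the places with \<open>|\<alpha>| > 1\<close>.\<close>

lemma in_all_val_rings_Fp_bar:
  fixes x :: "'k::field"
  assumes "\<And>V. val_ring V \<Longrightarrow> x \<in> V"
  shows "x \<in> Fp_bar"
  using algebraic_if_in_all_val_rings[OF is_subring_Ints_self, of x] assms
  unfolding Fp_bar_def algebraic_over_def coeffs_in_def by blast

section \<open>The order relation of a valuation ring\<close>

locale valuation =
  fixes V :: "'k::field set"
  assumes V: "val_ring V"
begin

text \<open>These relations compare absolute values without a value group: \<open>x \<preceq> y\<close> says \<open>|x| \<le> |y|\<close>.\<close>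

definition vle :: "'k \<Rightarrow> 'k \<Rightarrow> bool" (infix "\<preceq>" 50) where
  "x \<preceq> y \<longleftrightarrow> (\<exists>c\<in>V. x = c * y)"

definition vlt :: "'k \<Rightarrow> 'k \<Rightarrow> bool" (infix "\<prec>" 50) where
  "x \<prec> y \<longleftrightarrow> \<not> y \<preceq> x"

definition veq :: "'k \<Rightarrow> 'k \<Rightarrow> bool" (infix "\<approx>" 50) where
  "x \<approx> y \<longleftrightarrow> x \<preceq> y \<and> y \<preceq> x"

lemma R: "is_subring V" using V by (simp add: val_ring_def)

lemma vle_one_iff: "x \<preceq> 1 \<longleftrightarrow> x \<in> V" by (auto simp: vle_def)

lemma vle_refl [simp, intro]: "x \<preceq> x"
  unfolding vle_def using is_subring_1[OF R] by (intro bexI[of _ 1]) auto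

lemma vle_trans [trans]: "x \<preceq> y \<Longrightarrow> y \<preceq> z \<Longrightarrow> x \<preceq> z"
  unfolding vle_def using is_subring_mult[OF R] by (metis mult.assoc)

lemma vle_0 [simp, intro]: "0 \<preceq> x"
  unfolding vle_def using is_subring_0[OF R] by (intro bexI[of _ 0]) auto

lemma vle_0_right [simp]: "x \<preceq> 0 \<longleftrightarrow> x = 0"
  unfolding vle_def using is_subring_0[OF R] by auto

lemma vle_total: "x \<preceq> y \<or> y \<preceq> x"
proof (cases "x = 0 \<or> y = 0")
  case False
  have "x / y \<in> V \<or> inverse (x / y) \<in> V" using V unfolding val_ring_def by blast
  then show ?thesis
  proof
    assume "x / y \<in> V" then show ?thesis using False unfolding vle_def by (metis nonzero_eq_divide_eq)
  next
    assume "inverse (x / y) \<in> V" then show ?thesis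
      using False unfolding vle_def by (metis inverse_divide nonzero_eq_divide_eq)
  qed
qed auto

lemma vlt_imp_vle: "x \<prec> y \<Longrightarrow> x \<preceq> y"
  using vle_total unfolding vlt_def by blast

lemma vlt_vle_trans [trans]: "x \<prec> y \<Longrightarrow> y \<preceq> z \<Longrightarrow> x \<prec> z"
  unfolding vlt_def using vle_trans by blast

lemma vle_vlt_trans [trans]: "x \<preceq> y \<Longrightarrow> y \<prec> z \<Longrightarrow> x \<prec> z"
  unfolding vlt_def using vle_trans by blast

lemma vlt_trans [trans]: "x \<prec> y \<Longrightarrow> y \<prec> z \<Longrightarrow> x \<prec> z"
  using vlt_imp_vle vlt_vle_trans by blast

lemma vlt_irrefl [simp]: "\<not> x \<prec> x" by (simp add: vlt_def)

lemma zero_vlt_iff [simp]: "0 \<prec> x \<longleftrightarrow> x \<noteq> 0" by (simp add: vlt_def)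

lemma vlt_nonzero: "x \<prec> y \<Longrightarrow> y \<noteq> 0" by (auto simp: vlt_def)

lemma vle_mult: "x \<preceq> y \<Longrightarrow> x' \<preceq> y' \<Longrightarrow> x * x' \<preceq> y * y'"
  unfolding vle_def by (metis (no_types, lifting) R is_subring_mult mult.assoc mult.left_commute)

lemma vle_mult_cancel: "z \<noteq> 0 \<Longrightarrow> x * z \<preceq> y * z \<longleftrightarrow> x \<preceq> y"
  unfolding vle_def by (auto simp: mult.assoc[symmetric])

lemma vlt_mult_cancel: "z \<noteq> 0 \<Longrightarrow> x * z \<prec> y * z \<longleftrightarrow> x \<prec> y"
  by (simp add: vlt_def vle_mult_cancel)

lemma vlt_mult: "x \<prec> y \<Longrightarrow> x' \<preceq> y' \<Longrightarrow> y' \<noteq> 0 \<Longrightarrow> x * x' \<prec> y * y'"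
  using vle_mult[OF vle_refl[of x], of x' y'] vlt_mult_cancel[of y' x y] vle_vlt_trans by blast

lemma vle_power: "x \<preceq> y \<Longrightarrow> x ^ n \<preceq> y ^ n"
  by (induction n) (auto intro: vle_mult)

lemma vlt_power: "x \<prec> y \<Longrightarrow> n > 0 \<Longrightarrow> x ^ n \<prec> y ^ n"
proof (induction n)
  case (Suc n)
  then show ?case
    using vlt_mult[of x y "x ^ n" "y ^ n"] vle_power[OF vlt_imp_vle[of x y]] vlt_nonzero[of x y]
    by simp
qed simp

lemma vle_power_iff: "n > 0 \<Longrightarrow> x ^ n \<preceq> y ^ n \<longleftrightarrow> x \<preceq> y"
  using vle_power vlt_power[of y x n] unfolding vlt_def by blast

lemma vlt_power_iff: "n > 0 \<Longrightarrow> x ^ n \<prec> y ^ n \<longleftrightarrow> x \<prec> y"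
  by (simp add: vlt_def vle_power_iff)

lemma vle_add: "x \<preceq> z \<Longrightarrow> y \<preceq> z \<Longrightarrow> x + y \<preceq> z"
  unfolding vle_def by (metis R distrib_right is_subring_add)

lemma vle_minus_left [simp]: "- x \<preceq> y \<longleftrightarrow> x \<preceq> y"
  unfolding vle_def by (metis R is_subring_minus minus_minus mult_minus_left)

lemma vle_minus_right [simp]: "x \<preceq> - y \<longleftrightarrow> x \<preceq> y"
  unfolding vle_def by (metis R is_subring_minus minus_minus mult_minus_left mult_minus_right)

lemma vlt_minus [simp]: "- x \<prec> y \<longleftrightarrow> x \<prec> y" "x \<prec> - y \<longleftrightarrow> x \<prec> y"
  by (simp_all add: vlt_def)

lemma vle_diff: "x \<preceq> z \<Longrightarrow> y \<preceq> z \<Longrightarrow> x - y \<preceq> z"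
  using vle_add[of x z "- y"] by simp

lemma vlt_add: "x \<prec> z \<Longrightarrow> y \<prec> z \<Longrightarrow> x + y \<prec> z"
  using vle_total[of x y] vle_add[of x y y] vle_add[of x x y] vle_vlt_trans by blast

lemma vlt_diff: "x \<prec> z \<Longrightarrow> y \<prec> z \<Longrightarrow> x - y \<prec> z"
  using vlt_add[of x z "- y"] by simp

lemma vle_sum: "(\<And>i. i \<in> I \<Longrightarrow> g i \<preceq> z) \<Longrightarrow> sum g I \<preceq> z"
  by (induction I rule: infinite_finite_induct) (auto intro: vle_add)

lemma vlt_sum: "z \<noteq> 0 \<Longrightarrow> (\<And>i. i \<in> I \<Longrightarrow> g i \<prec> z) \<Longrightarrow> sum g I \<prec> z"
  by (induction I rule: infinite_finite_induct) (auto intro: vlt_add)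

lemma vle_prod: "(\<And>i. i \<in> I \<Longrightarrow> g i \<preceq> h i) \<Longrightarrow> prod g I \<preceq> prod h I"
  by (induction I rule: infinite_finite_induct) (auto intro: vle_mult)

lemma vle_power_mono: "1 \<preceq> x \<Longrightarrow> m \<le> n \<Longrightarrow> x ^ m \<preceq> x ^ n"
  using vle_mult[OF vle_refl[of "x ^ m"] vle_power[of 1 x "n - m"]]
  by (simp add: power_add[symmetric])

lemma vlt_power_mono: "1 \<prec> x \<Longrightarrow> m < n \<Longrightarrow> x ^ m \<prec> x ^ n"
  using vlt_mult[OF vlt_power[of 1 x "n - m"] vle_refl[of "x ^ m"]] vlt_nonzero[of 1 x]
  by (simp add: power_add[symmetric])

lemma veq_refl [simp, intro]: "x \<approx> x" by (simp add: veq_def)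

lemma veq_sym: "x \<approx> y \<Longrightarrow> y \<approx> x" by (simp add: veq_def)

lemma veq_trans [trans]: "x \<approx> y \<Longrightarrow> y \<approx> z \<Longrightarrow> x \<approx> z"
  unfolding veq_def using vle_trans by blast

lemma veq_mult: "x \<approx> y \<Longrightarrow> x' \<approx> y' \<Longrightarrow> x * x' \<approx> y * y'"
  unfolding veq_def using vle_mult by blast

lemma veq_power: "x \<approx> y \<Longrightarrow> x ^ n \<approx> y ^ n"
  unfolding veq_def using vle_power by blast

lemma veq_power_iff: "n > 0 \<Longrightarrow> x ^ n \<approx> y ^ n \<longleftrightarrow> x \<approx> y"
  by (simp add: veq_def vle_power_iff)

lemma veq_vle: "x \<approx> y \<Longrightarrow> x \<preceq> z \<longleftrightarrow> y \<preceq> z" "x \<approx> y \<Longrightarrow> z \<preceq> x \<longleftrightarrow> z \<preceq> y"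
  unfolding veq_def using vle_trans by blast+

lemma veq_vlt: "x \<approx> y \<Longrightarrow> x \<prec> z \<longleftrightarrow> y \<prec> z" "x \<approx> y \<Longrightarrow> z \<prec> x \<longleftrightarrow> z \<prec> y"
  unfolding vlt_def using veq_vle by blast+

text \<open>If \<open>x + y\<close> were smaller than \<open>x\<close>, then so would be
  \<open>x = (x + y) - y\<close>. Dominant terms are isolated in this way throughout.\<close>

lemma veq_add_vlt: "y \<prec> x \<Longrightarrow> x + y \<approx> x"
  using vle_add[of x x y] vle_diff[of "x + y" "y" "y"] vlt_imp_vle[of y x]
    vle_total[of "x + y" y] vle_diff[of "x + y" "x + y" y]
  unfolding veq_def vlt_def by fastforce

lemma veq_diff_vlt: "y - x \<prec> x \<Longrightarrow> y \<approx> x"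
  using veq_add_vlt[of "y - x" x] by simp

lemma veq_unit_mult: "c \<approx> 1 \<Longrightarrow> c * x \<approx> x"
  using veq_mult[of c 1 x x] by simp

text \<open>Such an \<open>x\<close> is a root of unity, and \<open>x ^ m = 1\<close> leaves no size
  other than that of \<open>1\<close>.\<close>

lemma Fp_bar_unit:
  assumes p: "prime CHAR('k)" and "(x::'k) \<in> Fp_bar" "x \<noteq> 0"
  shows "x \<approx> 1"
proof -
  obtain m where "m > 0" "x ^ m = 1" using Fp_bar_root_of_unity[OF assms] .
  then show ?thesis using veq_power_iff[of m x 1] by simp
qed

lemma of_nat_unit:
  assumes p: "prime CHAR('k)" "\<not> CHAR('k) dvd s"
  shows "(of_nat s :: 'k) \<approx> 1"
proof (rule Fp_bar_unit[OF p(1)])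
  show "(of_nat s :: 'k) \<in> Fp_bar"
    using Fp_bar_iff[OF p(1)] of_nat_power_char[OF p(1), of s 1] by (metis zero_less_one)
  show "(of_nat s :: 'k) \<noteq> 0" using p(2) of_nat_eq_0_iff_char_dvd by blast
qed

end

section \<open>Discriminants of finite sets\<close>

text \<open>For finite \<open>S\<close> this is, up to sign, the discriminant of the monic
  polynomial with simple roots \<open>S\<close>: each unordered pair occurs twice.\<close>

definition disc :: "'k::field set \<Rightarrow> 'k" where
  "disc S = (\<Prod>x\<in>S. \<Prod>y\<in>S-{x}. x - y)"

lemma disc_nonzero: "finite S \<Longrightarrow> disc S \<noteq> 0"
  by (auto simp: disc_def)

lemma disc_insert:
  assumes "finite S" "x \<notin> S"
  shows "disc (insert x S) = (\<Prod>y\<in>S. x - y) * (\<Prod>y\<in>S. y - x) * disc S"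
proof -
  have "disc (insert x S) = (\<Prod>y\<in>insert x S - {x}. x - y) * (\<Prod>z\<in>S. \<Prod>y\<in>insert x S - {z}. z - y)"
    unfolding disc_def using assms by simp
  also have "insert x S - {x} = S" using assms by auto
  also have "(\<Prod>z\<in>S. \<Prod>y\<in>insert x S - {z}. z - y) = (\<Prod>z\<in>S. (z - x) * (\<Prod>y\<in>S - {z}. z - y))"
  proof (intro prod.cong refl)
    fix z assume "z \<in> S"
    then have "insert x S - {z} = insert x (S - {z})" using assms by auto
    then show "(\<Prod>y\<in>insert x S - {z}. z - y) = (z - x) * (\<Prod>y\<in>S - {z}. z - y)"
      using assms by simp
  qed
  finally show ?thesis by (simp add: prod.distrib disc_def mult.assoc)
qed

lemma lead_coeff_prod_linear:
  fixes S :: "'k::field set"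
  shows "degree (\<Prod>y\<in>S. [:- y, 1:]) = card S" "coeff (\<Prod>y\<in>S. [:- y, 1:]) (card S) = 1"
proof -
  show d: "degree (\<Prod>y\<in>S. [:- y, 1:]) = card S"
    by (subst degree_prod_eq_sum_degree) auto
  show "coeff (\<Prod>y\<in>S. [:- y, 1:]) (card S) = 1"
    using lead_coeff_prod[of "\<lambda>y. [:- y, 1:]" S] by (simp add: d)
qed

text \<open>The coefficient of \<open>X ^ n\<close> in the Lagrange interpolation formula, whose
  basis products are monic of degree \<open>n\<close>.\<close>

lemma lagrange_coeff:
  fixes S :: "'k::field set"
  assumes S: "card S = Suc n" and q: "degree q \<le> n"
  shows "coeff q n = (\<Sum>x\<in>S. poly q x / (\<Prod>y\<in>S-{x}. x - y))"
proof -
  have fin: "finite S" using S by (metis card.infinite nat.simps(3))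
  define c where "c x = poly q x / (\<Prod>y\<in>S-{x}. x - y)" for x
  define L where "L = (\<Sum>x\<in>S. smult (c x) (\<Prod>y\<in>S-{x}. [:- y, 1:]))"
  have cS: "card (S - {x}) = n" if "x \<in> S" for x using S that fin by simp
  have "q = L"
  proof (rule poly_eqI_degree[of S])
    fix z assume z: "z \<in> S"
    have "poly L z = (\<Sum>x\<in>S. c x * (\<Prod>y\<in>S-{x}. z - y))"
      by (simp add: L_def poly_sum poly_prod)
    also have "\<dots> = c z * (\<Prod>y\<in>S-{z}. z - y)"
    proof (subst sum.remove[OF fin z])
      have "(\<Sum>x\<in>S-{z}. c x * (\<Prod>y\<in>S-{x}. z - y)) = 0"
        using z fin by (intro sum.neutral) auto
      then show "c z * (\<Prod>y\<in>S-{z}. z - y) + (\<Sum>x\<in>S-{z}. c x * (\<Prod>y\<in>S-{x}. z - y)) =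
        c z * (\<Prod>y\<in>S-{z}. z - y)" by simp
    qed
    also have "\<dots> = poly q z" using fin by (simp add: c_def)
    finally show "poly q z = poly L z" ..
  next
    have "degree L \<le> n" unfolding L_def
    proof (intro degree_sum_le fin)
      fix x assume "x \<in> S"
      then show "degree (smult (c x) (\<Prod>y\<in>S-{x}. [:- y, 1:])) \<le> n"
        using degree_smult_le[of "c x" "\<Prod>y\<in>S-{x}. [:- y, 1:]"] lead_coeff_prod_linear(1)[of "S - {x}"]
          cS[of x] by simp
    qed
    then show "degree L < card S" using S by simp
  qed (use S q in auto)
  then have "coeff q n = (\<Sum>x\<in>S. c x * coeff (\<Prod>y\<in>S-{x}. [:- y, 1:]) n)"
    by (simp add: L_def coeff_sum)
  also have "\<dots> = (\<Sum>x\<in>S. c x)"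
  proof (intro sum.cong refl)
    fix x assume "x \<in> S"
    from lead_coeff_prod_linear(2)[of "S - {x}", unfolded cS[OF this]]
    show "c x * coeff (\<Prod>y\<in>S-{x}. [:- y, 1:]) n = c x" by simp
  qed
  finally show ?thesis by (simp add: c_def)
qed

context valuation
begin

text \<open>By Lagrange interpolation some point of \<open>S\<close> has the product of its distances to the others
  bounded by the value of a given polynomial of degree \<open>card S - 1\<close>; remove it and iterate.\<close>

lemma disc_bound:
  assumes "finite S" "a \<noteq> 0"
    and "\<And>j. j < card S \<Longrightarrow> \<exists>b. degree b = j \<and> lead_coeff b \<approx> 1 \<and> (\<forall>x\<in>S. poly b x \<preceq> a powi e j)"
  shows "disc S \<preceq> a powi (2 * (\<Sum>j<card S. e j))"
  using assms(1,3)
proof (induction "card S" arbitrary: S)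
  case 0
  then show ?case by (simp add: disc_def)
next
  case (Suc n)
  obtain b where b: "degree b = n" "lead_coeff b \<approx> 1" "\<And>x. x \<in> S \<Longrightarrow> poly b x \<preceq> a powi e n"
    using Suc.prems(2)[of n] Suc.hyps(2) by auto
  define w where "w x = (\<Prod>y\<in>S-{x}. x - y)" for x
  have w0: "w x \<noteq> 0" for x using Suc.prems(1) by (auto simp: w_def)
  have "coeff b n = (\<Sum>x\<in>S. poly b x / w x)"
    unfolding w_def using Suc.hyps(2) b(1) by (intro lagrange_coeff) auto
  \<comment> \<open>Otherwise all summands of the Lagrange formula are smaller than
    \<open>1\<close>, and so is their sum, the leading coefficient of \<open>b\<close>.\<close>
  have "\<exists>x\<in>S. w x \<preceq> poly b x"
  proof (rule ccontr)
    assume *: "\<not> (\<exists>x\<in>S. w x \<preceq> poly b x)"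
    have "(\<Sum>x\<in>S. poly b x / w x) \<prec> 1"
    proof (rule vlt_sum)
      fix x assume "x \<in> S"
      then have "poly b x \<prec> w x" using * by (auto simp: vlt_def)
      then show "poly b x / w x \<prec> 1"
        using vlt_mult_cancel[of "w x" "poly b x / w x" 1] w0[of x] by simp
    qed auto
    with b(1,2) \<open>coeff b n = _\<close> show False by (simp add: vlt_def veq_def)
  qed
  then obtain x where x: "x \<in> S" "w x \<preceq> a powi e n" using b(3) vle_trans by blast
  define T where "T = S - {x}"
  have T: "S = insert x T" "x \<notin> T" "finite T" "card T = n"
    using x(1) Suc.prems(1) Suc.hyps(2)[symmetric] by (auto simp: T_def)
  have 1: "disc T \<preceq> a powi (2 * (\<Sum>j<card T. e j))"
  proof (rule Suc.hyps(1))
    fix j assume "j < card T"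
    then have "j < card S" using T(4) Suc.hyps(2) by linarith
    from Suc.prems(2)[OF this] show "\<exists>b. degree b = j \<and> lead_coeff b \<approx> 1 \<and> (\<forall>x\<in>T. poly b x \<preceq> a powi e j)"
      unfolding T(1) by blast
  qed (simp_all add: T)
  have wx: "w x = (\<Prod>y\<in>T. x - y)" by (simp add: w_def T_def)
  have "(\<Prod>y\<in>T. y - x) = (-1) ^ card T * w x"
  proof -
    have "(\<Prod>y\<in>T. y - x) = (\<Prod>y\<in>T. (-1) * (x - y))" by (intro prod.cong) auto
    then show ?thesis unfolding wx by (simp only: prod.distrib prod_constant)
  qed
  then have "(\<Prod>y\<in>T. y - x) = w x \<or> (\<Prod>y\<in>T. y - x) = - w x"
    by (cases "even (card T)") auto
  then have 2: "(\<Prod>y\<in>T. y - x) \<preceq> a powi e n" using x(2) by auto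
  have "disc S = w x * (\<Prod>y\<in>T. y - x) * disc T"
    unfolding T(1) wx by (rule disc_insert) (use T in auto)
  also have "\<dots> \<preceq> a powi e n * a powi e n * a powi (2 * (\<Sum>j<card T. e j))"
    by (intro vle_mult x 1 2)
  also have "a powi e n * a powi e n * a powi (2 * (\<Sum>j<card T. e j)) = a powi (2 * (\<Sum>j<card S. e j))"
    using assms(2) T(4) by (simp add: power_int_add[symmetric] Suc.hyps(2)[symmetric] algebra_simps)
  finally show ?case .
qed

text \<open>Test polynomials of every degree come from the single \<open>G\<close>: a power
  \<open>G ^ (j div g)\<close> carries the estimate, and \<open>X ^ (j mod g)\<close> fills up the
  degree at a bounded cost.\<close>

lemma disc_bound_poly:
  assumes S: "finite S" "\<And>x. x \<in> S \<Longrightarrow> x \<preceq> a" and a: "a \<noteq> 0"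
    and G: "degree G = g" "0 < g" "lead_coeff G \<approx> 1" "\<And>x. x \<in> S \<Longrightarrow> poly G x \<preceq> a powi e"
  shows "disc S \<preceq> a powi (2 * (\<Sum>j<card S. e * int (j div g) + int (j mod g)))"
proof (rule disc_bound[OF S(1) a])
  fix j
  define b where "b = G ^ (j div g) * monom 1 (j mod g)"
  have G0: "G \<noteq> 0" using G by auto
  have "degree b = degree G * (j div g) + j mod g"
    unfolding b_def using G0 by (subst degree_mult_eq) (auto simp: degree_power_eq degree_monom_eq monom_eq_0_iff)
  then have 1: "degree b = j" by (simp add: G(1))
  have "lead_coeff b = lead_coeff G ^ (j div g)"
    by (simp add: b_def lead_coeff_mult lead_coeff_power degree_monom_eq)
  also have "\<dots> \<approx> 1" using veq_power[OF G(3), of "j div g"] by simp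
  finally have 2: "lead_coeff b \<approx> 1" .
  have "poly b x \<preceq> a powi (e * int (j div g) + int (j mod g))" if "x \<in> S" for x
  proof -
    have "poly b x = poly G x ^ (j div g) * x ^ (j mod g)"
      by (simp add: b_def poly_monom)
    also have "\<dots> \<preceq> (a powi e) ^ (j div g) * a ^ (j mod g)"
      by (intro vle_mult vle_power G(4) S(2) that)
    also have "(a powi e) ^ (j div g) * a ^ (j mod g) = a powi (e * int (j div g) + int (j mod g))"
      using a by (simp add: power_int_add power_int_mult)
    finally show ?thesis .
  qed
  with 1 2 show "\<exists>b. degree b = j \<and> lead_coeff b \<approx> 1 \<and>
      (\<forall>x\<in>S. poly b x \<preceq> a powi (e * int (j div g) + int (j mod g)))" by blast
qed

end

text \<open>The case \<open>e = 1\<close> of the exponent above: \<open>j div g\<close> is about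
  \<open>j / g\<close>, so the sum is about \<open>M^2 / (2 g)\<close>, and the remainders
  contribute only linearly in \<open>M\<close>.\<close>

lemma sum_exponents_pos:
  assumes "0 < g"
  shows "2 * int g * (\<Sum>j<M. 1 * int (j div g) + int (j mod g)) \<le> int M * int M + 2 * int g * int g * int M"
proof -
  have *: "int g * (1 * int (j div g) + int (j mod g)) \<le> int j + int g * int g" for j
  proof -
    have "int j = int g * int (j div g) + int (j mod g)"
      by (metis mult_div_mod_eq of_nat_add of_nat_mult)
    moreover have "int g * int (j mod g) \<le> int g * int g" using assms by (intro mult_left_mono) auto
    ultimately show ?thesis by (simp add: algebra_simps)
  qed
  have "int g * (\<Sum>j<M. 1 * int (j div g) + int (j mod g)) \<le> (\<Sum>j<M. int j + int g * int g)"
    unfolding sum_distrib_left by (intro sum_mono) (rule *)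
  moreover have "2 * (\<Sum>j<M. int j + int g * int g) = int M * int M - int M + 2 * int g * int g * int M"
    by (induction M) (simp_all add: algebra_simps)
  ultimately show ?thesis by (simp add: algebra_simps)
qed

text \<open>The case \<open>e = -1\<close>: a quadratic gain instead of a loss, again up to a term
  linear in \<open>M\<close>.\<close>

lemma sum_exponents_neg:
  assumes "0 < g"
  shows "2 * int g * (\<Sum>j<M. (-1) * int (j div g) + int (j mod g)) \<le>
    - (int M * int M) + (1 + 2 * int g + 2 * int g * int g) * int M"
proof -
  have *: "int g * ((-1) * int (j div g) + int (j mod g)) \<le> - int j + int g + int g * int g" for j
  proof -
    have "int j = int g * int (j div g) + int (j mod g)"
      by (metis mult_div_mod_eq of_nat_add of_nat_mult)
    moreover have "int g * int (j mod g) \<le> int g * int g" using assms by (intro mult_left_mono) auto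
    moreover have "int (j mod g) \<le> int g" using assms by simp
    ultimately show ?thesis by (simp add: algebra_simps)
  qed
  have "int g * (\<Sum>j<M. (-1) * int (j div g) + int (j mod g)) \<le> (\<Sum>j<M. - int j + int g + int g * int g)"
    unfolding sum_distrib_left by (intro sum_mono) (rule *)
  moreover have "2 * (\<Sum>j<M. - int j + int g + int g * int g) =
      - (int M * int M) + int M + 2 * (int g + int g * int g) * int M"
    by (induction M) (simp_all add: algebra_simps)
  ultimately show ?thesis by (simp add: algebra_simps)
qed

section \<open>Local dynamics of the family\<close>

lemma separable_factorization:
  fixes P :: "'k::alg_closed_field poly"
  assumes P: "P \<noteq> 0" and sep: "\<And>x. poly P x = 0 \<Longrightarrow> poly (pderiv P) x \<noteq> 0"
  shows "P = smult (lead_coeff P) (\<Prod>x\<in>{x. poly P x = 0}. [:- x, 1:])"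
    and "card {x. poly P x = 0} = degree P"
proof -
  obtain A where A: "size A = degree P" "P = smult (lead_coeff P) (\<Prod>x\<in>#A. [:- x, 1:])"
    using alg_closed_imp_factorization[OF P] by blast
  have "count A x \<le> 1" for x
  proof (rule ccontr)
    assume "\<not> count A x \<le> 1"
    then have "{#x, x#} \<subseteq># A" by (auto simp: subseteq_mset_def)
    then obtain B where B: "A = {#x, x#} + B" by (metis mset_subset_eq_exists_conv)
    define Q where "Q = smult (lead_coeff P) (\<Prod>x\<in>#B. [:- x, 1:])"
    have PQ: "P = [:- x, 1:] * ([:- x, 1:] * Q)"
      by (subst A(2)) (simp add: B Q_def mult_ac)
    then have "poly P x = 0" by simp
    moreover have "poly (pderiv P) x = 0"
      unfolding PQ pderiv_mult poly_mult poly_add by simp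
    ultimately show False using sep by blast
  qed
  then have "A = mset_set (set_mset A)"
    by (intro multiset_eqI) (metis One_nat_def count_mset_set(1,3) count_greater_zero_iff finite_set_mset
        le_Suc_eq le_zero_eq not_gr_zero)
  moreover have roots: "set_mset A = {x. poly P x = 0}"
  proof -
    have "poly P y = lead_coeff P * (\<Prod>x\<in>#A. y - x)" for y
    proof -
      have "poly (\<Prod>x\<in>#A. [:- x, 1:]) y = (\<Prod>x\<in>#A. y - x)"
        by (induction A) (auto simp: algebra_simps)
      then show ?thesis by (subst A(2)) simp
    qed
    then show ?thesis using P by (auto simp: prod_mset_zero_iff)
  qed
  ultimately have AR: "A = mset_set {x. poly P x = 0}" by simp
  show "P = smult (lead_coeff P) (\<Prod>x\<in>{x. poly P x = 0}. [:- x, 1:])"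
    using A(2) unfolding AR by (simp add: prod_unfold_prod_mset)
  show "card {x. poly P x = 0} = degree P"
    using A(1) unfolding AR by simp
qed

text \<open>\<open>X ^ s - 1\<close> is separable because \<open>s\<close> is invertible in
  \<open>'k\<close>; scaling by \<open>b\<close> gives the homogeneous form.\<close>

lemma roots_of_unity_factorization:
  fixes s :: nat
  assumes s: "0 < s" "\<not> CHAR('k::alg_closed_field) dvd s"
  defines "Z \<equiv> {z :: 'k. z ^ s = 1}"
  shows "finite Z" "card Z = s" "b \<noteq> 0 \<Longrightarrow> x ^ s - b ^ s = (\<Prod>z\<in>Z. x - z * b)"
proof -
  define P where "P = monom (1::'k) s - 1"
  have ps: "poly P x = x ^ s - 1" for x by (simp add: P_def poly_monom)
  have deg: "degree P = s"
    unfolding P_def diff_conv_add_uminus using s(1)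
    by (subst degree_add_eq_left) (auto simp: degree_monom_eq)
  have lc: "lead_coeff P = 1" using s(1) unfolding deg by (simp add: P_def)
  have P0: "P \<noteq> 0" using lc by auto
  have sep: "poly (pderiv P) x \<noteq> 0" if "poly P x = 0" for x
  proof -
    have "x \<noteq> 0" using that s(1) by (auto simp: ps power_0_left)
    moreover have "(of_nat s :: 'k) \<noteq> 0" using s(2) of_nat_eq_0_iff_char_dvd by blast
    ultimately show ?thesis by (simp add: P_def pderiv_diff pderiv_monom poly_monom)
  qed
  have Z: "{x. poly P x = 0} = Z" by (auto simp: ps Z_def)
  have fac: "P = (\<Prod>x\<in>Z. [:- x, 1:])"
    using separable_factorization(1)[OF P0 sep] unfolding Z lc by simp
  show "card Z = s" using separable_factorization(2)[OF P0 sep] unfolding Z deg .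
  then show "finite Z" using s(1) card.infinite by fastforce
  assume b: "b \<noteq> 0"
  have "x ^ s - b ^ s = b ^ s * poly P (x / b)"
    using b by (simp add: ps field_simps)
  also have "poly P (x / b) = (\<Prod>z\<in>Z. x / b - z)"
    by (subst fac) (simp add: poly_prod)
  also have "b ^ s * (\<Prod>z\<in>Z. x / b - z) = (\<Prod>z\<in>Z. b * (x / b - z))"
    by (simp add: prod.distrib \<open>card Z = s\<close>)
  also have "\<dots> = (\<Prod>z\<in>Z. x - z * b)"
    using b by (intro prod.cong) (auto simp: field_simps)
  finally show "x ^ s - b ^ s = (\<Prod>z\<in>Z. x - z * b)" .
qed

lemma poly_prod_linear: "poly (\<Prod>r\<in>#A. [:- r, 1:]) x = (\<Prod>r\<in>#A. x - r)"
  for x :: "'k::comm_ring_1"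
  by (induction A) (auto simp: algebra_simps)

context valuation
begin

text \<open>Every power of \<open>r\<close> is congruent to \<open>1\<close> modulo the maximal
  ideal. With \<open>r = y / x\<close> this gives the quotient of \<open>y ^ s - x ^ s\<close> by
  \<open>y - x\<close> to leading order.\<close>

lemma geometric_sum_close:
  assumes "r - 1 \<prec> 1"
  shows "(\<Sum>i<s. r ^ i) - of_nat s \<prec> 1"
proof -
  have r: "r \<preceq> 1" using veq_diff_vlt[OF assms] by (simp add: veq_def)
  have "r ^ i - 1 \<prec> 1" for i
  proof -
    have "(\<Sum>j<i. r ^ j) \<preceq> 1" by (intro vle_sum) (use vle_power[OF r] in simp)
    then show ?thesis
      unfolding power_diff_1_eq using vlt_mult[OF assms, of "\<Sum>j<i. r ^ j" 1] by simp
  qed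
  then have "(\<Sum>i<s. r ^ i - 1) \<prec> 1" by (intro vlt_sum) auto
  then show ?thesis by (simp add: sum_subtractf)
qed

lemma prod_roots_far:
  assumes "\<And>r. r \<in># A \<Longrightarrow> a \<preceq> z - r"
  shows "a ^ size A \<preceq> (\<Prod>r\<in>#A. z - r)"
  using assms by (induction A) (auto intro: vle_mult)

lemma prod_roots_bound:
  assumes "z \<preceq> a" "\<And>r. r \<in># A \<Longrightarrow> r \<preceq> a"
  shows "(\<Prod>r\<in>#A. z - r) \<preceq> a ^ size A"
  using assms(2) by (induction A) (auto intro: vle_mult vle_diff assms(1))

text \<open>By the product rule each term of the derivative lacks one factor of size at most
  \<open>|a|\<close>. The factor \<open>a\<close> on the left avoids the exponent
  \<open>size A - 1\<close>.\<close>

lemma pderiv_prod_roots_bound: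
  assumes "z \<preceq> a" "\<And>r. r \<in># A \<Longrightarrow> r \<preceq> a"
  shows "a * poly (pderiv (\<Prod>r\<in>#A. [:- r, 1:])) z \<preceq> a ^ size A"
  using assms(2)
proof (induction A)
  case (add r A)
  define Q where "Q = (\<Prod>r\<in>#A. [:- r, 1:])"
  have "poly (pderiv (\<Prod>r\<in>#add_mset r A. [:- r, 1:])) z = poly Q z + (z - r) * poly (pderiv Q) z"
    by (simp only: image_mset_add_mset prod_mset.add_mset pderiv_mult Q_def[symmetric])
       (simp add: pderiv_pCons algebra_simps)
  then have "a * poly (pderiv (\<Prod>r\<in>#add_mset r A. [:- r, 1:])) z =
      a * poly Q z + (z - r) * (a * poly (pderiv Q) z)"
    by (simp only: distrib_left mult.left_commute)
  also have "\<dots> \<preceq> a * a ^ size A"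
    using add prod_roots_bound[OF assms(1), of A]
    by (intro vle_add vle_mult vle_refl vle_diff assms(1)) (auto simp: Q_def poly_prod_linear)
  finally show ?case by simp
qed simp

end

section \<open>The binomial map: exponents, iterates and the polynomial \<open>h\<close>\<close>

locale binomial_map =
  fixes p l1 l2 s1 s2 :: nat and c1 c2 :: "'k::alg_closed_field"
  assumes prime_p: "prime p" and char: "CHAR('k) = p"
    and c1: "c1 \<in> Fp_bar - {0}" and c2: "c2 \<in> Fp_bar - {0}"
    and s1: "\<not> p dvd s1" "1 < s1" and s2: "\<not> p dvd s2" "1 < s2"
    and bal: "p ^ l2 * (s2 - 1) = p ^ l1 * (s1 - 1)"
    and lt: "p ^ l1 * s1 < p ^ l2 * s2"
begin

abbreviation "P1 \<equiv> p ^ l1"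
abbreviation "P2 \<equiv> p ^ l2"
definition "d1 = p ^ l1 * s1"
definition "d2 = p ^ l2 * s2"
text \<open>By \<open>bal\<close> this is also \<open>P1 * (s1 - 1)\<close>, so each of
  \<open>d1\<close> and \<open>d2\<close> exceeds \<open>N\<close> by a power of
  \<open>p\<close>.\<close>

definition "N = P2 * (s2 - 1)"

definition f :: "'k \<Rightarrow> 'k" where "f x = c1 * x ^ d1 + c2 * x ^ d2"

definition it :: "'k \<Rightarrow> nat \<Rightarrow> 'k \<Rightarrow> 'k" where "it l n = ((\<lambda>x. f x + l) ^^ n)"

text \<open>A collision of iterates in place of a finite orbit: such equations are carried along by
  field embeddings.\<close>

definition preper :: "'k \<Rightarrow> 'k \<Rightarrow> bool" where
  "preper l x \<longleftrightarrow> (\<exists>i j. i < j \<and> it l i x = it l j x)"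

text \<open>An additive polynomial: the leading part of \<open>(f (x + w) - f x) / x ^ N\<close>
  when \<open>|x|\<close> is large and \<open>w\<close> is small against \<open>x\<close>.\<close>

definition h :: "'k \<Rightarrow> 'k" where
  "h w = c2 * of_nat s2 * w ^ P2 + c1 * of_nat s1 * w ^ P1"

lemma prime_char: "prime CHAR('k)" using prime_p char by simp

text \<open>\<open>bal\<close> gives \<open>d2 - d1 = P2 - P1\<close>, hence \<open>P1 < P2\<close>
  and \<open>p dvd P2\<close>; the latter makes the derivative of the dominant term of
  \<open>f\<close> vanish.\<close>

lemma exponents:
  "d1 = N + P1" "d2 = N + P2" "P1 < P2" "0 < P1" "2 \<le> N" "p dvd P2" "2 \<le> d1" "d1 < d2"
proof -
  have "s1 = Suc (s1 - 1)" "s2 = Suc (s2 - 1)" using s1 s2 by auto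
  then show a: "d1 = N + P1" "d2 = N + P2"
    unfolding N_def d1_def d2_def
    by (metis add.commute bal mult_Suc_right, metis add.commute mult_Suc_right)
  show d: "d1 < d2" using lt by (simp add: d1_def d2_def)
  then show b: "P1 < P2" using a by simp
  show c: "0 < P1" using prime_gt_0_nat[OF prime_p] by simp
  have "l2 \<noteq> 0" using b c by (intro notI) simp
  then show "p dvd P2" by simp
  then have "p \<le> P2" using b c by (intro dvd_imp_le) linarith+
  then have "2 \<le> P2" using prime_ge_2_nat[OF prime_p] by simp
  moreover have "P2 * 1 \<le> N" unfolding N_def using s2(2) by (intro mult_le_mono2) linarith
  ultimately show "2 \<le> N" by simp
  then show "2 \<le> d1" using a(1) by simp
qed

lemma power_diff_P:
  "(x - y) ^ (p ^ n) = x ^ (p ^ n) - y ^ (p ^ n)" for x y :: 'k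
  using power_char_diff[OF prime_char, unfolded char] .

lemma it_0 [simp]: "it l 0 x = x" and it_Suc [simp]: "it l (Suc n) x = f (it l n x) + l"
  by (simp_all add: it_def)

lemma it_Suc_right: "it l n (f x + l) = it l (Suc n) x"
  by (induction n) auto

lemma preper_step: "preper l x \<Longrightarrow> preper l (f x + l)"
  unfolding preper_def by (metis it_Suc it_Suc_right)

end

locale binomial_valuation = binomial_map p l1 l2 s1 s2 c1 c2 + valuation V
  for p l1 l2 s1 s2 :: nat and c1 c2 :: "'k::alg_closed_field" and V :: "'k set"
begin

lemma units: "c1 \<approx> 1" "c2 \<approx> 1" "of_nat s1 \<approx> 1" "of_nat s2 \<approx> 1"
  using Fp_bar_unit[OF prime_char] of_nat_unit[OF prime_char] c1 c2 s1 s2 char by auto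

lemma f_dominant:
  assumes "1 \<prec> x" shows "f x \<approx> x ^ d2"
proof -
  have "c1 * x ^ d1 \<approx> x ^ d1" "c2 * x ^ d2 \<approx> x ^ d2" using units veq_unit_mult by blast+
  moreover have "x ^ d1 \<prec> x ^ d2" using vlt_power_mono[OF assms exponents(8)] .
  ultimately have "c1 * x ^ d1 \<prec> c2 * x ^ d2" using veq_vlt by blast
  then have "c2 * x ^ d2 + c1 * x ^ d1 \<approx> c2 * x ^ d2" by (rule veq_add_vlt)
  then show ?thesis using \<open>c2 * x ^ d2 \<approx> x ^ d2\<close> veq_trans unfolding f_def by (metis add.commute)
qed

lemma f_small: "x \<preceq> 1 \<Longrightarrow> f x \<preceq> 1"
  unfolding f_def using units vle_mult[of c1 1 "x ^ d1" 1] vle_mult[of c2 1 "x ^ d2" 1]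
    vle_power[of x 1 d1] vle_power[of x 1 d2] by (auto simp: veq_def intro: vle_add)

lemma d2_gt: "1 < d2" using exponents by linarith

text \<open>The term \<open>c2 * x ^ d2\<close> dominates, so \<open>f x + l\<close> has size
  \<open>|x| ^ d2 > |x|\<close> and satisfies the same hypotheses: the orbit grows strictly.\<close>

lemma escape:
  assumes x: "1 \<prec> x" "l \<prec> x ^ d2"
  shows "\<not> preper l x"
proof
  assume "preper l x"
  then obtain i j where ij: "i < j" "it l i x = it l j x" by (auto simp: preper_def)
  have step: "y \<prec> f y + l \<and> 1 \<prec> f y + l \<and> l \<prec> (f y + l) ^ d2"
    if y: "1 \<prec> y" "l \<prec> y ^ d2" for y
  proof -
    have "l \<prec> f y" using f_dominant[OF y(1)] y(2) veq_vlt by blast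
    then have 1: "f y + l \<approx> y ^ d2" using veq_add_vlt f_dominant[OF y(1)] veq_trans by blast
    have "y \<prec> y ^ d2" using vlt_power_mono[OF y(1) d2_gt] by simp
    then have 2: "y \<prec> f y + l" using 1 veq_vlt by blast
    have 3: "1 \<prec> f y + l" using y(1) 2 vlt_trans by blast
    have "y ^ d2 \<prec> (f y + l) ^ d2" using vlt_power[OF 2] d2_gt by simp
    then have "l \<prec> (f y + l) ^ d2" using y(2) vlt_trans by blast
    with 2 3 show ?thesis by blast
  qed
  have inv: "1 \<prec> it l n x \<and> l \<prec> it l n x ^ d2" for n
    by (induction n) (use x step in auto)
  have inc: "it l n x \<prec> it l (Suc n) x" for n using step inv by simp
  from ij(1) have "it l i x \<prec> it l j x"
  proof (induction j)
    case (Suc j)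
    then show ?case using inc[of j] vlt_trans by (cases "i = j") (auto simp del: it_Suc)
  qed simp
  with ij(2) show False by simp
qed

end

section \<open>Preperiodic points at a place with \<open>|a| > 1\<close>\<close>

locale binomial_place = binomial_valuation p l1 l2 s1 s2 c1 c2 V
  for p l1 l2 s1 s2 :: nat and c1 c2 :: "'k::alg_closed_field" and V :: "'k set" +
  fixes a :: 'k
  assumes a: "a \<notin> V"
begin

lemma a_gt: "1 \<prec> a" using a by (simp add: vlt_def vle_one_iff)

lemma a0: "a \<noteq> 0" using a_gt vlt_nonzero by blast

text \<open>If \<open>l\<close> is too small, \<open>a\<close> escapes; if it is too large, it
  dominates \<open>f a\<close>, so that \<open>f a + l\<close> has size \<open>|l|\<close> and
  escapes.\<close>

lemma parameter_size:
  assumes "preper l a" shows "l \<approx> a ^ d2"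
proof -
  have 1: "a ^ d2 \<preceq> l" using escape[OF a_gt] assms by (auto simp: vlt_def)
  have "l \<preceq> a ^ d2"
  proof (rule ccontr)
    assume "\<not> l \<preceq> a ^ d2"
    then have "a ^ d2 \<prec> l" by (simp add: vlt_def)
    then have "f a \<prec> l" using f_dominant[OF a_gt] veq_vlt by blast
    then have 2: "f a + l \<approx> l" using veq_add_vlt[of "f a" l] by (simp add: add.commute)
    have "1 \<prec> a ^ d2" using vlt_power_mono[OF a_gt, of 0 d2] d2_gt by simp
    then have l1: "1 \<prec> l" using 1 vlt_vle_trans by blast
    then have "l \<prec> l ^ d2" using vlt_power_mono[OF _ d2_gt, of l] by simp
    then have "l \<prec> (f a + l) ^ d2" using veq_power[OF 2, of d2] veq_vlt by blast
    moreover have "1 \<prec> f a + l" using l1 2 veq_vlt by blast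
    ultimately show False using escape preper_step[OF assms] by blast
  qed
  with 1 show ?thesis by (simp add: veq_def)
qed

lemma preper_bound:
  assumes "preper l a" "preper l x" shows "x \<preceq> a"
proof (rule ccontr)
  assume "\<not> x \<preceq> a"
  then have ax: "a \<prec> x" by (simp add: vlt_def)
  then have "1 \<prec> x" using a_gt vlt_trans by blast
  moreover have "a ^ d2 \<prec> x ^ d2" using ax d2_gt by (intro vlt_power) auto
  then have "l \<prec> x ^ d2" using parameter_size[OF assms(1)] veq_vlt by blast
  ultimately show False using escape assms(2) by blast
qed

lemma a_lt_d2: "a \<prec> a ^ d2" using vlt_power_mono[OF a_gt d2_gt] by simp

text \<open>The image \<open>f x + l\<close> is bounded by \<open>|a|\<close>, which is below
  \<open>|l| = |a| ^ d2\<close>; so \<open>f x\<close> must cancel \<open>l\<close> to leading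
  order, and this determines \<open>|x|\<close>.\<close>

lemma preper_size:
  assumes l: "preper l a" and x: "preper l x" shows "x \<approx> a"
proof (rule ccontr)
  assume neq: "\<not> x \<approx> a"
  then have xa: "x \<prec> a" using preper_bound[OF l x] by (auto simp: veq_def vlt_def)
  have "f x + l \<prec> l"
    using preper_bound[OF l preper_step[OF x]] a_lt_d2 vle_vlt_trans parameter_size[OF l] veq_vlt by blast
  then have "- l + (f x + l) \<approx> - l" by (intro veq_add_vlt) simp
  then have fx: "f x \<approx> a ^ d2" using parameter_size[OF l] by (simp add: veq_def) (metis vle_trans)
  show False
  proof (cases "1 \<prec> x")
    case True
    then have "a ^ d2 \<preceq> x ^ d2" using f_dominant fx veq_trans veq_sym by (meson veq_def)
    then show False using vle_power_iff[of d2 a x] d2_gt xa by (simp add: vlt_def)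
  next
    case False
    then have "f x \<preceq> 1" using f_small by (simp add: vlt_def)
    then have "a ^ d2 \<preceq> 1" using fx veq_vle by blast
    moreover have "1 \<prec> a ^ d2" using vlt_trans[OF a_gt a_lt_d2] .
    ultimately show False by (simp add: vlt_def)
  qed
qed

lemma preper_diff:
  assumes "preper l a" "preper l x" "preper l y" shows "f y - f x \<preceq> a"
  using vle_diff[OF preper_bound[OF assms(1) preper_step[OF assms(3)]]
      preper_bound[OF assms(1) preper_step[OF assms(2)]]] by simp

text \<open>Up to terms of size \<open>|a| ^ d1\<close> the difference of values is
  \<open>c2 * (y ^ d2 - x ^ d2)\<close>, and \<open>y ^ d2 - x ^ d2\<close> is the
  \<open>P2\<close>-th power of \<open>y ^ s2 - x ^ s2\<close>.\<close>

lemma same_power_cluster: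
  assumes x: "x \<preceq> a" and y: "y \<preceq> a" and fxy: "f y - f x \<preceq> a"
  shows "y ^ s2 - x ^ s2 \<prec> a ^ s2"
proof -
  have c: "c1 * y ^ d1 \<preceq> a ^ d1" "c1 * x ^ d1 \<preceq> a ^ d1"
    using vle_mult[OF _ vle_power[OF y, of d1], of c1 1] vle_mult[OF _ vle_power[OF x, of d1], of c1 1]
      units(1) by (auto simp: veq_def)
  have "a \<preceq> a ^ d1" using vle_power_mono[OF vlt_imp_vle[OF a_gt], of 1 d1] exponents(7) by simp
  then have "(f y - f x) - (c1 * y ^ d1 - c1 * x ^ d1) \<preceq> a ^ d1"
    using vle_diff[OF vle_trans[OF fxy] vle_diff[OF c]] by blast
  also have "(f y - f x) - (c1 * y ^ d1 - c1 * x ^ d1) = c2 * (y ^ d2 - x ^ d2)"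
    by (simp add: f_def algebra_simps)
  finally have "y ^ d2 - x ^ d2 \<preceq> a ^ d1" using veq_unit_mult[OF units(2)] veq_vle by blast
  also have "a ^ d1 \<prec> a ^ d2" using vlt_power_mono[OF a_gt exponents(8)] .
  finally have "(y ^ s2 - x ^ s2) ^ P2 \<prec> (a ^ s2) ^ P2"
    by (simp add: power_diff_P power_mult[symmetric] mult.commute d2_def)
  moreover have "0 < P2" using exponents(3) by linarith
  ultimately show ?thesis using vlt_power_iff by blast
qed

text \<open>By Frobenius and the geometric sum, \<open>f y - f x = x ^ N * B\<close>, where
  \<open>B\<close> arises from \<open>h (y - x)\<close> by putting powers of the geometric sums
  \<open>q s\<close> for the integers \<open>s\<close>. Since \<open>|f y - f x|\<close> is at most
  \<open>|a| < |x| ^ N\<close>, the factor \<open>B\<close> is smaller than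
  \<open>1\<close>.\<close>

lemma close_difference:
  assumes x: "x \<approx> a" and w: "y - x \<prec> a" and fxy: "f y - f x \<preceq> a"
  shows "y - x \<preceq> 1" "h (y - x) \<prec> 1"
proof -
  define w where "w = y - x"
  define r where "r = y / x"
  have x0: "x \<noteq> 0" using x a0 by (auto simp: veq_def)
  have "(r - 1) * x = y - x" using x0 by (simp add: r_def field_simps)
  then have "(r - 1) * x \<prec> 1 * x" using assms(2) veq_vlt(2)[OF x] by simp
  then have r: "r - 1 \<prec> 1" using vlt_mult_cancel[OF x0] by blast
  define q where "q s = (\<Sum>i<s. r ^ i)" for s
  have pw: "y ^ s - x ^ s = x ^ (s - 1) * w * q s" if "0 < s" for s
  proof -
    have y: "y = x * r" using x0 by (simp add: r_def)
    have xs: "x ^ s = x ^ (s - 1) * x" using power_minus_mult[OF that, of x] by simp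
    have "y ^ s - x ^ s = x ^ s * (r ^ s - 1)"
      unfolding y by (simp add: power_mult_distrib right_diff_distrib)
    also have "\<dots> = x ^ (s - 1) * (x * (r - 1)) * q s"
      unfolding power_diff_1_eq q_def xs by (simp only: mult_ac)
    also have "x * (r - 1) = w" using x0 by (simp add: r_def w_def field_simps)
    finally show ?thesis .
  qed
  have pwP: "y ^ (p ^ n * s) - x ^ (p ^ n * s) = x ^ (p ^ n * (s - 1)) * (w ^ (p ^ n) * q s ^ (p ^ n))"
    if "0 < s" for s n
  proof -
    have "y ^ (p ^ n * s) - x ^ (p ^ n * s) = (y ^ s - x ^ s) ^ (p ^ n)"
      by (simp add: power_diff_P power_mult[symmetric] mult.commute)
    also have "\<dots> = x ^ (p ^ n * (s - 1)) * (w ^ (p ^ n) * q s ^ (p ^ n))"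
      unfolding pw[OF that] by (simp add: power_mult_distrib power_mult[symmetric] mult.commute)
    finally show ?thesis .
  qed
  have qs: "q s ^ (p ^ n) - of_nat s \<prec> 1" for s n
  proof -
    have "(q s - of_nat s) ^ (p ^ n) \<prec> 1 ^ (p ^ n)"
      using geometric_sum_close[OF r] prime_gt_0_nat[OF prime_p] by (intro vlt_power) (auto simp: q_def)
    then show ?thesis
      using of_nat_power_char[OF prime_char, of s n] by (simp add: power_diff_P char)
  qed
  define B where "B = c2 * (w ^ P2 * q s2 ^ P2) + c1 * (w ^ P1 * q s1 ^ P1)"
  have "f y - f x = c2 * (y ^ d2 - x ^ d2) + c1 * (y ^ d1 - x ^ d1)"
    by (simp add: f_def algebra_simps)
  \<comment> \<open>Here \<open>bal\<close> is used: both differences carry the same power of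
    \<open>x\<close>.\<close>
  also have "\<dots> = x ^ N * B"
  proof -
    have "y ^ d2 - x ^ d2 = x ^ N * (w ^ P2 * q s2 ^ P2)"
      unfolding d2_def N_def by (rule pwP) (use s2 in linarith)
    moreover have "y ^ d1 - x ^ d1 = x ^ N * (w ^ P1 * q s1 ^ P1)"
      unfolding d1_def N_def bal by (rule pwP) (use s1 in linarith)
    ultimately show ?thesis by (simp add: B_def algebra_simps)
  qed
  finally have "B * x ^ N \<preceq> a" using fxy by (simp add: mult.commute)
  also have "a \<prec> a ^ N" using vlt_power_mono[OF a_gt, of 1 N] exponents(5) by simp
  also have "a ^ N \<preceq> 1 * x ^ N" using veq_power[OF x, of N] by (simp add: veq_def)
  finally have B: "B \<prec> 1" using vlt_mult_cancel[of "x ^ N" B 1] x0 by simp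
  have qu: "q s2 ^ P2 \<approx> 1" "q s1 ^ P1 \<approx> 1"
  proof -
    have "q s ^ (p ^ n) \<approx> of_nat s" if "(of_nat s :: 'k) \<approx> 1" for s n
      by (rule veq_diff_vlt) (use qs[of s n] veq_vlt(2)[OF that] in blast)
    then show "q s2 ^ P2 \<approx> 1" "q s1 ^ P1 \<approx> 1" using units veq_trans by blast+
  qed
  have t2: "c2 * (w ^ P2 * q s2 ^ P2) \<approx> w ^ P2" "c1 * (w ^ P1 * q s1 ^ P1) \<approx> w ^ P1"
    using veq_trans[OF veq_unit_mult[OF units(2)] veq_unit_mult[OF qu(1), of "w ^ P2"]]
      veq_trans[OF veq_unit_mult[OF units(1)] veq_unit_mult[OF qu(2), of "w ^ P1"]]
    by (simp_all only: mult.commute)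
  \<comment> \<open>For \<open>|w| > 1\<close> the \<open>P2\<close> term would dominate, giving
    \<open>B\<close> the size of \<open>w ^ P2\<close>.\<close>
  have w1: "w \<preceq> 1"
  proof (rule ccontr)
    assume "\<not> w \<preceq> 1"
    then have w: "1 \<prec> w" by (simp add: vlt_def)
    have "w ^ P1 \<prec> w ^ P2" using vlt_power_mono[OF w exponents(3)] .
    then have "c1 * (w ^ P1 * q s1 ^ P1) \<prec> c2 * (w ^ P2 * q s2 ^ P2)"
      using t2 veq_vlt by blast
    then have "B \<approx> w ^ P2" unfolding B_def using veq_add_vlt t2(1) veq_trans by blast
    then have "w ^ P2 \<prec> 1" using B veq_vlt by blast
    moreover have "1 \<preceq> w ^ P2" using vle_power[OF vlt_imp_vle[OF w], of P2] by simp
    ultimately show False by (simp add: vlt_def)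
  qed
  then show "y - x \<preceq> 1" by (simp add: w_def)
  have small: "c * (w ^ n * e) \<prec> 1" if "c \<approx> 1" "e \<prec> 1" for c n e
  proof -
    have "e * w ^ n \<prec> 1 * 1" using vlt_mult[OF that(2), of "w ^ n" 1] vle_power[OF w1, of n] by simp
    then show ?thesis
      using veq_vlt(1)[OF veq_unit_mult[OF that(1)], of "w ^ n * e" 1] by (simp add: mult.commute)
  qed
  have "h w = B - (c2 * (w ^ P2 * (q s2 ^ P2 - of_nat s2)) + c1 * (w ^ P1 * (q s1 ^ P1 - of_nat s1)))"
    by (simp add: h_def B_def algebra_simps)
  also have "\<dots> \<prec> 1" by (intro vlt_diff vlt_add B small units qs)
  finally show "h (y - x) \<prec> 1" by (simp add: w_def)
qed

definition Z :: "'k set" where "Z = {z. z ^ s2 = 1}"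

lemma Z: "finite Z" "card Z = s2" "x ^ s2 - a ^ s2 = (\<Prod>z\<in>Z. x - z * a)"
  using roots_of_unity_factorization[of s2] s2 char a0 unfolding Z_def by auto

lemma Z_Fp_bar: "z \<in> Z \<Longrightarrow> z \<in> Fp_bar"
  using root_of_unity_Fp_bar[of s2 z] s2 by (simp add: Z_def)

lemma Z_unit: "z \<in> Z \<Longrightarrow> z \<approx> 1"
  using veq_power_iff[of s2 z 1] s2 by (simp add: Z_def)

text \<open>Distinct roots of unity differ by a nonzero element of \<open>Fp_bar\<close>, which has
  size \<open>1\<close>.\<close>

lemma Z_separated:
  assumes "z \<in> Z" "z' \<in> Z" "(z - z') * a \<prec> a" shows "z = z'"
proof (rule ccontr)
  assume "z \<noteq> z'"
  then have "z - z' \<approx> 1"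
    using Fp_bar_unit[OF prime_char] is_subring_diff[OF is_subring_Fp_bar[OF prime_char]] Z_Fp_bar assms
    by simp
  then show False using veq_unit_mult[of "z - z'" a] assms(3) veq_vlt(1) by auto
qed

lemma near_some_root:
  assumes "x ^ s2 - a ^ s2 \<prec> a ^ s2"
  shows "\<exists>z\<in>Z. x - z * a \<prec> a"
proof (rule ccontr)
  assume "\<not> ?thesis"
  then have "a \<preceq> x - z * a" if "z \<in> Z" for z using that by (auto simp: vlt_def)
  then have "(\<Prod>z\<in>Z. a) \<preceq> (\<Prod>z\<in>Z. x - z * a)" by (intro vle_prod)
  then have "a ^ s2 \<preceq> x ^ s2 - a ^ s2" by (simp add: Z(2,3))
  with assms show False by (simp add: vlt_def)
qed

text \<open>If translation by \<open>u/a\<close> permutes the \<open>s2\<close>-th roots of unity modulo the maximal ideal, then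
  summing over all of them gives \<open>s2 u/a \<equiv> 0\<close>.\<close>

lemma translation_small:
  assumes "\<And>z. z \<in> Z \<Longrightarrow> \<exists>z'\<in>Z. u - (z' - z) * a \<prec> a"
  shows "u \<prec> a"
proof -
  obtain g where g: "\<forall>z\<in>Z. g z \<in> Z \<and> u - (g z - z) * a \<prec> a"
    using bchoice[of Z "\<lambda>z z'. z' \<in> Z \<and> u - (z' - z) * a \<prec> a"] assms by blast
  have inj: "inj_on g Z"
  proof (rule inj_onI)
    fix z z' assume z: "z \<in> Z" "z' \<in> Z" "g z = g z'"
    have "(u - (g z - z) * a) - (u - (g z' - z') * a) \<prec> a"
      using g z by (intro vlt_diff[of "u - (g z - z) * a" a "u - (g z' - z') * a"]) auto
    then have "(z - z') * a \<prec> a" using z(3) by (simp add: algebra_simps)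
    with z Z_separated show "z = z'" by blast
  qed
  then have "g ` Z = Z" using g Z(1) by (intro endo_inj_surj) auto
  then have "(\<Sum>z\<in>Z. g z) = (\<Sum>z\<in>Z. z)" using sum.reindex[OF inj, of "\<lambda>z. z"] by simp
  then have "of_nat s2 * u = (\<Sum>z\<in>Z. u - (g z - z) * a)"
    by (simp add: sum_subtractf sum_distrib_right[symmetric] Z(2))
  also have "\<dots> \<prec> a" using g a0 by (intro vlt_sum) auto
  finally show ?thesis using veq_unit_mult[OF units(4)] veq_vlt by blast
qed

text \<open>Let \<open>P = f X - f a\<close>. Both \<open>P\<close> and its derivative are small at
  \<open>z * a\<close>, the derivative because \<open>d2\<close> is zero in \<open>'k\<close>; so at
  least two roots of \<open>P\<close> lie near \<open>z * a\<close>. At a point \<open>x\<close> far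
  from \<open>z * a\<close> their factors contribute at least \<open>|a|^2\<close> to
  \<open>|P x| \<le> |a|\<close>, and the cofactor \<open>G\<close> is at most
  \<open>1 / |a|\<close>.\<close>

lemma avoiding_poly:
  assumes z: "z \<in> Z"
  shows "\<exists>G. degree G = d2 - 2 \<and> lead_coeff G \<approx> 1 \<and>
    (\<forall>x. x \<preceq> a \<longrightarrow> \<not> x - z * a \<prec> a \<longrightarrow> f x - f a \<preceq> a \<longrightarrow> poly G x \<preceq> a powi (-1))"
proof -
  define P where "P = monom c1 d1 + (monom c2 d2 - [:f a:])"
  have pP: "poly P x = f x - f a" for x by (simp add: P_def poly_monom f_def)
  have c20: "c2 \<noteq> 0" using c2 by simp
  have lt': "0 < d2" using d2_gt by simp
  have cd2: "coeff P d2 = c2" using exponents(8) lt' by (simp add: P_def coeff_pCons split: nat.split)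
  have "degree P \<le> d2"
    unfolding P_def using exponents(8) by (intro degree_add_le degree_diff_le) (auto intro: order.trans[OF degree_monom_le])
  moreover have "d2 \<le> degree P" using cd2 c20 by (intro le_degree) simp
  ultimately have deg: "degree P = d2" by simp
  have P0: "P \<noteq> 0" using cd2 c20 by auto
  obtain A where A: "size A = d2" "P = smult c2 (\<Prod>r\<in>#A. [:- r, 1:])"
    using alg_closed_imp_factorization[OF P0] deg cd2 by auto
  have root: "r \<preceq> a" if "r \<in># A" for r
  proof (rule ccontr)
    assume "\<not> r \<preceq> a"
    then have ar: "a \<prec> r" by (simp add: vlt_def)
    have "poly P r = 0" using that by (subst A(2)) (auto simp: poly_prod_linear prod_mset_zero_iff)
    then have "f r = f a" by (simp add: pP)
    then have "r ^ d2 \<approx> a ^ d2"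
      using f_dominant[of r] f_dominant[OF a_gt] vlt_trans[OF a_gt ar] veq_trans veq_sym by metis
    then show False using ar lt' by (simp add: veq_power_iff) (simp add: veq_def vlt_def)
  qed
  have za: "z * a \<approx> a" using veq_unit_mult Z_unit[OF z] by blast
  then have za': "z * a \<preceq> a" by (simp add: veq_def)
  have a12: "a ^ d1 \<prec> a ^ d2" using vlt_power_mono[OF a_gt exponents(8)] .
  have c1le: "c1 * x \<preceq> y \<longleftrightarrow> x \<preceq> y" for x y using veq_unit_mult[OF units(1)] veq_vle by blast
  have c2lt: "c2 * x \<prec> y \<longleftrightarrow> x \<prec> y" for x y using veq_unit_mult[OF units(2)] veq_vlt by blast
  have "z ^ s2 = 1" using z by (simp add: Z_def)
  \<comment> \<open>Hence the leading terms of \<open>f (z * a)\<close> and \<open>f a\<close>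
    cancel.\<close>
  then have "(z * a) ^ d2 = a ^ d2"
    unfolding d2_def by (simp add: power_mult_distrib mult.commute[of P2] power_mult)
  then have "poly P (z * a) = c1 * ((z * a) ^ d1 - a ^ d1)" by (simp add: pP f_def algebra_simps)
  also have "\<dots> \<preceq> a ^ d1" unfolding c1le by (intro vle_diff vle_power za' vle_refl)
  finally have "c2 * (\<Prod>r\<in>#A. z * a - r) \<prec> a ^ d2"
    using a12 vle_vlt_trans by (subst (asm) A(2)) (simp add: poly_prod_linear)
  then have "\<not> a ^ size A \<preceq> (\<Prod>r\<in>#A. z * a - r)" unfolding c2lt A(1) by (simp add: vlt_def)
  then obtain r1 where r1: "r1 \<in># A" "z * a - r1 \<prec> a" using prod_roots_far[of A a "z * a"] by (auto simp: vlt_def)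
  then obtain A1 where A1: "A = add_mset r1 A1" by (meson multi_member_split)
  define Q where "Q = (\<Prod>r\<in>#A1. [:- r, 1:])"
  have PQ: "P = smult c2 ([:- r1, 1:] * Q)" by (subst A(2)) (simp add: A1 Q_def)
  have "(of_nat d2 :: 'k) = 0" using exponents(6) char of_nat_eq_0_iff_char_dvd unfolding d2_def by (metis dvd_mult2)
  then have "pderiv P = monom (of_nat d1 * c1) (d1 - 1)"
    unfolding P_def pderiv_add pderiv_diff pderiv_monom by (simp add: pderiv_pCons)
  then have "a * poly (pderiv P) (z * a) = c1 * (of_nat d1 * (a * (z * a) ^ (d1 - 1)))"
    by (simp add: poly_monom mult_ac)
  also have "\<dots> \<preceq> 1 * a ^ d1"
  proof -
    have "a * (z * a) ^ (d1 - 1) \<preceq> a * a ^ (d1 - 1)" by (intro vle_mult vle_refl vle_power za')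
    also have "a * a ^ (d1 - 1) = a ^ d1" using exponents(7) by (metis One_nat_def Suc_pred less_le_trans pos2 power_Suc)
    finally show ?thesis
      unfolding c1le by (intro vle_mult) (simp_all add: vle_one_iff is_subring_of_nat R)
  qed
  finally have 1: "a * poly (pderiv P) (z * a) \<prec> a ^ d2" using a12 vle_vlt_trans by simp
  \<comment> \<open>In the product rule the term with \<open>z * a - r1\<close> is small as well, so
    \<open>Q\<close> must be small at \<open>z * a\<close> and has a root nearby.\<close>
  have dP: "poly (pderiv P) (z * a) = c2 * (poly Q (z * a) + (z * a - r1) * poly (pderiv Q) (z * a))"
    unfolding PQ pderiv_smult pderiv_mult by (simp add: pderiv_pCons algebra_simps)
  have sA1: "size A1 = d2 - 1" using A(1) A1 by simp
  have Sd2: "a ^ d2 = a * a ^ (d2 - 1)" using lt' by (metis Suc_pred' power_Suc)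
  have "(z * a - r1) * (a * poly (pderiv Q) (z * a)) \<prec> a * a ^ (d2 - 1)"
    unfolding Q_def using pderiv_prod_roots_bound[OF za', of A1] root A1 sA1 a0
    by (intro vlt_mult r1) auto
  moreover have "a * (poly Q (z * a) + (z * a - r1) * poly (pderiv Q) (z * a)) \<prec> a ^ d2"
    using 1 unfolding dP by (metis c2lt mult.left_commute)
  ultimately have "a * (poly Q (z * a) + (z * a - r1) * poly (pderiv Q) (z * a)) -
      (z * a - r1) * (a * poly (pderiv Q) (z * a)) \<prec> a ^ d2"
    unfolding Sd2 by (intro vlt_diff)
  then have "poly Q (z * a) * a \<prec> a ^ (d2 - 1) * a" unfolding Sd2 by (simp add: algebra_simps)
  then have "poly Q (z * a) \<prec> a ^ (d2 - 1)" using vlt_mult_cancel[OF a0] by blast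
  then have "\<not> a ^ size A1 \<preceq> (\<Prod>r\<in>#A1. z * a - r)"
    unfolding sA1 by (simp add: Q_def poly_prod_linear vlt_def)
  then obtain r2 where r2: "r2 \<in># A1" "z * a - r2 \<prec> a" using prod_roots_far[of A1 a "z * a"] by (auto simp: vlt_def)
  then obtain A2 where A2: "A1 = add_mset r2 A2" by (meson multi_member_split)
  define G where "G = smult c2 (\<Prod>r\<in>#A2. [:- r, 1:])"
  have PG: "P = [:- r1, 1:] * ([:- r2, 1:] * G)" by (subst A(2)) (simp add: A1 A2 G_def mult_ac)
  have G0: "G \<noteq> 0" using PG P0 by auto
  have nz: "[:- r2, 1:] * G \<noteq> 0" using G0 by (simp only: mult_eq_0_iff) simp
  have "degree P = 1 + degree ([:- r2, 1:] * G)" unfolding PG by (subst degree_mult_eq[OF _ nz]) simp_all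
  also have "degree ([:- r2, 1:] * G) = 1 + degree G" using G0 by (subst degree_mult_eq) simp_all
  finally have "degree P = 1 + (1 + degree G)" .
  then have 2: "degree G = d2 - 2" using deg by simp
  have "lead_coeff P = lead_coeff G" unfolding PG lead_coeff_mult by simp
  then have 3: "lead_coeff G \<approx> 1" using cd2 deg units(2) by simp
  have "poly G x \<preceq> a powi (-1)" if x: "x \<preceq> a" "\<not> x - z * a \<prec> a" "f x - f a \<preceq> a" for x
  proof -
    have far: "a \<preceq> x - r" if "z * a - r \<prec> a" for r
    proof (rule ccontr)
      assume "\<not> a \<preceq> x - r"
      then have "(x - r) - (z * a - r) \<prec> a" using that vlt_diff[of "x - r" a "z * a - r"] by (simp add: vlt_def)
      with x(2) show False by simp
    qed
    have "a * (a * poly G x) \<preceq> (x - r1) * ((x - r2) * poly G x)"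
      by (intro vle_mult far r1 r2 vle_refl)
    also have "\<dots> = poly P x" unfolding PG by (simp add: algebra_simps)
    also have "\<dots> \<preceq> a" unfolding pP by (rule x(3))
    finally have "(poly G x * a) * a \<preceq> 1 * a" by (simp add: mult_ac)
    then have "poly G x * a \<preceq> 1" by (rule vle_mult_cancel[OF a0, THEN iffD1])
    also have "1 = inverse a * a" using a0 by simp
    finally have "poly G x * a \<preceq> inverse a * a" .
    then show ?thesis using vle_mult_cancel[OF a0] by (simp add: power_int_minus)
  qed
  with 2 3 show ?thesis by blast
qed

end

section \<open>Partial field embeddings\<close>

text \<open>A partial embedding of fields is represented by its graph, a subring of \<open>'k \<times> 'k\<close>.\<close>

definition iso_graph :: "('k::field \<times> 'k) set \<Rightarrow> bool" where
  "iso_graph \<Gamma> \<longleftrightarrow> (1, 1) \<in> \<Gamma> \<and>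
     (\<forall>x y x' y'. (x, y) \<in> \<Gamma> \<longrightarrow> (x', y') \<in> \<Gamma> \<longrightarrow> (x - x', y - y') \<in> \<Gamma> \<and> (x * x', y * y') \<in> \<Gamma>) \<and>
     (\<forall>x y. (x, y) \<in> \<Gamma> \<longrightarrow> (x = 0 \<longleftrightarrow> y = 0))"

definition cpair :: "('k::field \<times> 'k) set \<Rightarrow> 'k poly \<Rightarrow> 'k poly \<Rightarrow> bool" where
  "cpair \<Gamma> q q' \<longleftrightarrow> (\<forall>i. (coeff q i, coeff q' i) \<in> \<Gamma>)"

text \<open>Maximal graphs take the place of automorphisms of \<open>'k\<close>: every element
  algebraic over the domain already lies in it (\<open>max_graph_algebraic\<close>).\<close>

definition max_graph :: "('k::field \<times> 'k) set \<Rightarrow> bool" where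
  "max_graph \<Gamma> \<longleftrightarrow> iso_graph \<Gamma> \<and> (\<forall>\<Delta>. iso_graph \<Delta> \<longrightarrow> \<Gamma> \<subseteq> \<Delta> \<longrightarrow> \<Delta> = \<Gamma>)"

definition adjoin_pair :: "('k::field \<times> 'k) set \<Rightarrow> 'k \<Rightarrow> 'k \<Rightarrow> ('k \<times> 'k) set" where
  "adjoin_pair \<Gamma> x y = {(poly q x, poly q' y) |q q'. cpair \<Gamma> q q'}"

lemma iso_graph_1: "iso_graph \<Gamma> \<Longrightarrow> (1, 1) \<in> \<Gamma>"
  and iso_graph_diff: "iso_graph \<Gamma> \<Longrightarrow> (x, y) \<in> \<Gamma> \<Longrightarrow> (x', y') \<in> \<Gamma> \<Longrightarrow> (x - x', y - y') \<in> \<Gamma>"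
  and iso_graph_mult: "iso_graph \<Gamma> \<Longrightarrow> (x, y) \<in> \<Gamma> \<Longrightarrow> (x', y') \<in> \<Gamma> \<Longrightarrow> (x * x', y * y') \<in> \<Gamma>"
  and iso_graph_zero_iff: "iso_graph \<Gamma> \<Longrightarrow> (x, y) \<in> \<Gamma> \<Longrightarrow> x = 0 \<longleftrightarrow> y = 0"
  unfolding iso_graph_def by blast+

lemma iso_graph_0: "iso_graph \<Gamma> \<Longrightarrow> (0, 0) \<in> \<Gamma>"
  using iso_graph_diff[of \<Gamma> 1 1 1 1] iso_graph_1[of \<Gamma>] by simp

lemma iso_graph_add:
  "iso_graph \<Gamma> \<Longrightarrow> (x, y) \<in> \<Gamma> \<Longrightarrow> (x', y') \<in> \<Gamma> \<Longrightarrow> (x + x', y + y') \<in> \<Gamma>"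
  using iso_graph_diff[of \<Gamma> 0 0 x' y'] iso_graph_diff[of \<Gamma> x y "- x'" "- y'"] iso_graph_0[of \<Gamma>] by simp

lemma iso_graph_power: "iso_graph \<Gamma> \<Longrightarrow> (x, y) \<in> \<Gamma> \<Longrightarrow> (x ^ n, y ^ n) \<in> \<Gamma>"
  by (induction n) (auto intro: iso_graph_1 iso_graph_mult)

lemma iso_graph_sum:
  assumes "iso_graph \<Gamma>" "\<And>i. i \<in> I \<Longrightarrow> (g i, g' i) \<in> \<Gamma>"
  shows "(sum g I, sum g' I) \<in> \<Gamma>"
  using assms(2)
  by (induction I rule: infinite_finite_induct) (auto intro: iso_graph_0 iso_graph_add assms(1))

lemma iso_graph_prod:
  assumes "iso_graph \<Gamma>" "\<And>i. i \<in> I \<Longrightarrow> (g i, g' i) \<in> \<Gamma>"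
  shows "(prod g I, prod g' I) \<in> \<Gamma>"
  using assms(2)
  by (induction I rule: infinite_finite_induct) (auto intro: iso_graph_1 iso_graph_mult assms(1))

lemma iso_graph_eq_iff:
  "iso_graph \<Gamma> \<Longrightarrow> (x, y) \<in> \<Gamma> \<Longrightarrow> (x', y') \<in> \<Gamma> \<Longrightarrow> x = x' \<longleftrightarrow> y = y'"
  using iso_graph_zero_iff[of \<Gamma> "x - x'" "y - y'"] iso_graph_diff[of \<Gamma> x y x' y'] by simp

lemma is_subring_Domain: "iso_graph \<Gamma> \<Longrightarrow> is_subring (Domain \<Gamma>)"
  unfolding is_subring_def
  by (meson Domain.intros DomainE iso_graph_1 iso_graph_diff iso_graph_mult)

lemma cpair_0: "iso_graph \<Gamma> \<Longrightarrow> cpair \<Gamma> 0 0"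
  by (simp add: cpair_def iso_graph_0)

lemma cpair_monom: "iso_graph \<Gamma> \<Longrightarrow> (x, y) \<in> \<Gamma> \<Longrightarrow> cpair \<Gamma> (monom x n) (monom y n)"
  by (auto simp: cpair_def iso_graph_0)

lemma cpair_diff: "iso_graph \<Gamma> \<Longrightarrow> cpair \<Gamma> q q' \<Longrightarrow> cpair \<Gamma> r r' \<Longrightarrow> cpair \<Gamma> (q - r) (q' - r')"
  by (auto simp: cpair_def iso_graph_diff)

lemma cpair_add: "iso_graph \<Gamma> \<Longrightarrow> cpair \<Gamma> q q' \<Longrightarrow> cpair \<Gamma> r r' \<Longrightarrow> cpair \<Gamma> (q + r) (q' + r')"
  by (auto simp: cpair_def iso_graph_add)

lemma cpair_mult: "iso_graph \<Gamma> \<Longrightarrow> cpair \<Gamma> q q' \<Longrightarrow> cpair \<Gamma> r r' \<Longrightarrow> cpair \<Gamma> (q * r) (q' * r')"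
  by (auto simp: cpair_def coeff_mult intro!: iso_graph_sum iso_graph_mult)

lemma cpair_coeff_zero: "iso_graph \<Gamma> \<Longrightarrow> cpair \<Gamma> q q' \<Longrightarrow> coeff q i = 0 \<longleftrightarrow> coeff q' i = 0"
  unfolding cpair_def using iso_graph_zero_iff by blast

lemma cpair_zero: "iso_graph \<Gamma> \<Longrightarrow> cpair \<Gamma> q q' \<Longrightarrow> q = 0 \<longleftrightarrow> q' = 0"
  using cpair_coeff_zero[of \<Gamma> q q'] by (auto simp: poly_eq_iff)

lemma cpair_degree: "iso_graph \<Gamma> \<Longrightarrow> cpair \<Gamma> q q' \<Longrightarrow> degree q = degree q'"
  using cpair_coeff_zero[of \<Gamma> q q'] unfolding degree_def by simp

lemma cpair_exists:
  assumes "iso_graph \<Gamma>" "coeffs_in (Domain \<Gamma>) q"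
  shows "\<exists>q'. cpair \<Gamma> q q'"
proof -
  define g where "g x = (SOME y. (x, y) \<in> \<Gamma>)" for x
  have g: "(x, g x) \<in> \<Gamma>" if "x \<in> Domain \<Gamma>" for x
    unfolding g_def using that by (auto intro: someI)
  \<comment> \<open>\<open>coeff_map_poly\<close> asks for a map that sends \<open>0\<close> to
    \<open>0\<close>.\<close>
  have "g 0 = 0"
    using g[of 0] iso_graph_0[OF assms(1)] iso_graph_zero_iff[OF assms(1)] by blast
  then have "cpair \<Gamma> q (map_poly g q)"
    using assms(2) g by (auto simp: cpair_def coeffs_in_def coeff_map_poly)
  then show ?thesis ..
qed

lemma adjoin_pair_superset: "iso_graph \<Gamma> \<Longrightarrow> \<Gamma> \<subseteq> adjoin_pair \<Gamma> x y"
proof clarify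
  fix u v assume "iso_graph \<Gamma>" "(u, v) \<in> \<Gamma>"
  then have "cpair \<Gamma> (monom u 0) (monom v 0)" by (rule cpair_monom)
  moreover have "u = poly (monom u 0) x" "v = poly (monom v 0) y" by (simp_all add: poly_monom)
  ultimately show "(u, v) \<in> adjoin_pair \<Gamma> x y" unfolding adjoin_pair_def by blast
qed

lemma in_adjoin_pair: "iso_graph \<Gamma> \<Longrightarrow> (x, y) \<in> adjoin_pair \<Gamma> x y"
proof -
  assume "iso_graph \<Gamma>"
  then have "cpair \<Gamma> (monom 1 1) (monom 1 1)" by (intro cpair_monom iso_graph_1)
  moreover have "x = poly (monom 1 1) x" "y = poly (monom 1 1) y" by (simp_all add: poly_monom)
  ultimately show "(x, y) \<in> adjoin_pair \<Gamma> x y" unfolding adjoin_pair_def by blast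
qed

text \<open>\<open>zero\<close> says that \<open>x\<close> and \<open>y\<close> satisfy
  corresponding equations, which makes \<open>x \<mapsto> y\<close> well defined and
  injective.\<close>

lemma iso_graph_adjoin_pair:
  assumes G: "iso_graph \<Gamma>"
    and zero: "\<And>q q'. cpair \<Gamma> q q' \<Longrightarrow> poly q x = 0 \<longleftrightarrow> poly q' y = 0"
  shows "iso_graph (adjoin_pair \<Gamma> x y)"
  unfolding iso_graph_def
proof (intro conjI allI impI)
  show "(1, 1) \<in> adjoin_pair \<Gamma> x y" using adjoin_pair_superset[OF G] iso_graph_1[OF G] by blast
next
  fix u v u' v' assume "(u, v) \<in> adjoin_pair \<Gamma> x y" "(u', v') \<in> adjoin_pair \<Gamma> x y"
  then obtain q q' r r' where q: "cpair \<Gamma> q q'" "cpair \<Gamma> r r'" and uv: "u = poly q x" "v = poly q' y"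
      "u' = poly r x" "v' = poly r' y"
    unfolding adjoin_pair_def by blast
  show "(u - u', v - v') \<in> adjoin_pair \<Gamma> x y"
    unfolding uv poly_diff[symmetric] adjoin_pair_def using cpair_diff[OF G q] by blast
  show "(u * u', v * v') \<in> adjoin_pair \<Gamma> x y"
    unfolding uv poly_mult[symmetric] adjoin_pair_def using cpair_mult[OF G q] by blast
next
  fix u v assume "(u, v) \<in> adjoin_pair \<Gamma> x y"
  then show "u = 0 \<longleftrightarrow> v = 0" by (auto simp: adjoin_pair_def zero)
qed

definition inverse_closed :: "('k::field \<times> 'k) set \<Rightarrow> bool" where
  "inverse_closed \<Gamma> \<longleftrightarrow> (\<forall>x y. (x, y) \<in> \<Gamma> \<longrightarrow> (inverse x, inverse y) \<in> \<Gamma>)"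

text \<open>Division with remainder, carried out in parallel on a polynomial and its image. The
  exclusive degree bound \<open>n\<close> serves the induction.\<close>

lemma cpair_division:
  assumes G: "iso_graph \<Gamma>" and inv: "inverse_closed \<Gamma>" and P: "cpair \<Gamma> P P'" "P \<noteq> 0"
    and q: "cpair \<Gamma> q q'" "\<forall>i\<ge>n. coeff q i = 0"
  shows "\<exists>t t' r r'. cpair \<Gamma> t t' \<and> cpair \<Gamma> r r' \<and> q = t * P + r \<and> q' = t' * P' + r' \<and>
    (r = 0 \<or> degree r < degree P)"
  using q
proof (induction n arbitrary: q q')
  case 0
  then have "q = 0" by (auto simp: poly_eq_iff)
  moreover from this 0 have "q' = 0" using cpair_zero[OF G] by blast
  ultimately show ?case using cpair_0[OF G] by (intro exI[of _ 0]) auto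
next
  case (Suc n)
  show ?case
  proof (cases "n < degree P")
    case True
    have "degree q \<le> n" using Suc.prems(2) by (intro degree_le) auto
    then have "degree q < degree P" using True by simp
    then show ?thesis
      using Suc.prems(1) cpair_0[OF G]
      by (intro exI[of _ 0] exI[of _ q] exI[of _ q']) auto
  next
    case False
    define m where "m = n - degree P"
    define c where "c = coeff q n * inverse (lead_coeff P)"
    define c' where "c' = coeff q' n * inverse (lead_coeff P')"
    have dP: "degree P' = degree P" using cpair_degree[OF G P(1)] by simp
    have "(c, c') \<in> \<Gamma>"
      unfolding c_def c'_def dP using Suc.prems(1) P(1) inv
      by (intro iso_graph_mult G) (auto simp: cpair_def inverse_closed_def)
    then have mon: "cpair \<Gamma> (monom c m) (monom c' m)" by (rule cpair_monom[OF G])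
    define q1 where "q1 = q - monom c m * P"
    define q1' where "q1' = q' - monom c' m * P'"
    have q1: "cpair \<Gamma> q1 q1'"
      unfolding q1_def q1'_def by (intro cpair_diff cpair_mult G mon P Suc.prems)
    have "coeff q1 i = 0" if "n \<le> i" for i
    proof (cases "i = n")
      case True
      then show ?thesis using False P(2) by (simp add: q1_def coeff_monom_mult m_def c_def)
    next
      case F: False
      then have "degree P < i - m" using that False by (auto simp: m_def)
      then have "coeff (monom c m * P) i = 0" by (simp add: coeff_monom_mult coeff_eq_0)
      then show ?thesis using Suc.prems(2) that F by (simp add: q1_def)
    qed
    then obtain t t' r r' where t: "cpair \<Gamma> t t'" "cpair \<Gamma> r r'" "q1 = t * P + r" "q1' = t' * P' + r'"
        "r = 0 \<or> degree r < degree P"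
      using Suc.IH[OF q1] by blast
    have "q = (t + monom c m) * P + r" "q' = (t' + monom c' m) * P' + r'"
      using t(3,4) by (simp_all add: q1_def q1'_def algebra_simps)
    then show ?thesis using cpair_add[OF G t(1) mon] t(2,5) by blast
  qed
qed

lemma cpair_divide:
  assumes "iso_graph \<Gamma>" "inverse_closed \<Gamma>" "cpair \<Gamma> P P'" "P \<noteq> 0" "cpair \<Gamma> q q'"
  obtains t t' r r' where "cpair \<Gamma> t t'" "cpair \<Gamma> r r'" "q = t * P + r" "q' = t' * P' + r'"
    "r = 0 \<or> degree r < degree P"
  using cpair_division[OF assms(1-5), of "Suc (degree q)"] by (auto simp: coeff_eq_0)

text \<open>If \<open>q\<close> vanishes at \<open>x\<close>, it is a multiple of the minimal
  \<open>P\<close>. Conversely, a polynomial \<open>g\<close> of least degree whose image vanishes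
  at \<open>y\<close> divides \<open>P\<close> and \<open>q\<close>; by minimality of
  \<open>P\<close> the cofactor \<open>t\<close> is nonzero at \<open>x\<close>, so
  \<open>g\<close>, and with it \<open>q\<close>, vanishes there.\<close>

lemma cpair_minimal:
  assumes G: "iso_graph \<Gamma>" and inv: "inverse_closed \<Gamma>"
    and P: "cpair \<Gamma> P P'" "P \<noteq> 0" "poly P x = 0" "poly P' y = 0"
    and min: "\<And>q q'. cpair \<Gamma> q q' \<Longrightarrow> q \<noteq> 0 \<Longrightarrow> poly q x = 0 \<Longrightarrow> degree P \<le> degree q"
    and q: "cpair \<Gamma> q q'"
  shows "poly q x = 0 \<longleftrightarrow> poly q' y = 0"
proof
  assume qx: "poly q x = 0"
  obtain t t' r r' where t: "cpair \<Gamma> t t'" "cpair \<Gamma> r r'" "q = t * P + r" "q' = t' * P' + r'"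
      "r = 0 \<or> degree r < degree P"
    using cpair_divide[OF G inv P(1,2) q] .
  have "poly r x = 0" using qx t(3) P(3) by simp
  then have "r = 0" using min[OF t(2)] t(5) by (meson not_less)
  then have "r' = 0" using cpair_zero[OF G t(2)] by simp
  then show "poly q' y = 0" using t(4) P(4) by simp
next
  assume qy: "poly q' y = 0"
  define D where "D n \<longleftrightarrow> (\<exists>g g'. cpair \<Gamma> g g' \<and> g \<noteq> 0 \<and> poly g' y = 0 \<and> degree g = n)" for n
  have "\<exists>n. D n" unfolding D_def using P by blast
  then have "D (LEAST n. D n)" by (rule LeastI_ex)
  then obtain g g' where g: "cpair \<Gamma> g g'" "g \<noteq> 0" "poly g' y = 0" "degree g = (LEAST n. D n)"
    unfolding D_def by blast
  have gmin: "r = 0" if "cpair \<Gamma> r r'" "poly r' y = 0" "r = 0 \<or> degree r < degree g" for r r'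
  proof (rule ccontr)
    assume "r \<noteq> 0"
    then have "D (degree r)" "degree r < (LEAST n. D n)" using that g(4) unfolding D_def by auto
    then show False using not_less_Least by blast
  qed
  have mult: "\<exists>t t'. r = t * g \<and> cpair \<Gamma> t t'"
    if r: "cpair \<Gamma> r r'" "poly r' y = 0" for r r'
  proof -
    obtain t t' e e' where t: "cpair \<Gamma> t t'" "cpair \<Gamma> e e'" "r = t * g + e" "r' = t' * g' + e'"
        "e = 0 \<or> degree e < degree g"
      using cpair_divide[OF G inv g(1,2) r(1)] .
    have "poly e' y = 0" using r(2) t(4) g(3) by simp
    then have "e = 0" using gmin t(2,5) by blast
    then show ?thesis using t(1,3) by auto
  qed
  obtain t t' where t: "P = t * g" "cpair \<Gamma> t t'" using mult[OF P(1,4)] by blast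
  have t0: "t \<noteq> 0" using t P(2) by auto
  have "degree g \<noteq> 0"
  proof
    assume "degree g = 0"
    then have "degree g' = 0" using cpair_degree[OF G g(1)] by simp
    then obtain c where "g' = [:c:]" by (metis degree_eq_zeroE)
    then show False using g(1-3) cpair_zero[OF G g(1)] by simp
  qed
  moreover have "degree P = degree t + degree g" unfolding t(1) using t0 g(2) by (rule degree_mult_eq)
  ultimately have "poly t x \<noteq> 0" using min[OF t(2) t0] by linarith
  then have "poly g x = 0" using P(3) t(1) by simp
  then show "poly q x = 0" using mult[OF q qy] by auto
qed

lemma max_graph_exists:
  assumes "iso_graph \<Gamma>"
  shows "\<exists>\<Delta>. max_graph \<Delta> \<and> \<Gamma> \<subseteq> \<Delta>"
proof -
  define \<A> where "\<A> = {\<Delta>. iso_graph \<Delta> \<and> \<Gamma> \<subseteq> \<Delta>}"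
  have "\<exists>M\<in>\<A>. \<forall>X\<in>\<A>. M \<subseteq> X \<longrightarrow> X = M"
  proof (rule subset_Zorn_nonempty)
    show "\<A> \<noteq> {}" using assms by (auto simp: \<A>_def)
    fix \<C> assume C: "\<C> \<noteq> {}" "subset.chain \<A> \<C>"
    then have iso: "iso_graph X" "\<Gamma> \<subseteq> X" if "X \<in> \<C>" for X
      using that unfolding subset.chain_def \<A>_def by auto
    have "iso_graph (\<Union>\<C>)"
      unfolding iso_graph_def
    proof (intro conjI allI impI)
      show "(1, 1) \<in> \<Union>\<C>" using C(1) iso iso_graph_1 by blast
    next
      fix x y x' y' assume "(x, y) \<in> \<Union>\<C>" "(x', y') \<in> \<Union>\<C>"
      then obtain X where X: "X \<in> \<C>" "(x, y) \<in> X" "(x', y') \<in> X"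
        using C(2) unfolding subset.chain_def by blast
      show "(x - x', y - y') \<in> \<Union>\<C>" using iso_graph_diff[OF iso(1) X(2,3)] X(1) by blast
      show "(x * x', y * y') \<in> \<Union>\<C>" using iso_graph_mult[OF iso(1) X(2,3)] X(1) by blast
    next
      fix x y assume "(x, y) \<in> \<Union>\<C>"
      then show "x = 0 \<longleftrightarrow> y = 0" using iso(1) iso_graph_zero_iff by blast
    qed
    moreover have "\<Gamma> \<subseteq> \<Union>\<C>" using C(1) iso(2) by blast
    ultimately show "\<Union>\<C> \<in> \<A>" by (simp add: \<A>_def)
  qed
  then obtain M where M: "M \<in> \<A>" "\<And>X. X \<in> \<A> \<Longrightarrow> M \<subseteq> X \<Longrightarrow> X = M" by metis
  then have "iso_graph M" "\<Gamma> \<subseteq> M" by (simp_all add: \<A>_def)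
  moreover have "X = M" if "iso_graph X" "M \<subseteq> X" for X
    using M(2)[of X] that \<open>\<Gamma> \<subseteq> M\<close> by (auto simp: \<A>_def)
  ultimately show ?thesis unfolding max_graph_def by blast
qed

lemma max_graph_iso: "max_graph \<Gamma> \<Longrightarrow> iso_graph \<Gamma>"
  by (simp add: max_graph_def)

lemma max_graph_adjoin:
  assumes "max_graph \<Gamma>" "\<And>q q'. cpair \<Gamma> q q' \<Longrightarrow> poly q x = 0 \<longleftrightarrow> poly q' y = 0"
  shows "(x, y) \<in> \<Gamma>"
  using assms iso_graph_adjoin_pair adjoin_pair_superset in_adjoin_pair max_graph_iso
  unfolding max_graph_def by metis

text \<open>The map extends by \<open>1/x \<mapsto> 1/y\<close>: clearing denominators turns the
  vanishing of polynomials at these points into the vanishing of a pair in the graph.\<close>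

lemma max_graph_inverse_closed:
  assumes "max_graph \<Gamma>" shows "inverse_closed \<Gamma>"
  unfolding inverse_closed_def
proof (intro allI impI)
  fix x y assume xy: "(x, y) \<in> \<Gamma>"
  note G = max_graph_iso[OF assms]
  show "(inverse x, inverse y) \<in> \<Gamma>"
  proof (cases "x = 0")
    case True
    then have "y = 0" using iso_graph_zero_iff[OF G xy] by simp
    with True show ?thesis using iso_graph_0[OF G] by simp
  next
    case x0: False
    then have y0: "y \<noteq> 0" using iso_graph_zero_iff[OF G xy] by simp
    show ?thesis
    proof (rule max_graph_adjoin[OF assms])
      fix q q' assume q: "cpair \<Gamma> q q'"
      define r where "r = (\<Sum>i\<le>degree q. coeff q i * x ^ (degree q - i))"
      define r' where "r' = (\<Sum>i\<le>degree q. coeff q' i * y ^ (degree q - i))"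
      have "(r, r') \<in> \<Gamma>"
        unfolding r_def r'_def using q xy
        by (intro iso_graph_sum iso_graph_mult iso_graph_power G) (auto simp: cpair_def)
      then have "r = 0 \<longleftrightarrow> r' = 0" by (rule iso_graph_zero_iff[OF G])
      moreover have "r = x ^ degree q * poly q (inverse x)"
        using x0 by (auto simp: r_def poly_altdef sum_distrib_left power_diff field_simps intro!: sum.cong)
      moreover have "r' = y ^ degree q * poly q' (inverse y)"
        using y0 by (auto simp: r'_def poly_altdef cpair_degree[OF G q, symmetric] sum_distrib_left
            power_diff field_simps intro!: sum.cong)
      ultimately show "poly q (inverse x) = 0 \<longleftrightarrow> poly q' (inverse y) = 0"
        using x0 y0 by simp
    qed
  qed
qed

lemma minimal_poly_exists:
  assumes "P \<noteq> 0" "coeffs_in R P" "poly P x = 0"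
  obtains Q where "Q \<noteq> 0" "coeffs_in R Q" "poly Q x = 0"
    "\<And>q. coeffs_in R q \<Longrightarrow> q \<noteq> 0 \<Longrightarrow> poly q x = 0 \<Longrightarrow> degree Q \<le> degree q"
proof -
  define D where "D n \<longleftrightarrow> (\<exists>g. coeffs_in R g \<and> g \<noteq> 0 \<and> poly g x = 0 \<and> degree g = n)" for n
  have "\<exists>n. D n" unfolding D_def using assms by blast
  then have "D (LEAST n. D n)" by (rule LeastI_ex)
  then obtain Q where Q: "coeffs_in R Q" "Q \<noteq> 0" "poly Q x = 0" "degree Q = (LEAST n. D n)"
    unfolding D_def by blast
  show ?thesis
  proof (rule that[OF Q(2,1,3)])
    fix q assume "coeffs_in R q" "q \<noteq> 0" "poly q x = 0"
    then have "D (degree q)" unfolding D_def by blast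
    then show "degree Q \<le> degree q" unfolding Q(4) by (rule Least_le)
  qed
qed

lemma degree_pos_if_root: "P \<noteq> 0 \<Longrightarrow> poly P x = 0 \<Longrightarrow> 0 < degree P"
  by (cases "degree P = 0") (auto elim!: degree_eq_zeroE)

text \<open>The image of the minimal polynomial of \<open>x\<close> has a root \<open>y\<close>,
  since \<open>'k\<close> is algebraically closed; the embedding extends by
  \<open>x \<mapsto> y\<close>, and maximality puts \<open>x\<close> into the domain.\<close>

lemma max_graph_algebraic:
  fixes \<Gamma> :: "('k::alg_closed_field \<times> 'k) set"
  assumes max: "max_graph \<Gamma>" and P: "P \<noteq> 0" "coeffs_in (Domain \<Gamma>) P" "poly P x = 0"
  shows "x \<in> Domain \<Gamma>"
proof -
  note G = max_graph_iso[OF max] and inv = max_graph_inverse_closed[OF max]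
  obtain Q where Q: "Q \<noteq> 0" "coeffs_in (Domain \<Gamma>) Q" "poly Q x = 0"
    "\<And>q. coeffs_in (Domain \<Gamma>) q \<Longrightarrow> q \<noteq> 0 \<Longrightarrow> poly q x = 0 \<Longrightarrow> degree Q \<le> degree q"
    by (rule minimal_poly_exists[OF P]) blast
  obtain Q' where Q': "cpair \<Gamma> Q Q'" using cpair_exists[OF G Q(2)] by blast
  have "degree Q' > 0" using degree_pos_if_root[OF Q(1,3)] cpair_degree[OF G Q'] by simp
  then obtain y where y: "poly Q' y = 0" using alg_closed_imp_poly_has_root by blast
  have "(x, y) \<in> \<Gamma>"
  proof (rule max_graph_adjoin[OF max])
    fix q q' assume q: "cpair \<Gamma> q q'"
    show "poly q x = 0 \<longleftrightarrow> poly q' y = 0"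
    proof (rule cpair_minimal[OF G inv Q' Q(1,3) y _ q])
      fix q q' assume "cpair \<Gamma> q q'" "q \<noteq> 0" "poly q x = 0"
      then show "degree Q \<le> degree q" using Q(4) unfolding cpair_def coeffs_in_def by blast
    qed
  qed
  then show ?thesis by blast
qed

lemma coeff_power_monom_plus_const:
  fixes Y :: "'k::field"
  assumes "0 < q" "0 < s"
  shows "coeff ((monom 1 q + [:Y:]) ^ s) (q * (s - 1)) = of_nat s * Y"
proof -
  have "(monom 1 q + [:Y:]) ^ s = (\<Sum>j\<le>s. of_nat (s choose j) * monom 1 q ^ j * [:Y:] ^ (s - j))"
    by (rule binomial_ring)
  also have "\<dots> = (\<Sum>j\<le>s. monom (of_nat (s choose j) * Y ^ (s - j)) (q * j))"
  proof (intro sum.cong refl)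
    fix j
    show "of_nat (s choose j) * monom 1 q ^ j * [:Y:] ^ (s - j) =
        monom (of_nat (s choose j) * Y ^ (s - j)) (q * j)"
      by (simp add: of_nat_poly monom_power poly_const_pow smult_monom mult_ac)
  qed
  finally have "coeff ((monom 1 q + [:Y:]) ^ s) (q * (s - 1)) =
      (\<Sum>j\<le>s. if j = s - 1 then of_nat (s choose j) * Y ^ (s - j) else 0)"
    using assms(1) by (auto simp: coeff_sum intro!: sum.cong)
  also have "\<dots> = of_nat (s choose (s - 1)) * Y ^ (s - (s - 1))"
    by (simp add: sum.delta)
  also have "\<dots> = of_nat s * Y"
    using assms(2) binomial_symmetric[of "s - 1" s] by simp
  finally show ?thesis .
qed

text \<open>Write \<open>d = q * s\<close> with \<open>q\<close> a power of the characteristic and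
  \<open>s\<close> prime to it. Then \<open>(X - x) ^ d = (X ^ q + Y) ^ s\<close> with
  \<open>Y = (- x) ^ q\<close>, and the coefficient \<open>s * Y\<close> of
  \<open>X ^ (q * (s - 1))\<close> shows that \<open>Y\<close> is in \<open>F\<close>.\<close>

lemma purely_inseparable:
  fixes x c :: "'k::field"
  assumes p: "prime CHAR('k)" and F: "is_subring F" "\<And>z. z \<in> F \<Longrightarrow> inverse z \<in> F"
    and c: "c \<noteq> 0" and d: "0 < d" and P: "coeffs_in F (smult c ([:- x, 1:] ^ d))"
  shows "\<exists>e. x ^ (CHAR('k) ^ e) \<in> F"
proof -
  have "\<not> is_unit CHAR('k)" "d \<noteq> 0" using p d by auto
  then obtain s where s: "d = CHAR('k) ^ multiplicity CHAR('k) d * s" "\<not> CHAR('k) dvd s"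
    using multiplicity_decompose'[of d "CHAR('k)"] by blast
  define e where "e = multiplicity CHAR('k) d"
  define q where "q = CHAR('k) ^ e"
  have q0: "0 < q" using prime_gt_0_nat[OF p] by (simp add: q_def)
  have s0: "0 < s" using s(2) by (intro gr0I) simp
  have ds: "d = q * s" using s(1) by (simp add: q_def e_def)
  define Y where "Y = (- x) ^ q"
  have "[:- x, 1:] ^ q = (monom 1 1 + [:- x:]) ^ q"
    by (simp add: monom_altdef)
  also have "\<dots> = monom 1 1 ^ q + [:- x:] ^ q"
    by (rule freshmans_dream'[of _ e]) (simp_all add: p q_def)
  also have "\<dots> = monom 1 q + [:Y:]"
    by (simp add: monom_power poly_const_pow Y_def)
  finally have dq: "[:- x, 1:] ^ d = (monom 1 q + [:Y:]) ^ s" by (simp add: ds power_mult)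
  have "lead_coeff (smult c ([:- x, 1:] ^ d)) = c"
    by (simp add: lead_coeff_power)
  then have cF: "c \<in> F" using P unfolding coeffs_in_def by metis
  have "c * (of_nat s * Y) \<in> F"
    using P coeff_power_monom_plus_const[OF q0 s0, of Y] unfolding coeffs_in_def dq
    by (metis coeff_smult)
  from is_subring_mult[OF F(1) F(2)[OF is_subring_of_nat[OF F(1)]]
      is_subring_mult[OF F(1) F(2)[OF cF] this]]
  have "inverse (of_nat s) * (inverse c * (c * (of_nat s * Y))) \<in> F" .
  moreover have "(of_nat s :: 'k) \<noteq> 0" using s(2) of_nat_eq_0_iff_char_dvd by blast
  then have "inverse (of_nat s) * (inverse c * (c * (of_nat s * Y))) = Y"
    using c by (simp add: field_simps)
  ultimately have "Y \<in> F" by simp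
  moreover have "Y = x ^ q \<or> Y = - (x ^ q)" unfolding Y_def by (cases "even q") auto
  ultimately have "x ^ q \<in> F" using is_subring_minus[OF F(1), of Y] by auto
  then show ?thesis unfolding q_def by blast
qed

text \<open>A substitute for Galois theory. Each root \<open>y\<close> of the minimal polynomial
  \<open>Q\<close> gives an embedding \<open>x \<mapsto> y\<close>; its maximal extension also fixes
  \<open>x\<close>, so \<open>y = x\<close>. Hence \<open>Q\<close> is a constant times a power of
  \<open>X - x\<close>.\<close>

theorem fixed_by_max_graphs:
  fixes x :: "'k::alg_closed_field"
  assumes p: "prime CHAR('k)" and F: "is_subring F" "\<And>z. z \<in> F \<Longrightarrow> inverse z \<in> F"
    and P: "P \<noteq> 0" "coeffs_in F P" "poly P x = 0"
    and fixed: "\<And>\<Gamma>. max_graph \<Gamma> \<Longrightarrow> (\<And>z. z \<in> F \<Longrightarrow> (z, z) \<in> \<Gamma>) \<Longrightarrow> (x, x) \<in> \<Gamma>"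
  shows "\<exists>e. x ^ (CHAR('k) ^ e) \<in> F"
proof -
  define \<Gamma> where "\<Gamma> = {(z, z) |z. z \<in> F}"
  have G: "iso_graph \<Gamma>"
    unfolding iso_graph_def \<Gamma>_def using F(1)
    by (auto intro: is_subring_1 is_subring_diff is_subring_mult)
  have inv: "inverse_closed \<Gamma>" unfolding inverse_closed_def \<Gamma>_def using F(2) by auto
  have cp: "cpair \<Gamma> q q' \<longleftrightarrow> q' = q \<and> coeffs_in F q" for q q'
    by (auto simp: cpair_def \<Gamma>_def coeffs_in_def poly_eq_iff)
  obtain Q where Q: "Q \<noteq> 0" "coeffs_in F Q" "poly Q x = 0"
    "\<And>q. coeffs_in F q \<Longrightarrow> q \<noteq> 0 \<Longrightarrow> poly q x = 0 \<Longrightarrow> degree Q \<le> degree q"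
    by (rule minimal_poly_exists[OF P]) blast
  have only: "y = x" if y: "poly Q y = 0" for y
  proof -
    have "poly q x = 0 \<longleftrightarrow> poly q' y = 0" if q: "cpair \<Gamma> q q'" for q q'
      using cpair_minimal[OF G inv _ Q(1,3) y _ q] Q(2,4) cp by blast
    then have "iso_graph (adjoin_pair \<Gamma> x y)" by (rule iso_graph_adjoin_pair[OF G])
    then obtain \<Delta> where D: "max_graph \<Delta>" "adjoin_pair \<Gamma> x y \<subseteq> \<Delta>" using max_graph_exists by blast
    have "(x, y) \<in> \<Delta>" using in_adjoin_pair[OF G] D(2) by blast
    moreover have "(z, z) \<in> \<Delta>" if "z \<in> F" for z
      using adjoin_pair_superset[OF G] D(2) that unfolding \<Gamma>_def by blast
    then have "(x, x) \<in> \<Delta>" using fixed[OF D(1)] by blast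
    ultimately show "y = x" using iso_graph_eq_iff[OF max_graph_iso[OF D(1)]] by blast
  qed
  obtain A where A: "size A = degree Q" "Q = smult (lead_coeff Q) (\<Prod>r\<in>#A. [:- r, 1:])"
    using alg_closed_imp_factorization[OF Q(1)] by blast
  have "r = x" if "r \<in># A" for r
  proof (rule only)
    show "poly Q r = 0"
      using that by (subst A(2)) (simp add: poly_prod_linear prod_mset_zero_iff)
  qed
  then have "A = replicate_mset (size A) x" by (metis set_mset_subset_singletonD singletonI subsetI)
  then have "(\<Prod>r\<in>#A. [:- r, 1:]) = [:- x, 1:] ^ degree Q"
    unfolding A(1)[symmetric] by (metis image_replicate_mset prod_mset_replicate_mset)
  then have "coeffs_in F (smult (lead_coeff Q) ([:- x, 1:] ^ degree Q))" using A(2) Q(2) by simp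
  then show ?thesis
    using purely_inseparable[OF p F] Q(1) degree_pos_if_root[OF Q(1,3)] by (metis leading_coeff_0_iff)
qed

section \<open>Norms\<close>

definition rat_field :: "'k::field \<Rightarrow> 'k set" where
  "rat_field a = {poly u a / poly v a |u v. coeffs_in Fp_bar u \<and> coeffs_in Fp_bar v \<and> poly v a \<noteq> 0}"

lemma rat_fieldI:
  "coeffs_in Fp_bar u \<Longrightarrow> coeffs_in Fp_bar v \<Longrightarrow> poly v a \<noteq> 0 \<Longrightarrow> poly u a / poly v a \<in> rat_field a"
  unfolding rat_field_def by blast

lemma adjoin_subset_rat_field:
  assumes "prime CHAR('k::field)"
  shows "adjoin Fp_bar (a::'k) \<subseteq> rat_field a"
proof
  fix x assume "x \<in> adjoin Fp_bar a"
  then obtain q where "coeffs_in Fp_bar q" "x = poly q a" by (auto simp: adjoin_def)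
  then show "x \<in> rat_field a"
    using rat_fieldI[of q 1 a] coeffs_in_1[OF is_subring_Fp_bar[OF assms]] by simp
qed

lemma is_subring_rat_field:
  assumes p: "prime CHAR('k::field)"
  shows "is_subring (rat_field (a::'k))"
  unfolding is_subring_def
proof (intro conjI ballI)
  note R = is_subring_Fp_bar[OF p]
  show "1 \<in> rat_field a"
    using adjoin_subset_rat_field[OF p] is_subring_1[OF is_subring_adjoin[OF R]] by blast
  fix x y assume "x \<in> rat_field a" "y \<in> rat_field a"
  then obtain u v u' v' where c: "coeffs_in Fp_bar u" "coeffs_in Fp_bar v" "coeffs_in Fp_bar u'"
      "coeffs_in Fp_bar v'" and nz: "poly v a \<noteq> 0" "poly v' a \<noteq> 0"
    and xy: "x = poly u a / poly v a" "y = poly u' a / poly v' a"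
    unfolding rat_field_def by blast
  have "x - y = poly (u * v' - u' * v) a / poly (v * v') a"
    using nz by (simp add: xy field_simps)
  then show "x - y \<in> rat_field a"
    using rat_fieldI[of "u * v' - u' * v" "v * v'" a] c nz
    by (simp add: coeffs_in_diff coeffs_in_mult R)
  have "x * y = poly (u * u') a / poly (v * v') a"
    by (simp add: xy)
  then show "x * y \<in> rat_field a"
    using rat_fieldI[of "u * u'" "v * v'" a] c nz by (simp add: coeffs_in_mult R)
qed

lemma inverse_rat_field:
  assumes p: "prime CHAR('k::field)" and x: "(x::'k) \<in> rat_field a"
  shows "inverse x \<in> rat_field a"
proof (cases "x = 0")
  case False
  obtain u v where "coeffs_in Fp_bar u" "coeffs_in Fp_bar v" "poly v a \<noteq> 0" "x = poly u a / poly v a"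
    using x unfolding rat_field_def by blast
  with False show ?thesis using rat_fieldI[of v u a] by auto
qed (use x in simp)

lemma val_ring_Fp_bar:
  assumes p: "prime CHAR('k::field)" and "val_ring (V::'k set)"
  shows "Fp_bar \<subseteq> V"
proof
  interpret valuation V by unfold_locales (rule assms)
  fix x :: 'k assume "x \<in> Fp_bar"
  then show "x \<in> V"
    using Fp_bar_unit[OF p] is_subring_0[OF R] by (cases "x = 0") (auto simp: veq_def vle_one_iff)
qed

lemma (in valuation) poly_size:
  assumes p: "prime CHAR('k)" and a: "a \<notin> V" and u: "coeffs_in Fp_bar u" "u \<noteq> 0"
  shows "poly u a \<approx> a ^ degree u"
proof -
  have a1: "1 \<prec> a" using a by (simp add: vlt_def vle_one_iff)
  have c: "coeff u i \<preceq> 1" for i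
    using val_ring_Fp_bar[OF p V] u(1) by (auto simp: vle_one_iff coeffs_in_def)
  have lc: "lead_coeff u * a ^ degree u \<approx> a ^ degree u"
    using u by (intro veq_unit_mult Fp_bar_unit[OF p]) (auto simp: coeffs_in_def)
  have "(\<Sum>i<degree u. coeff u i * a ^ i) \<prec> a ^ degree u"
  proof (rule vlt_sum)
    show "a ^ degree u \<noteq> 0" using vlt_nonzero[OF a1] by simp
    fix i assume "i \<in> {..<degree u}"
    then have "a ^ i \<prec> a ^ degree u" using vlt_power_mono[OF a1] by simp
    moreover have "coeff u i * a ^ i \<preceq> a ^ i" using vle_mult[OF c vle_refl, of i "a ^ i"] by simp
    ultimately show "coeff u i * a ^ i \<prec> a ^ degree u" by (rule vle_vlt_trans[rotated])
  qed
  then have "(\<Sum>i<degree u. coeff u i * a ^ i) \<prec> lead_coeff u * a ^ degree u"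
    using veq_vlt(2)[OF lc] by blast
  then have "lead_coeff u * a ^ degree u + (\<Sum>i<degree u. coeff u i * a ^ i) \<approx> lead_coeff u * a ^ degree u"
    by (rule veq_add_vlt)
  moreover have "poly u a = lead_coeff u * a ^ degree u + (\<Sum>i<degree u. coeff u i * a ^ i)"
    unfolding poly_altdef lessThan_Suc_atMost[symmetric] by simp
  ultimately show ?thesis using veq_trans lc by simp
qed

text \<open>A rational function of \<open>a\<close> that is integral over \<open>Fp_bar[a]\<close> and vanishes at one place with
  \<open>|a| > 1\<close> has no pole at all, since all such places agree on \<open>Fp_bar(a)\<close>.\<close>

lemma (in valuation) integral_rational_small:
  assumes p: "prime CHAR('k)" and a: "a \<notin> V" and y: "y \<in> rat_field a"
    and int: "\<And>W. val_ring W \<Longrightarrow> a \<in> W \<Longrightarrow> y \<in> W" and small: "y \<prec> 1"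
  shows "y = 0"
proof (rule ccontr)
  assume y0: "y \<noteq> 0"
  obtain u v where uv: "coeffs_in Fp_bar u" "coeffs_in Fp_bar v" "poly v a \<noteq> 0" "y = poly u a / poly v a"
    using y unfolding rat_field_def by blast
  have nz: "u \<noteq> 0" "v \<noteq> 0" using uv y0 by auto
  have yv: "poly u a = y * poly v a" using uv by simp
  \<comment> \<open>Being small at the given place amounts to a condition on degrees, which
    transfers to every other place with \<open>|a| > 1\<close>.\<close>
  have deg: "degree u < degree v"
  proof (rule ccontr)
    assume "\<not> degree u < degree v"
    moreover have "1 \<preceq> a" using a vle_total[of 1 a] by (auto simp: vle_one_iff)
    ultimately have "a ^ degree v \<preceq> a ^ degree u" by (intro vle_power_mono) auto
    then have "poly v a \<preceq> poly u a"
      using poly_size[OF p a uv(1) nz(1)] poly_size[OF p a uv(2) nz(2)] veq_vle by blast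
    then have "1 * poly v a \<preceq> y * poly v a" by (simp add: yv)
    then have "1 \<preceq> y" by (rule vle_mult_cancel[OF uv(3), THEN iffD1])
    with small show False by (simp add: vlt_def)
  qed
  have "y \<in> W" if W: "val_ring W" for W
  proof (cases "a \<in> W")
    case True then show ?thesis using int W by blast
  next
    case aW: False
    interpret W: valuation W by unfold_locales (rule W)
    have "W.vle 1 a" using aW W.vle_total[of 1 a] by (auto simp: W.vle_one_iff)
    then have "W.vle (a ^ degree u) (a ^ degree v)" using deg by (intro W.vle_power_mono) auto
    then have "W.vle (poly u a) (poly v a)"
      using W.poly_size[OF p aW uv(1) nz(1)] W.poly_size[OF p aW uv(2) nz(2)] W.veq_vle by blast
    then have "W.vle (y * poly v a) (1 * poly v a)" by (simp add: yv)
    then have "W.vle y 1" by (rule W.vle_mult_cancel[OF uv(3), THEN iffD1])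
    then show ?thesis by (simp add: W.vle_one_iff)
  qed
  then have "y \<in> Fp_bar" by (rule in_all_val_rings_Fp_bar)
  then have "y \<approx> 1" using Fp_bar_unit[OF p] y0 by blast
  with small show False by (simp add: veq_def vlt_def)
qed

text \<open>The embeddings over \<open>Fp_bar(a)\<close> permute the factors, so they fix the
  product, and some power of it, with a power of the characteristic as exponent, lies in
  \<open>Fp_bar(a)\<close>. That power is integral over \<open>Fp_bar[a]\<close> and small at one
  place, hence \<open>0\<close>.\<close>

lemma norm_small:
  fixes a :: "'k::alg_closed_field"
  assumes p: "prime CHAR('k)" and V: "val_ring V" and a: "a \<notin> V" and B: "finite B"
    and perm: "\<And>\<Gamma>. max_graph \<Gamma> \<Longrightarrow> (\<And>z. z \<in> rat_field a \<Longrightarrow> (z, z) \<in> \<Gamma>) \<Longrightarrow>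
      \<exists>t. inj_on t B \<and> (\<forall>b\<in>B. t b \<in> B \<and> (g b, g (t b)) \<in> \<Gamma>)"
    and int: "\<And>W b. val_ring W \<Longrightarrow> a \<in> W \<Longrightarrow> b \<in> B \<Longrightarrow> g b \<in> W"
    and small: "valuation.vlt V (\<Prod>b\<in>B. g b) 1"
  shows "(\<Prod>b\<in>B. g b) = 0"
proof -
  interpret valuation V by unfold_locales (rule V)
  define x where "x = (\<Prod>b\<in>B. g b)"
  note A = is_subring_Fp_bar[OF p]
  have xint: "x \<in> W" if "val_ring W" "a \<in> W" for W
    unfolding x_def using int that by (intro is_subring_prod) (auto simp: val_ring_def)
  have "\<exists>P. P \<noteq> 0 \<and> coeffs_in (adjoin Fp_bar a) P \<and> poly P x = 0"
  proof (rule algebraic_if_in_all_val_rings[OF is_subring_adjoin[OF A]])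
    fix W assume "val_ring W" "adjoin Fp_bar a \<subseteq> W"
    then show "x \<in> W" using xint in_adjoin[OF A, of a] by blast
  qed
  then obtain P where P: "P \<noteq> 0" "coeffs_in (rat_field a) P" "poly P x = 0"
    using coeffs_in_mono[OF _ adjoin_subset_rat_field[OF p]] by blast
  have "\<exists>e. x ^ (CHAR('k) ^ e) \<in> rat_field a"
  proof (rule fixed_by_max_graphs[OF p is_subring_rat_field[OF p] inverse_rat_field[OF p] P])
    fix \<Gamma> :: "('k \<times> 'k) set"
    assume G: "max_graph \<Gamma>" "\<And>z. z \<in> rat_field a \<Longrightarrow> (z, z) \<in> \<Gamma>"
    obtain t where t: "inj_on t B" "\<And>b. b \<in> B \<Longrightarrow> t b \<in> B \<and> (g b, g (t b)) \<in> \<Gamma>"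
      using perm[OF G] by blast
    have "t ` B = B" using t B by (intro endo_inj_surj) auto
    then have "(\<Prod>b\<in>B. g (t b)) = x" unfolding x_def using prod.reindex[OF t(1), of g] by simp
    moreover have "(x, \<Prod>b\<in>B. g (t b)) \<in> \<Gamma>"
      unfolding x_def using t(2) by (intro iso_graph_prod max_graph_iso[OF G(1)]) auto
    ultimately show "(x, x) \<in> \<Gamma>" by simp
  qed
  then obtain e where e: "x ^ (CHAR('k) ^ e) \<in> rat_field a" by blast
  have "x ^ (CHAR('k) ^ e) = 0"
  proof (rule integral_rational_small[OF p a e])
    fix W assume "val_ring W" "a \<in> W"
    then show "x ^ (CHAR('k) ^ e) \<in> W"
      using xint by (intro is_subring_power) (auto simp: val_ring_def)
  next
    have "x \<prec> 1" using small by (simp add: x_def)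
    then show "x ^ (CHAR('k) ^ e) \<prec> 1"
      using vlt_power[of x 1 "CHAR('k) ^ e"] prime_gt_0_nat[OF p] by simp
  qed
  then show ?thesis by (simp add: x_def)
qed

section \<open>Conjugates and the parameter sets\<close>

lemma disc_translate: "disc ((\<lambda>x. c + x) ` S) = disc S"
proof -
  have "disc ((\<lambda>x. c + x) ` S) = (\<Prod>x\<in>S. \<Prod>y\<in>(\<lambda>x. c + x) ` S - {c + x}. c + x - y)"
    unfolding disc_def by (subst prod.reindex) (auto simp: inj_on_def)
  also have "\<dots> = disc S"
    unfolding disc_def
  proof (rule prod.cong[OF refl])
    fix x
    have "(\<lambda>x. c + x) ` S - {c + x} = (\<lambda>x. c + x) ` (S - {x})" by auto
    then show "(\<Prod>y\<in>(\<lambda>x. c + x) ` S - {c + x}. c + x - y) = (\<Prod>y\<in>S - {x}. x - y)"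
      by (simp add: prod.reindex inj_on_def)
  qed
  finally show ?thesis .
qed

lemma disc_iso_graph:
  assumes G: "iso_graph \<Gamma>" and t: "inj_on t S" "\<And>x. x \<in> S \<Longrightarrow> (x, t x) \<in> \<Gamma>"
  shows "(disc S, disc (t ` S)) \<in> \<Gamma>"
proof -
  have "disc (t ` S) = (\<Prod>x\<in>S. \<Prod>y\<in>t ` S - {t x}. t x - y)"
    unfolding disc_def by (subst prod.reindex[OF t(1)]) simp
  also have "\<dots> = (\<Prod>x\<in>S. \<Prod>y\<in>S - {x}. t x - t y)"
  proof (rule prod.cong[OF refl])
    fix x assume x: "x \<in> S"
    have inj: "inj_on t (S - {x})" using t(1) by (rule inj_on_subset) auto
    have "t ` S - {t x} = t ` (S - {x})" using t(1) x by (auto simp: inj_on_def)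
    then show "(\<Prod>y\<in>t ` S - {t x}. t x - y) = (\<Prod>y\<in>S - {x}. t x - t y)"
      by (simp add: prod.reindex[OF inj])
  qed
  also have "(disc S, \<dots>) \<in> \<Gamma>"
    unfolding disc_def using t(2) by (intro iso_graph_prod iso_graph_diff G) auto
  finally show ?thesis .
qed

lemma degree_add_dominant:
  assumes "degree A < degree B"
  shows "degree (A + B) = degree B" "lead_coeff (A + B) = lead_coeff B"
  using degree_add_eq_right[OF assms] lead_coeff_add_le[OF assms] by auto

section \<open>Iterates as polynomials in the parameter or in the starting point\<close>

context binomial_map
begin

text \<open>Starting point \<open>Q\<close> and parameter \<open>R\<close> are both polynomials, so
  that one recursion covers \<open>par\<close>, where the parameter varies, and \<open>var\<close>,
  where the starting point does.\<close>

fun itpoly :: "'k poly \<Rightarrow> 'k poly \<Rightarrow> nat \<Rightarrow> 'k poly" where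
  "itpoly Q R 0 = Q"
| "itpoly Q R (Suc n) = R + (smult c1 (itpoly Q R n ^ d1) + smult c2 (itpoly Q R n ^ d2))"

lemma poly_itpoly: "poly (itpoly Q R n) t = it (poly R t) n (poly Q t)"
  by (induction n) (simp_all add: f_def add.commute)

lemma c_nonzero: "c1 \<noteq> 0" "c2 \<noteq> 0" using c1 c2 by auto

lemma itpoly_step:
  assumes Q: "0 < degree (itpoly Q R n)" and R: "degree R \<le> 1"
  shows "degree (itpoly Q R (Suc n)) = d2 * degree (itpoly Q R n)"
    "lead_coeff (itpoly Q R (Suc n)) = c2 * lead_coeff (itpoly Q R n) ^ d2"
proof -
  define q where "q = itpoly Q R n"
  have q0: "q \<noteq> 0" "0 < degree q" using Q by (auto simp: q_def)
  have d: "2 \<le> d1" "d1 < d2" using exponents by auto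
  have dg: "degree (smult c1 (q ^ d1)) = d1 * degree q" "degree (smult c2 (q ^ d2)) = d2 * degree q"
    using c_nonzero q0 by (simp_all add: degree_power_eq mult.commute)
  have "d1 * degree q < d2 * degree q" using d q0 by simp
  then have 1: "degree (smult c1 (q ^ d1) + smult c2 (q ^ d2)) = d2 * degree q"
    "lead_coeff (smult c1 (q ^ d1) + smult c2 (q ^ d2)) = lead_coeff (smult c2 (q ^ d2))"
    using degree_add_dominant[of "smult c1 (q ^ d1)" "smult c2 (q ^ d2)"] unfolding dg by auto
  have "2 * 1 \<le> d2 * degree q" using d q0 by (intro mult_le_mono) auto
  then have "degree R < degree (smult c1 (q ^ d1) + smult c2 (q ^ d2))"
    using R unfolding 1 by simp
  from degree_add_dominant[OF this] 1
  show "degree (itpoly Q R (Suc n)) = d2 * degree (itpoly Q R n)"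
    "lead_coeff (itpoly Q R (Suc n)) = c2 * lead_coeff (itpoly Q R n) ^ d2"
    by (simp_all add: q_def[symmetric] lead_coeff_power)
qed

lemma d2_ge: "2 \<le> d2" using exponents by linarith

lemma degree_itpoly:
  assumes "degree (itpoly Q R m) = 1" "degree R \<le> 1"
  shows "degree (itpoly Q R (m + n)) = d2 ^ n"
proof (induction n)
  case (Suc n)
  then have "0 < degree (itpoly Q R (m + n))" using d2_ge by simp
  from itpoly_step(1)[OF this assms(2)] Suc show ?case by simp
qed (use assms in simp)

definition par :: "'k \<Rightarrow> nat \<Rightarrow> 'k poly" where "par x = itpoly [:x:] [:0, 1:]"
definition var :: "'k \<Rightarrow> nat \<Rightarrow> 'k poly" where "var l = itpoly [:0, 1:] [:l:]"

lemma poly_par: "poly (par x n) l = it l n x" by (simp add: par_def poly_itpoly)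
lemma poly_var: "poly (var l n) x = it l n x" by (simp add: var_def poly_itpoly)

lemma par_1: "par x (Suc 0) = [:f x, 1:]"
  by (simp add: par_def f_def poly_const_pow)

lemma degree_par: "degree (par x (Suc n)) = d2 ^ n"
  using degree_itpoly[of "[:x:]" "[:0, 1:]" "Suc 0" n] par_1[of x] by (simp add: par_def)

lemma degree_var: "degree (var l n) = d2 ^ n"
  using degree_itpoly[of "[:0, 1:]" "[:l:]" 0 n] by (simp add: var_def)

text \<open>Leading coefficients in \<open>Fp_bar - {0}\<close> are units at every place, as
  \<open>disc_bound_poly\<close> requires of \<open>G\<close>.\<close>

lemma lead_coeff_par: "lead_coeff (par x (Suc n)) \<in> Fp_bar - {0}"
proof (induction n)
  case 0
  then show ?case using is_subring_1[OF is_subring_Fp_bar[OF prime_char]] by (simp add: par_1)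
next
  case (Suc n)
  have "0 < degree (par x (Suc n))" using degree_par d2_ge by simp
  then have "lead_coeff (par x (Suc (Suc n))) = c2 * lead_coeff (par x (Suc n)) ^ d2"
    unfolding par_def by (intro itpoly_step(2)) simp_all
  then show ?case
    using Suc c2 is_subring_mult[OF is_subring_Fp_bar[OF prime_char]]
      is_subring_power[OF is_subring_Fp_bar[OF prime_char]] by simp
qed

lemma par_diff_nonzero: "i < j \<Longrightarrow> par x i - par x j \<noteq> 0"
proof
  assume ij: "i < j" and "par x i - par x j = 0"
  then have "degree (par x i) = degree (par x j)" by simp
  moreover obtain k where k: "j = Suc k" using ij by (cases j) auto
  moreover have "degree (par x i) < d2 ^ k"
  proof (cases i)
    case 0
    then show ?thesis using d2_ge by (simp add: par_def)
  next
    case (Suc m)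
    then show ?thesis using ij k d2_ge by (simp add: degree_par)
  qed
  ultimately show False by (simp add: degree_par)
qed

lemma var_diff_nonzero: "i < j \<Longrightarrow> var l i - var l j \<noteq> 0"
proof
  assume ij: "i < j" and "var l i - var l j = 0"
  then have "d2 ^ i = d2 ^ j" using degree_var by (metis eq_iff_diff_eq_0)
  with ij d2_ge show False by simp
qed

text \<open>The bound \<open>n\<close> makes the set of parameters for a given point, and of points
  for a given parameter, finite.\<close>

definition coll :: "nat \<Rightarrow> 'k \<Rightarrow> 'k \<Rightarrow> bool" where
  "coll n l x \<longleftrightarrow> (\<exists>i j. i < j \<and> j \<le> n \<and> it l i x = it l j x)"

lemma coll_preper: "coll n l x \<Longrightarrow> preper l x"
  unfolding coll_def preper_def by blast

lemma preper_coll: "preper l x \<Longrightarrow> \<exists>n. coll n l x"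
  unfolding coll_def preper_def by blast

lemma coll_mono: "coll n l x \<Longrightarrow> n \<le> m \<Longrightarrow> coll m l x"
  unfolding coll_def using order_trans by blast

lemma finite_coll_par: "finite {l. coll n l x}"
proof (rule finite_subset)
  show "{l. coll n l x} \<subseteq> (\<Union>j\<le>n. \<Union>i<j. {l. poly (par x i - par x j) l = 0})"
    by (auto simp: coll_def poly_par)
  show "finite (\<Union>j\<le>n. \<Union>i<j. {l. poly (par x i - par x j) l = 0})"
    by (intro finite_UN_I poly_roots_finite par_diff_nonzero) auto
qed

lemma finite_coll_var: "finite {x. coll n l x}"
proof (rule finite_subset)
  show "{x. coll n l x} \<subseteq> (\<Union>j\<le>n. \<Union>i<j. {x. poly (var l i - var l j) x = 0})"
    by (auto simp: coll_def poly_var)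
  show "finite (\<Union>j\<le>n. \<Union>i<j. {x. poly (var l i - var l j) x = 0})"
    by (intro finite_UN_I poly_roots_finite var_diff_nonzero) auto
qed

lemma coeffs_in_itpoly:
  assumes "is_subring A" "c1 \<in> A" "c2 \<in> A" "coeffs_in A Q" "coeffs_in A R"
  shows "coeffs_in A (itpoly Q R n)"
  by (induction n) (use assms in \<open>auto intro!: coeffs_in_add coeffs_in_smult coeffs_in_power\<close>)

end

section \<open>Embeddings over \<open>Fp_bar(a)\<close> and the conjugates of
  \<open>\<beta>\<close>\<close>

locale conjugates = binomial_map p l1 l2 s1 s2 c1 c2
  for p l1 l2 s1 s2 :: nat and c1 c2 :: "'k::alg_closed_field" +
  fixes a \<beta> :: 'k
begin

definition embedding :: "('k \<times> 'k) set \<Rightarrow> bool" where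
  "embedding \<Gamma> \<longleftrightarrow> max_graph \<Gamma> \<and> (\<forall>z\<in>rat_field a. (z, z) \<in> \<Gamma>)"

definition S :: "nat \<Rightarrow> 'k \<Rightarrow> 'k set" where
  "S n b = {l. coll n l a \<and> coll n l b}"

text \<open>The conjugates of \<open>\<beta>\<close> over \<open>Fp_bar(a)\<close>, obtained as a
  closure under images by embeddings.\<close>

inductive_set orbit :: "'k set" where
  base: "\<beta> \<in> orbit"
| step: "b \<in> orbit \<Longrightarrow> embedding \<Gamma> \<Longrightarrow> (b, b') \<in> \<Gamma> \<Longrightarrow> b' \<in> orbit"

lemma finite_S: "finite (S n b)"
  by (rule finite_subset[OF _ finite_coll_par[of n a]]) (auto simp: S_def)

lemma embedding_iso: "embedding \<Gamma> \<Longrightarrow> iso_graph \<Gamma>"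
  by (simp add: embedding_def max_graph_iso)

lemma embedding_fixes:
  assumes "embedding \<Gamma>" shows "(a, a) \<in> \<Gamma>" "(c1, c1) \<in> \<Gamma>" "(c2, c2) \<in> \<Gamma>"
proof -
  note R = is_subring_Fp_bar[OF prime_char]
  have sub: "(z, z) \<in> \<Gamma>" if "z \<in> adjoin Fp_bar a" for z
    using assms that adjoin_subset_rat_field[OF prime_char] unfolding embedding_def by blast
  show "(a, a) \<in> \<Gamma>" using sub in_adjoin[OF R] by blast
  show "(c1, c1) \<in> \<Gamma>" "(c2, c2) \<in> \<Gamma>" using sub adjoin_superset[OF R] c1 c2 by blast+
qed

lemma embedding_f:
  assumes G: "embedding \<Gamma>" and x: "(x, x') \<in> \<Gamma>" shows "(f x, f x') \<in> \<Gamma>"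
  unfolding f_def
  by (intro iso_graph_add iso_graph_mult iso_graph_power embedding_iso embedding_fixes G x)

lemma embedding_it:
  assumes G: "embedding \<Gamma>" and "(x, x') \<in> \<Gamma>" "(l, l') \<in> \<Gamma>"
  shows "(it l n x, it l' n x') \<in> \<Gamma>"
  by (induction n) (use assms in \<open>auto intro!: iso_graph_add embedding_iso embedding_f\<close>)

lemma embedding_coll:
  assumes G: "embedding \<Gamma>" and xl: "(x, x') \<in> \<Gamma>" "(l, l') \<in> \<Gamma>" and "coll n l x"
  shows "coll n l' x'"
proof -
  obtain i j where "i < j" "j \<le> n" "it l i x = it l j x" using assms(4) by (auto simp: coll_def)
  moreover have "it l i x = it l j x \<longleftrightarrow> it l' i x' = it l' j x'"
    by (intro iso_graph_eq_iff[OF embedding_iso[OF G]] embedding_it G xl)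
  ultimately show ?thesis unfolding coll_def by blast
qed

lemma parameter_in_Domain:
  assumes G: "embedding \<Gamma>" and l: "coll n l a" shows "l \<in> Domain \<Gamma>"
proof -
  obtain i j where ij: "i < j" "it l i a = it l j a" using l by (auto simp: coll_def)
  note R = is_subring_Domain[OF embedding_iso[OF G]]
  have D: "a \<in> Domain \<Gamma>" "c1 \<in> Domain \<Gamma>" "c2 \<in> Domain \<Gamma>" using embedding_fixes[OF G] by blast+
  have "coeffs_in (Domain \<Gamma>) (par a k)" for k
    unfolding par_def
    by (intro coeffs_in_itpoly R D) (simp_all add: coeffs_in_pCons coeffs_in_0 is_subring_0 is_subring_1 R D)
  then have "coeffs_in (Domain \<Gamma>) (par a i - par a j)" by (intro coeffs_in_diff R)
  moreover have "poly (par a i - par a j) l = 0" using ij by (simp add: poly_par)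
  ultimately show ?thesis
    using max_graph_algebraic[of \<Gamma> "par a i - par a j" l] G par_diff_nonzero[OF ij(1)]
    unfolding embedding_def by blast
qed

lemma point_in_Domain:
  assumes G: "embedding \<Gamma>" and l: "coll n l a" "coll n l b" shows "b \<in> Domain \<Gamma>"
proof -
  obtain i j where ij: "i < j" "it l i b = it l j b" using l by (auto simp: coll_def)
  note R = is_subring_Domain[OF embedding_iso[OF G]]
  have D: "l \<in> Domain \<Gamma>" "c1 \<in> Domain \<Gamma>" "c2 \<in> Domain \<Gamma>"
    using embedding_fixes[OF G] parameter_in_Domain[OF G l(1)] by blast+
  have "coeffs_in (Domain \<Gamma>) (var l k)" for k
    unfolding var_def
    by (intro coeffs_in_itpoly R D) (simp_all add: coeffs_in_pCons coeffs_in_0 is_subring_0 is_subring_1 R D)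
  then have "coeffs_in (Domain \<Gamma>) (var l i - var l j)" by (intro coeffs_in_diff R)
  moreover have "poly (var l i - var l j) b = 0" using ij by (simp add: poly_var)
  ultimately show ?thesis
    using max_graph_algebraic[of \<Gamma> "var l i - var l j" b] G var_diff_nonzero[OF ij(1)]
    unfolding embedding_def by blast
qed

text \<open>Meaningful only on \<open>Domain \<Gamma>\<close>, where the graph of an embedding has
  exactly one value.\<close>

definition app :: "('k \<times> 'k) set \<Rightarrow> 'k \<Rightarrow> 'k" where "app \<Gamma> x = (SOME y. (x, y) \<in> \<Gamma>)"

lemma app: "x \<in> Domain \<Gamma> \<Longrightarrow> (x, app \<Gamma> x) \<in> \<Gamma>"
  unfolding app_def by (auto intro: someI)

lemma app_inj:
  assumes "embedding \<Gamma>" "A \<subseteq> Domain \<Gamma>" shows "inj_on (app \<Gamma>) A"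
proof (rule inj_onI)
  fix x y assume xy: "x \<in> A" "y \<in> A" and eq: "app \<Gamma> x = app \<Gamma> y"
  from iso_graph_eq_iff[OF embedding_iso[OF assms(1)] app app, of x y] assms(2) xy eq
  show "x = y" by (simp add: subset_iff)
qed

lemma app_S:
  assumes G: "embedding \<Gamma>" and b: "(b, b') \<in> \<Gamma>" shows "app \<Gamma> ` S n b \<subseteq> S n b'"
proof clarify
  fix l assume l: "l \<in> S n b"
  then have "(l, app \<Gamma> l) \<in> \<Gamma>" unfolding S_def by (auto intro!: app parameter_in_Domain[OF G])
  then show "app \<Gamma> l \<in> S n b'"
    using l embedding_coll[OF G embedding_fixes(1)[OF G]] embedding_coll[OF G b] by (auto simp: S_def)
qed

lemma S_Domain: "embedding \<Gamma> \<Longrightarrow> S n b \<subseteq> Domain \<Gamma>"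
  unfolding S_def using parameter_in_Domain by blast

lemma card_S_le: "embedding \<Gamma> \<Longrightarrow> (b, b') \<in> \<Gamma> \<Longrightarrow> card (S n b) \<le> card (S n b')"
  using card_inj_on_le[OF app_inj[OF _ S_Domain] app_S finite_S] by simp

end

locale conjugates_nonempty = conjugates +
  fixes n0 :: nat
  assumes nonempty: "S n0 \<beta> \<noteq> {}"
begin

lemma orbit_nonempty: "b \<in> orbit \<Longrightarrow> S n0 b \<noteq> {}"
proof (induction rule: orbit.induct)
  case base
  show ?case by (rule nonempty)
next
  case (step b \<Gamma> b')
  then show ?case using app_S[of \<Gamma> b b' n0] by blast
qed

text \<open>Each conjugate shares some parameter of level \<open>n0\<close> with \<open>a\<close>;
  there are finitely many such parameters, each with finitely many colliding points.\<close>

lemma finite_orbit: "finite orbit"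
proof (rule finite_subset)
  show "orbit \<subseteq> (\<Union>l\<in>{l. coll n0 l a}. {b. coll n0 l b})"
    using orbit_nonempty unfolding S_def by blast
  show "finite (\<Union>l\<in>{l. coll n0 l a}. {b. coll n0 l b})"
    by (intro finite_UN_I finite_coll_par finite_coll_var)
qed

lemma orbit_Domain:
  assumes "embedding \<Gamma>" shows "orbit \<subseteq> Domain \<Gamma>"
proof
  fix b assume "b \<in> orbit"
  then obtain l where "l \<in> S n0 b" using orbit_nonempty by blast
  then show "b \<in> Domain \<Gamma>" unfolding S_def by (auto intro: point_in_Domain[OF assms])
qed

lemma app_orbit:
  assumes "embedding \<Gamma>"
  shows "inj_on (app \<Gamma>) orbit" "b \<in> orbit \<Longrightarrow> (b, app \<Gamma> b) \<in> \<Gamma>" "b \<in> orbit \<Longrightarrow> app \<Gamma> b \<in> orbit"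
proof -
  show "inj_on (app \<Gamma>) orbit" by (rule app_inj[OF assms orbit_Domain[OF assms]])
  assume b: "b \<in> orbit"
  then show "(b, app \<Gamma> b) \<in> \<Gamma>" using orbit_Domain[OF assms] by (intro app) auto
  then show "app \<Gamma> b \<in> orbit" by (rule orbit.step[OF b assms])
qed

text \<open>Embeddings do not decrease these cardinalities and permute the finite orbit, so the sum
  over the orbit is unchanged and no term can grow.\<close>

lemma card_S_app:
  assumes G: "embedding \<Gamma>" and b: "b \<in> orbit"
  shows "card (S n (app \<Gamma> b)) = card (S n b)"
proof -
  have "app \<Gamma> ` orbit = orbit"
    using app_orbit[OF G] finite_orbit by (intro endo_inj_surj) auto
  then have "(\<Sum>b\<in>orbit. card (S n (app \<Gamma> b))) = (\<Sum>b\<in>orbit. card (S n b))"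
    using sum.reindex[OF app_orbit(1)[OF G], of "\<lambda>b. card (S n b)"] by simp
  moreover have "card (S n b) \<le> card (S n (app \<Gamma> b))" if "b \<in> orbit" for b
    using card_S_le[OF G app_orbit(2)[OF G that]] .
  ultimately show ?thesis
    using sum_mono_inv[of "\<lambda>b. card (S n b)" orbit "\<lambda>b. card (S n (app \<Gamma> b))" b] finite_orbit b
    by simp
qed

lemma image_S_app:
  assumes G: "embedding \<Gamma>" and b: "b \<in> orbit"
  shows "app \<Gamma> ` S n b = S n (app \<Gamma> b)"
proof (rule card_subset_eq[OF finite_S app_S[OF G app_orbit(2)[OF G b]]])
  show "card (app \<Gamma> ` S n b) = card (S n (app \<Gamma> b))"
    using card_S_app[OF G b] card_image[OF app_inj[OF G S_Domain[OF G]]] by simp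
qed

lemma card_S_orbit: "b \<in> orbit \<Longrightarrow> card (S n b) = card (S n \<beta>)"
proof (induction rule: orbit.induct)
  case (step b \<Gamma> b')
  have "b' = app \<Gamma> b"
    using iso_graph_eq_iff[OF embedding_iso[OF step(2)] step(3) app_orbit(2)[OF step(2,1)]] by simp
  then show ?case using card_S_app[OF step(2,1)] step.IH by simp
qed simp

lemma disc_S_app:
  assumes G: "embedding \<Gamma>" and b: "b \<in> orbit"
  shows "(disc (S n b), disc (S n (app \<Gamma> b))) \<in> \<Gamma>"
  unfolding image_S_app[OF G b, symmetric]
proof (rule disc_iso_graph[OF embedding_iso[OF G] app_inj[OF G S_Domain[OF G]]])
  fix x assume "x \<in> S n b"
  then show "(x, app \<Gamma> x) \<in> \<Gamma>" by (intro app subsetD[OF S_Domain[OF G]])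
qed

end

lemma infinite_Un_chain_card:
  assumes "infinite (\<Union>n::nat. A n)" "\<And>n m. n \<le> m \<Longrightarrow> A n \<subseteq> A m" "\<And>n. finite (A n)"
  shows "\<exists>n. K < card (A n)"
proof -
  obtain T where T: "finite T" "card T = Suc K" "T \<subseteq> (\<Union>n. A n)"
    using infinite_arbitrarily_large[OF assms(1)] by metis
  have "\<exists>g. \<forall>x\<in>T. x \<in> A (g x)" using T(3) by (intro bchoice) blast
  then obtain g where g: "\<And>x. x \<in> T \<Longrightarrow> x \<in> A (g x)" by blast
  have "T \<subseteq> A (Max (g ` T))"
    using g assms(2)[OF Max_ge[of "g ` T"]] T(1) by blast
  then have "Suc K \<le> card (A (Max (g ` T)))" using card_mono[OF assms(3)] T(2) by metis
  then show ?thesis by (intro exI[of _ "Max (g ` T)"]) simp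
qed

section \<open>Estimates at the place \<open>V\<close> combined with norms over the orbit\<close>

locale conjugates_place = binomial_place p l1 l2 s1 s2 c1 c2 V a +
  conjugates_nonempty p l1 l2 s1 s2 c1 c2 a \<beta> n0
  for p l1 l2 s1 s2 :: nat and c1 c2 :: "'k::alg_closed_field" and V :: "'k set" and a \<beta> :: 'k
    and n0 :: nat
begin

text \<open>With \<open>|a| \<le> 1\<close>, a parameter of size above \<open>1\<close> would
  dominate \<open>f a\<close> and make \<open>f a + l\<close> escape.\<close>

lemma parameter_integral:
  assumes W: "val_ring W" "a \<in> W" and l: "preper l a" shows "l \<in> W"
proof (rule ccontr)
  interpret W: binomial_valuation p l1 l2 s1 s2 c1 c2 W by unfold_locales (rule W)
  assume "l \<notin> W"
  then have l1: "W.vlt 1 l" by (simp add: W.vlt_def W.vle_one_iff)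
  have "W.vle (f a) 1" using W.f_small W(2) by (simp add: W.vle_one_iff)
  then have "W.vlt (f a) l" using l1 by (rule W.vle_vlt_trans)
  then have eq: "W.veq (f a + l) l" using W.veq_add_vlt[of "f a" l] by (simp add: add.commute)
  have "W.vlt l (l ^ d2)" using W.vlt_power_mono[OF l1 d2_gt] by simp
  then have "W.vlt l ((f a + l) ^ d2)" using W.veq_power[OF eq, of d2] W.veq_vlt by blast
  moreover have "W.vlt 1 (f a + l)" using l1 W.veq_vlt(2)[OF eq] by blast
  ultimately show False using W.escape preper_step[OF l] by blast
qed

lemma point_integral:
  assumes W: "val_ring W" "a \<in> W" and l: "preper l a" "preper l b" shows "b \<in> W"
proof (rule ccontr)
  interpret W: binomial_valuation p l1 l2 s1 s2 c1 c2 W by unfold_locales (rule W)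
  assume "b \<notin> W"
  then have b1: "W.vlt 1 b" by (simp add: W.vlt_def W.vle_one_iff)
  have "W.vle l 1" using parameter_integral[OF W l(1)] by (simp add: W.vle_one_iff)
  moreover have "W.vlt 1 (b ^ d2)" using W.vlt_power_mono[OF b1, of 0 d2] d2_gt by simp
  ultimately have "W.vlt l (b ^ d2)" by (rule W.vle_vlt_trans)
  then show False using W.escape[OF b1] l(2) by blast
qed

text \<open>Suppose every \<open>z * a\<close> is approached by some \<open>f a + l\<close>. Then
  \<open>f b + l\<close> is near some \<open>z' * a\<close>, so \<open>f b - f a\<close> satisfies
  the hypothesis of \<open>translation_small\<close>, against \<open>far\<close>.\<close>

lemma missed_root:
  assumes far: "\<not> f b - f a \<prec> a"
  shows "\<exists>z\<in>Z. \<forall>l. preper l a \<longrightarrow> preper l b \<longrightarrow> \<not> f a + l - z * a \<prec> a"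
proof (rule ccontr)
  assume neg: "\<not> ?thesis"
  have "f b - f a \<prec> a"
  proof (rule translation_small)
    fix z assume "z \<in> Z"
    then obtain l where l: "preper l a" "preper l b" "f a + l - z * a \<prec> a" using neg by blast
    have y: "preper l (f b + l)" using preper_step[OF l(2)] .
    have "(f b + l) ^ s2 - a ^ s2 \<prec> a ^ s2"
      using same_power_cluster[OF vle_refl preper_bound[OF l(1) y] preper_diff[OF l(1,1) y]] .
    then obtain z' where z': "z' \<in> Z" "f b + l - z' * a \<prec> a" using near_some_root by blast
    have "(f b + l - z' * a) - (f a + l - z * a) \<prec> a" by (rule vlt_diff[OF z'(2) l(3)])
    then have "f b - f a - (z' - z) * a \<prec> a" by (simp add: algebra_simps)
    with z'(1) show "\<exists>z'\<in>Z. f b - f a - (z' - z) * a \<prec> a" by blast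
  qed
  with far show False ..
qed

lemma first_iterate:
  assumes "l \<in> S n b"
  shows "preper l a" "preper l b" "f a + l \<preceq> a" "f (f a + l) - f a \<preceq> a"
proof -
  show l: "preper l a" "preper l b" using assms coll_preper by (auto simp: S_def)
  show "f a + l \<preceq> a" using preper_bound[OF l(1) preper_step[OF l(1)]] .
  show "f (f a + l) - f a \<preceq> a" using preper_diff[OF l(1,1) preper_step[OF l(1)]] .
qed

text \<open>The set is translated by \<open>f a\<close> first: the parameters have size
  \<open>|a| ^ d2\<close>, but the points \<open>f a + l\<close> are at most
  \<open>|a|\<close>.\<close>

lemma disc_S_bound_poly:
  assumes "degree G = g" "0 < g" "lead_coeff G \<approx> 1" "\<And>l. l \<in> S n b \<Longrightarrow> poly G (f a + l) \<preceq> a powi e"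
  shows "disc (S n b) \<preceq> a powi (2 * (\<Sum>j<card (S n b). e * int (j div g) + int (j mod g)))"
proof -
  let ?T = "(\<lambda>l. f a + l) ` S n b"
  have "disc ?T \<preceq> a powi (2 * (\<Sum>j<card ?T. e * int (j div g) + int (j mod g)))"
    by (rule disc_bound_poly[where G = G]) (use assms finite_S first_iterate(3) a0 in auto)
  moreover have "card ?T = card (S n b)" by (intro card_image) (simp add: inj_on_def)
  ultimately show ?thesis by (simp add: disc_translate)
qed

text \<open>\<open>G\<close> is an iterate of \<open>a\<close> as a polynomial in the parameter,
  rewritten in \<open>f a + l\<close>. Its values are preperiodic points, hence at most
  \<open>|a|\<close>, while its degree \<open>d2 ^ m\<close> can be made large.\<close>

lemma disc_S_bound:
  "disc (S n b) \<preceq> a powi (2 * (\<Sum>j<card (S n b). 1 * int (j div d2 ^ m) + int (j mod d2 ^ m)))"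
proof (rule disc_S_bound_poly)
  let ?G = "pcompose (par a (Suc m)) [:- f a, 1:]"
  show "degree ?G = d2 ^ m" by (simp add: degree_pcompose degree_par)
  have "lead_coeff ?G = lead_coeff (par a (Suc m))" by (subst lead_coeff_comp) simp_all
  then show "lead_coeff ?G \<approx> 1" using Fp_bar_unit[OF prime_char] lead_coeff_par by simp
  fix l assume l: "l \<in> S n b"
  have "preper l (it l k a)" for k
    by (induction k) (use first_iterate(1)[OF l] preper_step in auto)
  then have "it l (Suc m) a \<preceq> a" using preper_bound[OF first_iterate(1)[OF l]] by blast
  then show "poly ?G (f a + l) \<preceq> a powi 1"
    unfolding poly_pcompose by (simp add: poly_par)
qed (use d2_ge in simp)

text \<open>The root of unity from \<open>missed_root\<close> yields through
  \<open>avoiding_poly\<close> a \<open>G\<close> with values at most \<open>1 / |a|\<close>, hence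
  a quadratic gain.\<close>

lemma disc_S_bound_missed:
  assumes "\<not> f b - f a \<prec> a"
  shows "disc (S n b) \<preceq> a powi (2 * (\<Sum>j<card (S n b). (-1) * int (j div (d2 - 2)) + int (j mod (d2 - 2))))"
proof -
  obtain z where z: "z \<in> Z" "\<And>l. preper l a \<Longrightarrow> preper l b \<Longrightarrow> \<not> f a + l - z * a \<prec> a"
    using missed_root[OF assms] by blast
  obtain G where G: "degree G = d2 - 2" "lead_coeff G \<approx> 1"
    "\<And>x. x \<preceq> a \<Longrightarrow> \<not> x - z * a \<prec> a \<Longrightarrow> f x - f a \<preceq> a \<Longrightarrow> poly G x \<preceq> a powi (-1)"
    using avoiding_poly[OF z(1)] by blast
  show ?thesis
  proof (rule disc_S_bound_poly[OF G(1) _ G(2)])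
    show "0 < d2 - 2" using exponents by linarith
    fix l assume l: "l \<in> S n b"
    show "poly G (f a + l) \<preceq> a powi (-1)"
      using G(3) z(2) first_iterate[OF l] by blast
  qed
qed

lemma powi_neg_small: "e < 0 \<Longrightarrow> a powi e \<prec> 1"
proof -
  assume "e < 0"
  then obtain k where k: "e = - int (Suc k)" by (metis negD)
  have "1 \<prec> a ^ Suc k" using vlt_power_mono[OF a_gt, of 0 "Suc k"] by simp
  moreover have "a powi e * a ^ Suc k = 1"
    unfolding k power_int_minus power_int_of_nat by (rule left_inverse) (use a0 in simp)
  ultimately have "a powi e * a ^ Suc k \<prec> 1 * a ^ Suc k" by simp
  then show ?thesis using vlt_mult_cancel[of "a ^ Suc k" "a powi e" 1] a0 by simp
qed

text \<open>With \<open>r\<close> conjugates, the quadratic gain \<open>M\<^sup>2 / g0\<close> at one of them beats the losses \<open>M\<^sup>2 / g\<close>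
  at the others as soon as \<open>g > g0 r\<close>.\<close>

lemma exponent_negative:
  fixes E E0 M g g0 r :: int
  assumes E: "2 * g * E \<le> M * M + 2 * g * g * M"
    and E0: "2 * g0 * E0 \<le> - (M * M) + (1 + 2 * g0 + 2 * g0 * g0) * M"
    and g: "0 < g0" "g0 * r < g" "0 \<le> r"
    and M: "g * (1 + 2 * g0 + 2 * g0 * g0) + g0 * r * (2 * g * g) < M" "0 < M"
  shows "E0 + r * E < 0"
proof (rule ccontr)
  assume "\<not> E0 + r * E < 0"
  have g0: "0 < g" using g mult_nonneg_nonneg[of g0 r] by linarith
  have "0 \<le> 2 * g0 * g * (E0 + r * E)" using \<open>\<not> _\<close> g(1) g0 by (intro mult_nonneg_nonneg) auto
  also have "\<dots> = g * (2 * g0 * E0) + g0 * r * (2 * g * E)" by (simp add: algebra_simps)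
  also have "\<dots> \<le> g * (- (M * M) + (1 + 2 * g0 + 2 * g0 * g0) * M) + g0 * r * (M * M + 2 * g * g * M)"
    using g g0 by (intro add_mono mult_left_mono E E0) auto
  also have "\<dots> = (g0 * r - g) * (M * M) + (g * (1 + 2 * g0 + 2 * g0 * g0) + g0 * r * (2 * g * g)) * M"
    by (simp add: algebra_simps)
  also have "\<dots> < (-1) * (M * M) + M * M"
    using g(2) M by (intro add_le_less_mono mult_right_mono mult_strict_right_mono) auto
  finally show False by simp
qed

text \<open>If the bound failed at \<open>b\<close>, the gain there would outweigh the losses at the
  other conjugates; the norm of the discriminant would be smaller than \<open>1\<close>, hence
  \<open>0\<close>, although discriminants of finite sets are nonzero.\<close>

lemma difference_small:
  assumes inf: "\<And>K. \<exists>n. K < card (S n \<beta>)" and b: "b \<in> orbit"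
  shows "f b - f a \<prec> a"
proof (rule ccontr)
  assume far: "\<not> f b - f a \<prec> a"
  define g0 where "g0 = d2 - 2"
  define r where "r = card orbit"
  \<comment> \<open>From \<open>m < 2 ^ m \<le> d2 ^ m\<close> it follows that \<open>g\<close>
    exceeds \<open>g0 * r\<close>, as \<open>exponent_negative\<close> asks.\<close>
  define m where "m = g0 * r"
  define g where "g = d2 ^ m"
  have g0: "0 < g0" using exponents unfolding g0_def by linarith
  have "m < 2 ^ m" by (rule less_exp)
  also have "2 ^ m \<le> g" unfolding g_def using d2_ge by (intro power_mono) auto
  finally have gg: "g0 * r < g" by (simp add: m_def)
  then have gpos: "0 < g" by simp
  obtain n where n: "g * (1 + 2 * g0 + 2 * g0 * g0) + g0 * r * (2 * g * g) < card (S n \<beta>)"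
    using inf by blast
  define M where "M = card (S n \<beta>)"
  define E where "E = (\<Sum>j<M. 1 * int (j div g) + int (j mod g))"
  define E0 where "E0 = (\<Sum>j<M. (-1) * int (j div g0) + int (j mod g0))"
  have Eg: "2 * int g * E \<le> int M * int M + 2 * int g * int g * int M"
    unfolding E_def by (rule sum_exponents_pos[OF gpos])
  have E0g: "2 * int g0 * E0 \<le> - (int M * int M) + (1 + 2 * int g0 + 2 * int g0 * int g0) * int M"
    unfolding E0_def by (rule sum_exponents_neg[OF g0])
  have rr: "int (card (orbit - {b})) = int r - 1"
    using b finite_orbit card_gt_0_iff[of orbit] by (auto simp: r_def of_nat_diff)
  have neg: "E0 + (int r - 1) * E < 0"
  proof (rule exponent_negative[OF Eg E0g])
    have r1: "1 \<le> r" using b finite_orbit card_gt_0_iff[of orbit] by (auto simp: r_def)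
    show "0 < int g0" using g0 by simp
    have le: "int g0 * (int r - 1) \<le> int g0 * int r" by (intro mult_left_mono) auto
    show "int g0 * (int r - 1) < int g"
      using gg le by (metis le_less_trans of_nat_less_iff of_nat_mult)
    show "0 \<le> int r - 1" using r1 by simp
    have "int g * (1 + 2 * int g0 + 2 * int g0 * int g0) + int g0 * (int r - 1) * (2 * int g * int g)
        \<le> int g * (1 + 2 * int g0 + 2 * int g0 * int g0) + int g0 * int r * (2 * int g * int g)"
      using le by (intro add_left_mono mult_right_mono) auto
    also have "\<dots> = int (g * (1 + 2 * g0 + 2 * g0 * g0) + g0 * r * (2 * g * g))"
      by (simp add: algebra_simps)
    also have "\<dots> < int M" using n unfolding M_def by (simp only: of_nat_less_iff)
    finally show "int g * (1 + 2 * int g0 + 2 * int g0 * int g0) +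
        int g0 * (int r - 1) * (2 * int g * int g) < int M" .
    show "0 < int M" using n by (simp add: M_def)
  qed
  have "(\<Prod>c\<in>orbit. disc (S n c)) = disc (S n b) * (\<Prod>c\<in>orbit - {b}. disc (S n c))"
    using b finite_orbit by (simp add: prod.remove)
  also have "\<dots> \<preceq> a powi (2 * E0) * (\<Prod>c\<in>orbit - {b}. a powi (2 * E))"
  proof (intro vle_mult vle_prod)
    show "disc (S n b) \<preceq> a powi (2 * E0)"
      using disc_S_bound_missed[OF far, of n] card_S_orbit[OF b, of n] by (simp add: E0_def M_def g0_def)
    fix c assume "c \<in> orbit - {b}"
    then show "disc (S n c) \<preceq> a powi (2 * E)"
      using disc_S_bound[of n c m] card_S_orbit[of c n] by (simp add: E_def M_def g_def)
  qed
  also have "a powi (2 * E0) * (\<Prod>c\<in>orbit - {b}. a powi (2 * E)) = a powi (2 * (E0 + (int r - 1) * E))"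
    using a0 by (simp add: power_int_add power_int_mult[symmetric] rr[symmetric] algebra_simps
        flip: power_int_of_nat)
  also have "\<dots> \<prec> 1" using neg by (intro powi_neg_small) simp
  finally have small: "(\<Prod>c\<in>orbit. disc (S n c)) \<prec> 1" .
  have "(\<Prod>c\<in>orbit. disc (S n c)) = 0"
  proof (rule norm_small[OF prime_char V a finite_orbit _ _ small])
    fix \<Gamma> :: "('k \<times> 'k) set" assume "max_graph \<Gamma>" "\<And>z. z \<in> rat_field a \<Longrightarrow> (z, z) \<in> \<Gamma>"
    then have G: "embedding \<Gamma>" by (simp add: embedding_def)
    show "\<exists>t. inj_on t orbit \<and> (\<forall>c\<in>orbit. t c \<in> orbit \<and> (disc (S n c), disc (S n (t c))) \<in> \<Gamma>)"
      using app_orbit[OF G] disc_S_app[OF G] by blast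
  next
    fix W c assume W: "val_ring W" "a \<in> W" and "c \<in> orbit"
    have "l \<in> W" if "l \<in> S n c" for l using parameter_integral[OF W first_iterate(1)[OF that]] .
    then show "disc (S n c) \<in> W"
      unfolding disc_def using W(1) by (intro is_subring_prod is_subring_diff) (auto simp: val_ring_def)
  qed
  then show False using finite_orbit disc_nonzero[OF finite_S] by (simp add: prod_zero_iff)
qed

lemma h_embedding:
  assumes G: "embedding \<Gamma>" and b: "(b, b') \<in> \<Gamma>"
  shows "(h (f b - f a), h (f b' - f a)) \<in> \<Gamma>"
proof -
  note iso = embedding_iso[OF G]
  have "(of_nat k, of_nat k) \<in> \<Gamma>" for k
    by (induction k) (auto intro: iso_graph_0 iso_graph_1 iso_graph_add iso)
  then show ?thesis
    unfolding h_def
    by (intro iso_graph_add iso_graph_mult iso_graph_power iso_graph_diff iso embedding_f[OF G]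
        embedding_fixes[OF G] b) auto
qed

text \<open>At each conjugate \<open>b\<close> a parameter of level \<open>n0\<close> provides the
  preperiodic points \<open>f a + l\<close> and \<open>f b + l\<close>, with difference
  \<open>f b - f a\<close>; by \<open>close_difference\<close> its image under \<open>h\<close> is
  small, so the norm vanishes.\<close>

theorem h_vanishes:
  assumes inf: "\<And>K. \<exists>n. K < card (S n \<beta>)"
  shows "h (f \<beta> - f a) = 0"
proof -
  let ?g = "\<lambda>b. h (f b - f a)"
  have hs: "?g b \<prec> 1" if b: "b \<in> orbit" for b
  proof -
    obtain l where l: "l \<in> S n0 b" using orbit_nonempty[OF b] by blast
    note pl = first_iterate(1,2)[OF l]
    note st = preper_step[OF pl(1)] preper_step[OF pl(2)]
    have eq: "(f b + l) - (f a + l) = f b - f a" by simp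
    show ?thesis
      using close_difference(2)[OF preper_size[OF pl(1) st(1)] _ preper_diff[OF pl(1) st], unfolded eq]
        difference_small[OF inf b] by blast
  qed
  have bo: "\<beta> \<in> orbit" by (rule orbit.base)
  have "(\<Prod>b\<in>orbit - {\<beta>}. ?g b) \<preceq> (\<Prod>b\<in>orbit - {\<beta>}. 1)"
    using hs vlt_imp_vle by (intro vle_prod) blast
  then have "?g \<beta> * (\<Prod>b\<in>orbit - {\<beta>}. ?g b) \<prec> 1 * 1"
    using hs[OF bo] by (intro vlt_mult) auto
  then have small: "(\<Prod>b\<in>orbit. ?g b) \<prec> 1"
    using prod.remove[OF finite_orbit bo, of ?g] by simp
  have "(\<Prod>b\<in>orbit. ?g b) = 0"
  proof (rule norm_small[OF prime_char V a finite_orbit _ _ small])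
    fix \<Gamma> :: "('k \<times> 'k) set" assume "max_graph \<Gamma>" "\<And>z. z \<in> rat_field a \<Longrightarrow> (z, z) \<in> \<Gamma>"
    then have G: "embedding \<Gamma>" by (simp add: embedding_def)
    show "\<exists>t. inj_on t orbit \<and> (\<forall>c\<in>orbit. t c \<in> orbit \<and> (?g c, ?g (t c)) \<in> \<Gamma>)"
      using app_orbit[OF G] h_embedding[OF G] by blast
  next
    fix W c assume W: "val_ring W" "a \<in> W" and c: "c \<in> orbit"
    have R: "is_subring W" using W(1) by (simp add: val_ring_def)
    obtain l where l: "l \<in> S n0 c" using orbit_nonempty[OF c] by blast
    have cW: "c \<in> W" using point_integral[OF W first_iterate(1,2)[OF l]] .
    have cc: "c1 \<in> W" "c2 \<in> W" using val_ring_Fp_bar[OF prime_char W(1)] c1 c2 by auto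
    show "?g c \<in> W"
      unfolding h_def f_def
      by (intro is_subring_add is_subring_mult is_subring_power is_subring_diff is_subring_of_nat R cW W cc)
  qed
  then obtain b where b: "b \<in> orbit" "?g b = 0" using finite_orbit by (auto simp: prod_zero_iff)
  \<comment> \<open>Vanishing is pulled back from \<open>b\<close> to \<open>\<beta>\<close> along
    the chain of embeddings that generates the orbit.\<close>
  from b show ?thesis
  proof (induction rule: orbit.induct)
    case (step b \<Gamma> b')
    then show ?case
      using iso_graph_zero_iff[OF embedding_iso[OF step(2)] h_embedding[OF step(2,3)]] by simp
  qed
qed

end

lemma (in binomial_map) h_zero_imp:
  assumes "h u = 0" "u \<noteq> 0"
  shows "u ^ (P2 - P1) = - ((c1 * of_nat s1) / (c2 * of_nat s2))"
proof -
  have "of_nat s2 \<noteq> (0 :: 'k)" using s2 char of_nat_eq_0_iff_char_dvd by metis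
  then have c: "c2 * of_nat s2 \<noteq> 0" using c2 by simp
  have "u ^ P2 = u ^ (P2 - P1) * u ^ P1" using exponents(3) by (simp add: power_add[symmetric])
  then have "(c2 * of_nat s2 * u ^ (P2 - P1) + c1 * of_nat s1) * u ^ P1 = 0"
    using assms(1) by (simp add: h_def algebra_simps)
  then have "c2 * of_nat s2 * u ^ (P2 - P1) + c1 * of_nat s1 = 0" using assms(2) by simp
  then have "u ^ (P2 - P1) * (c2 * of_nat s2) = - (c1 * of_nat s1)"
    by (simp add: eq_neg_iff_add_eq_0 mult_ac)
  then show ?thesis using c by (simp add: field_simps)
qed

lemma (in binomial_map) ratio_Fp_bar: "- ((c1 * of_nat s1) / (c2 * of_nat s2)) \<in> Fp_bar - {0}"
proof -
  note R = is_subring_Fp_bar[OF prime_char]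
  have "(of_nat s1 :: 'k) \<noteq> 0" "(of_nat s2 :: 'k) \<noteq> 0"
    using s1 s2 char of_nat_eq_0_iff_char_dvd by metis+
  moreover have "- (c1 * of_nat s1 * inverse (c2 * of_nat s2)) \<in> Fp_bar"
    using c1 c2
    by (intro is_subring_minus is_subring_mult is_subring_of_nat inverse_Fp_bar prime_char R) auto
  ultimately show ?thesis using c1 c2 by (simp add: divide_inverse)
qed

text \<open>At a place with \<open>|y| > 1\<close> the point \<open>x\<close> has the same size as
  \<open>y\<close>, whereas elements of \<open>Fp_bar\<close> have size at most
  \<open>1\<close>.\<close>

lemma (in binomial_map) preper_not_Fp_bar:
  assumes l: "preper l x" "preper l y" and y: "y \<notin> Fp_bar"
  shows "x \<notin> Fp_bar"
proof
  assume x: "x \<in> Fp_bar"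
  obtain W where W: "val_ring W" "y \<notin> W" using in_all_val_rings_Fp_bar y by blast
  interpret W: binomial_place p l1 l2 s1 s2 c1 c2 W y by unfold_locales (use W in auto)
  have "W.veq x y" using W.preper_size[OF l(2,1)] .
  moreover have "W.vle x 1" using val_ring_Fp_bar[OF prime_char W(1)] x by (auto simp: W.vle_one_iff)
  ultimately have "W.vle y 1" using W.veq_vle(1) by blast
  with W(2) show False by (simp add: W.vle_one_iff)
qed

theorem theorem1p5:
  fixes p d1 d2 l1 l2 s1 s2 :: nat
    and L :: "'k::alg_closed_field set"
    and c1 c2 \<alpha> \<beta> :: 'k
    and f :: "'k poly"
  assumes "prime p"
    and "CHAR('k) = p"
    and "alg_closure_of L"
    and "c1 \<in> Fp_bar - {0}" and "c2 \<in> Fp_bar - {0}"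
    and "1 \<le> d1" and "d1 < d2"
    and "f = monom c1 d1 + monom c2 d2"
    and "d1 = p ^ l1 * s1" and "\<not> p dvd s1"
    and "d2 = p ^ l2 * s2" and "\<not> p dvd s2"
    and "s1 > 1" and "s2 > 1"
    and "p ^ l2 * (s2 - 1) = p ^ l1 * (s1 - 1)"
    and "\<alpha> \<in> L" and "\<beta> \<in> L"
    and "infinite (Prep f \<alpha> \<beta>)"
    and "\<not> (\<alpha> \<in> Fp_bar \<and> \<beta> \<in> Fp_bar)"
  shows "poly f \<alpha> = poly f \<beta> \<or>
    ((poly f \<beta> - poly f \<alpha>) ^ (p ^ l2 - p ^ l1) = - ((c1 * of_nat s1) / (c2 * of_nat s2)) \<and>
     - ((c1 * of_nat s1) / (c2 * of_nat s2)) \<in> Fp_bar - {0})"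
proof -
  interpret M: binomial_map p l1 l2 s1 s2 c1 c2 by unfold_locales (use assms in auto)
  have pf: "poly f x = M.f x" for x
    using assms by (simp add: M.f_def M.d1_def M.d2_def poly_monom)
  have it: "(poly (shift_poly f l) ^^ n) x = M.it l n x" for l n x
    by (induction n) (simp_all add: shift_poly_def pf)
  \<comment> \<open>A finite orbit cannot be listed injectively by the natural numbers, so two
    iterates collide.\<close>
  have pre: "M.preper l x" if x: "preperiodic (shift_poly f l) x" for l x
  proof -
    have "finite (range (\<lambda>n. M.it l n x))" using x by (simp add: preperiodic_def it)
    then have "\<not> inj (\<lambda>n. M.it l n x)" using infinite_UNIV_nat finite_imageD by blast
    then show ?thesis unfolding M.preper_def inj_def by (metis nat_neq_iff)
  qed
  have sub: "Prep f \<alpha> \<beta> \<subseteq> {l. M.preper l \<alpha> \<and> M.preper l \<beta>}" using pre by (auto simp: Prep_def)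
  interpret C: conjugates p l1 l2 s1 s2 c1 c2 \<alpha> \<beta> ..
  have "{l. M.preper l \<alpha> \<and> M.preper l \<beta>} \<subseteq> (\<Union>n. C.S n \<beta>)"
  proof clarify
    fix l assume "M.preper l \<alpha>" "M.preper l \<beta>"
    then obtain i j where "M.coll i l \<alpha>" "M.coll j l \<beta>" using M.preper_coll by blast
    then have "l \<in> C.S (max i j) \<beta>" using M.coll_mono by (auto simp: C.S_def)
    then show "l \<in> (\<Union>n. C.S n \<beta>)" by blast
  qed
  then have "infinite (\<Union>n. C.S n \<beta>)" using sub assms(18) finite_subset by metis
  then have inf: "\<exists>n. K < card (C.S n \<beta>)" for K
    by (rule infinite_Un_chain_card) (auto simp: C.S_def C.finite_S[unfolded C.S_def] M.coll_mono)
  obtain n0 where "0 < card (C.S n0 \<beta>)" using inf by blast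
  then have n0: "C.S n0 \<beta> \<noteq> {}" by auto
  then obtain l where l: "M.preper l \<alpha>" "M.preper l \<beta>" using M.coll_preper by (auto simp: C.S_def)
  \<comment> \<open>If \<open>\<beta>\<close> is the point outside \<open>Fp_bar\<close>, the common
    parameter \<open>l\<close> transfers this to \<open>\<alpha>\<close>, and the place can be
    chosen for \<open>\<alpha>\<close>.\<close>
  have "\<alpha> \<notin> Fp_bar" using assms(19) M.preper_not_Fp_bar[OF l] by blast
  then obtain V where V: "val_ring V" "\<alpha> \<notin> V" using in_all_val_rings_Fp_bar by blast
  interpret conjugates_place p l1 l2 s1 s2 c1 c2 V \<alpha> \<beta> n0
    by unfold_locales (use V n0 in auto)
  have "M.h (M.f \<beta> - M.f \<alpha>) = 0" by (rule h_vanishes[OF inf])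
  then show ?thesis
    using M.h_zero_imp[of "M.f \<beta> - M.f \<alpha>"] M.ratio_Fp_bar unfolding pf
    by (cases "M.f \<alpha> = M.f \<beta>") simp_all
qed

end
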